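(* Suppose that: the errors $\epsilon_1,\dots,\epsilon_n$ are i.i.d. standard Gaussian and independent of $\{X_i,\bm Z_i\}_{i=1}^n$; $\lVert X\rVert_{\mathcal L_2}\le D_x<\infty$ almost surely, $D_K:=\sup_{t\in\mathcal T}|K(t,t)|<\infty$ and $D_G:=\sup_{\bm z\in\mathcal Z}|G(\bm z,\bm z)|<\infty$; and the eigenvalues satisfy $s_k\le c_1k^{-2r}$ for all $k\ge1$ and some constant $0<r<\infty$, and $\tilde s_k\le c_2k^{-2m}$ for all $k\ge1$ and some constant $0<m<\infty$, where $r>m$. Let the regularization parameters $\lambda=\lambda_n$, $\xi=\xi_n$ satisfy $$\lambda^2\asymp n^{-\frac{2r}{2r+1}},\qquad \xi^2\asymp n^{-\frac{2m}{2m+1}},$$ and suppose that $R=R_n$ and $R_I=R_{I,n}$ with $R^2\asymp\xi^2$ and $R_I^2\asymp\lambda^2$ satisfy $$\lambda^2\lVert\beta^0\rVert_K^2+\xi^2\lVert g^0\rVert_G^2\le\delta^2R^2,\quad \lambda\le\xi\le R,\quad \lambda^2\lVert\beta^0\rVert_K^2\le\delta_I^2R_I^2,\quad \lambda\le R_I\le R\le1,\quad R_I\ge R\lambda/\xi,$$ where $\delta,\delta_I>0$ are (sufficiently) small constants. Then, as $n\to\infty$, $$\lVert\hat f-f^0\rVert^2=\mathcal O_p\big(n^{-2m/(2m+1)}\big),\qquad \lVert\hat g-g^0\rVert^2=\mathcal O_p\big(n^{-2m/(2m+1)}\big),$$ $$\Big\lVert\int_{\mathcal T}X(t)\big(\hat\beta(t)-\beta^0(t)\big)\,dt\Big\rVert^2=\mathcal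 O_p\big(n^{-2r/(2r+1)}\big).$$
   Context: Spaces and kernels. $\mathcal T\subset\mathbb R$ is compact, $\mathcal L_2=\mathcal L_2(\mathcal T)$ is the space of square integrable functions on $\mathcal T$, and $\mathcal Z\subset\mathbb R^p$. $K:\mathcal T\times\mathcal T\to\mathbb R$ and $G:\mathcal Z\times\mathcal Z\to\mathbb R$ are continuous, square integrable, symmetric, nonnegative definite reproducing kernels with reproducing kernel Hilbert spaces $\mathcal H_K,\mathcal H_G$ and norms $\lVert\cdot\rVert_K,\lVert\cdot\rVert_G$. Model. $X$ is a centered square integrable random function with values in $\mathcal L_2$, $\bm Z$ is a random vector in $\mathcal Z$ with distribution $\rho_z$, $\mathbb E[X\mid\bm Z]=0$, and $$Y=\int_{\mathcal T}X(t)\beta^0(t)\,dt+g^0(\bm Z)+\epsilon,\qquad \beta^0\in\mathcal H_K,\ g^0\in\mathcal H_G.$$ $\{(X_i,\bm Z_i,Y_i)\}_{i=1}^n$ is an i.i.d. sample from this model, with errors $\epsilon_i$. The distribution of $(X,\bm Z)$, the kernels, $\beta^0$ and $g^0$ do not depend on $n$. Operators. For a real, symmetric, nonnegative definite kernel $U$ on $\mathcal T\times\mathcal T$, $L_U f(\cdot)=\int_{\mathcal T}U(s,\cdot)f(s)\,ds$ on $\mathcal L_2$, and $L_{U^{1/2}}=L_U^{1/2}$. Let $C(s,t)=\mathbb E[X(s)X(t)]$ and $\mathscr L=L_{K^{1/2}}L_CL_{K^{1/2}}$, with eigenvalues $s_1\ge s_2\ge\dots\ge0$. Let $L_G g(\cdot)=\int_{\mathcal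 Z}G(\bm z,\cdot)g(\bm z)\,d\rho_z(\bm z)$ on the space of $\rho_z$-square-integrable functions, with eigenvalues $\tilde s_1\ge\tilde s_2\ge\dots>0$. Estimator. For regularization parameters $\lambda,\xi>0$, $$(\hat\beta,\hat g)=\mathop{\arg\min}_{\beta\in\mathcal H_K,\,g\in\mathcal H_G}\Big\{\frac1n\sum_{i=1}^n\Big(Y_i-\int_{\mathcal T}X_i(t)\beta(t)\,dt-g(\bm Z_i)\Big)^2+\lambda^2\lVert\beta\rVert_K^2+\xi^2\lVert g\rVert_G^2\Big\}.$$ Put $f^0(X,\bm Z)=\int_{\mathcal T}X(t)\beta^0(t)\,dt+g^0(\bm Z)$ and $\hat f(X,\bm Z)=\int_{\mathcal T}X(t)\hat\beta(t)\,dt+\hat g(\bm Z)$. For a function $f$ of $(X,\bm Z)$, $\lVert f\rVert=\sqrt{\mathbb E f^2(X,\bm Z)}$, the expectation being over the distribution of $(X,\bm Z)$ with $f$ held fixed (so for data-dependent $f$ it is over a copy of $(X,\bm Z)$ independent of the sample). Assumptions. Gaussian assumption: $\epsilon_1,\dots,\epsilon_n$ are i.i.d. standard Gaussian and independent of $\{X_i,\bm Z_i\}_{i=1}^n$. Design assumption: $\lVert X\rVert_{\mathcal L_2}\le D_x<\infty$ almost surely; $D_K:=\sup_{t\in\mathcal T}|K(t,t)|<\infty$; $D_G:=\sup_{\bm z\in\mathcal Z}|G(\bm z,\bm z)|<\infty$. Eigenvalue decay assumption: $s_k\le c_1k^{-2r}$ for all $k\ge1$ and some constant $0<r<\infty$;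 $\tilde s_k\le c_2k^{-2m}$ for all $k\ge1$ and some constant $0<m<\infty$. Standing convention: the functional component is the smoother one, i.e. $r>m$. Notation: $a_n\asymp b_n$ means $C_1\le\liminf a_n/b_n\le\limsup a_n/b_n\le C_2$ for some positive constants $C_1,C_2$; $\mathcal O_p$ denotes boundedness in probability at the given rate. *)

theory Defs
  imports "HOL-Probability.Probability"
begin

section \<open>Square integrable functions\<close>

text \<open>
  Elements of the space of square integrable functions are represented by functions; two of them
  denote the same element iff they agree almost everywhere.
\<close>

definition sq_int :: "'a measure \<Rightarrow> ('a \<Rightarrow> real) set" where
  "sq_int \<mu> = {f. f \<in> borel_measurable \<mu> \<and> integrable \<mu> (\<lambda>x. (f x)\<^sup>2)}"

definition l2_inner :: "'a measure \<Rightarrow> ('a \<Rightarrow> real) \<Rightarrow> ('a \<Rightarrow> real) \<Rightarrow> real" where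
  "l2_inner \<mu> f g = (\<integral>x. f x * g x \<partial>\<mu>)"

definition l2_norm :: "'a measure \<Rightarrow> ('a \<Rightarrow> real) \<Rightarrow> real" where
  "l2_norm \<mu> f = sqrt (l2_inner \<mu> f f)"

text \<open>
  The Borel sigma-algebra of the norm topology, with respect to which random elements of the
  space and their laws are understood. Norm-open sets are unions of almost-everywhere classes.
\<close>

definition l2_borel :: "'a measure \<Rightarrow> ('a \<Rightarrow> real) measure" where
  "l2_borel \<mu> = sigma (sq_int \<mu>)
     {U. U \<subseteq> sq_int \<mu> \<and>
         (\<forall>f\<in>U. \<exists>e>0. \<forall>g\<in>sq_int \<mu>. l2_norm \<mu> (\<lambda>x. g x - f x) < e \<longrightarrow> g \<in> U)}"

section \<open>Operators\<close>

definition kernel_op :: "'a measure \<Rightarrow> ('a \<Rightarrow> 'a \<Rightarrow> real) \<Rightarrow> ('a \<Rightarrow> real) \<Rightarrow> 'a \<Rightarrow> real" where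
  "kernel_op \<mu> U f = (\<lambda>t. \<integral>s. U s t * f s \<partial>\<mu>)"

definition bounded_l2_op :: "'a measure \<Rightarrow> (('a \<Rightarrow> real) \<Rightarrow> 'a \<Rightarrow> real) \<Rightarrow> bool" where
  "bounded_l2_op \<mu> A \<longleftrightarrow>
     (\<forall>f\<in>sq_int \<mu>. A f \<in> sq_int \<mu>) \<and>
     (\<forall>f\<in>sq_int \<mu>. \<forall>g\<in>sq_int \<mu>. \<forall>a b.
        AE x in \<mu>. A (\<lambda>y. a * f y + b * g y) x = a * A f x + b * A g x) \<and>
     (\<exists>B. \<forall>f\<in>sq_int \<mu>. l2_norm \<mu> (A f) \<le> B * l2_norm \<mu> f)"

text \<open>\<open>S\<close> is the nonnegative self-adjoint square root of \<open>A\<close>; it is unique up to null sets.\<close>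

definition l2_sqrt ::
  "'a measure \<Rightarrow> (('a \<Rightarrow> real) \<Rightarrow> 'a \<Rightarrow> real) \<Rightarrow> (('a \<Rightarrow> real) \<Rightarrow> 'a \<Rightarrow> real) \<Rightarrow> bool" where
  "l2_sqrt \<mu> A S \<longleftrightarrow>
     bounded_l2_op \<mu> S \<and>
     (\<forall>f\<in>sq_int \<mu>. \<forall>g\<in>sq_int \<mu>. l2_inner \<mu> (S f) g = l2_inner \<mu> f (S g)) \<and>
     (\<forall>f\<in>sq_int \<mu>. 0 \<le> l2_inner \<mu> (S f) f) \<and>
     (\<forall>f\<in>sq_int \<mu>. AE x in \<mu>. S (S f) x = A f x)"

text \<open>
  \<open>s 1 \<ge> s 2 \<ge> \<dots> \<ge> 0\<close> are the eigenvalues of the compact self-adjoint nonnegative operator \<open>A\<close>,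
  repeated according to multiplicity; if \<open>A\<close> has finite rank, the sequence continues with zeros.
  The last condition says that no positive eigenvalue is missed: \<open>A\<close> vanishes on the orthogonal
  complement of the listed eigenfunctions. The value \<open>s 0\<close> is irrelevant.
\<close>

definition l2_eigenvalues ::
  "'a measure \<Rightarrow> (('a \<Rightarrow> real) \<Rightarrow> 'a \<Rightarrow> real) \<Rightarrow> (nat \<Rightarrow> real) \<Rightarrow> bool" where
  "l2_eigenvalues \<mu> A s \<longleftrightarrow>
     (\<forall>k\<ge>1. 0 \<le> s k) \<and>
     (\<forall>j k. 1 \<le> j \<longrightarrow> j \<le> k \<longrightarrow> s k \<le> s j) \<and>
     (\<exists>\<phi>. let I = {k. 1 \<le> k \<and> 0 < s k} in
        (\<forall>k\<in>I. \<phi> k \<in> sq_int \<mu>) \<and>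
        (\<forall>j\<in>I. \<forall>k\<in>I. l2_inner \<mu> (\<phi> j) (\<phi> k) = (if j = k then 1 else 0)) \<and>
        (\<forall>k\<in>I. AE x in \<mu>. A (\<phi> k) x = s k * \<phi> k x) \<and>
        (\<forall>f\<in>sq_int \<mu>. (\<forall>k\<in>I. l2_inner \<mu> f (\<phi> k) = 0) \<longrightarrow> (AE x in \<mu>. A f x = 0)))"

section \<open>Reproducing kernel Hilbert spaces\<close>

definition nonneg_definite_kernel :: "'a set \<Rightarrow> ('a \<Rightarrow> 'a \<Rightarrow> real) \<Rightarrow> bool" where
  "nonneg_definite_kernel S k \<longleftrightarrow>
     (\<forall>x\<in>S. \<forall>y\<in>S. k x y = k y x) \<and>
     (\<forall>F c. finite F \<longrightarrow> F \<subseteq> S \<longrightarrow> 0 \<le> (\<Sum>x\<in>F. \<Sum>y\<in>F. c x * c y * k x y))"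

text \<open>
  Functions on \<open>S\<close> are represented by total functions vanishing outside \<open>S\<close>, so that they form a
  vector space under the pointwise operations.
\<close>

definition hilbert_function_space ::
  "'a set \<Rightarrow> ('a \<Rightarrow> real) set \<Rightarrow> (('a \<Rightarrow> real) \<Rightarrow> ('a \<Rightarrow> real) \<Rightarrow> real) \<Rightarrow> bool" where
  "hilbert_function_space S H ip \<longleftrightarrow>
     (\<forall>f\<in>H. \<forall>x. x \<notin> S \<longrightarrow> f x = 0) \<and>
     (\<lambda>x. 0) \<in> H \<and>
     (\<forall>f\<in>H. \<forall>g\<in>H. \<forall>a b. (\<lambda>x. a * f x + b * g x) \<in> H) \<and>
     (\<forall>f\<in>H. \<forall>g\<in>H. ip f g = ip g f) \<and>
     (\<forall>f\<in>H. \<forall>g\<in>H. \<forall>h\<in>H. \<forall>a b. ip (\<lambda>x. a * f x + b * g x) h = a * ip f h + b * ip g h) \<and>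
     (\<forall>f\<in>H. 0 \<le> ip f f) \<and>
     (\<forall>f\<in>H. ip f f = 0 \<longrightarrow> f = (\<lambda>x. 0)) \<and>
     (\<forall>F. (\<forall>n::nat. F n \<in> H) \<longrightarrow>
        (\<forall>e>0. \<exists>N. \<forall>m\<ge>N. \<forall>n\<ge>N. sqrt (ip (\<lambda>x. F m x - F n x) (\<lambda>x. F m x - F n x)) < e) \<longrightarrow>
        (\<exists>f\<in>H. (\<lambda>n. sqrt (ip (\<lambda>x. F n x - f x) (\<lambda>x. F n x - f x))) \<longlonglongrightarrow> 0))"

text \<open>By the Moore--Aronszajn theorem, \<open>k\<close> determines \<open>H\<close> and the values of \<open>ip\<close> on \<open>H\<close>.\<close>

definition rkhs ::
  "'a set \<Rightarrow> ('a \<Rightarrow> 'a \<Rightarrow> real) \<Rightarrow> ('a \<Rightarrow> real) set \<Rightarrow>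
   (('a \<Rightarrow> real) \<Rightarrow> ('a \<Rightarrow> real) \<Rightarrow> real) \<Rightarrow> bool" where
  "rkhs S k H ip \<longleftrightarrow>
     hilbert_function_space S H ip \<and>
     (\<forall>x\<in>S. (\<lambda>y. if y \<in> S then k x y else 0) \<in> H \<and>
        (\<forall>f\<in>H. ip f (\<lambda>y. if y \<in> S then k x y else 0) = f x))"

definition rkhs_norm ::
  "(('a \<Rightarrow> real) \<Rightarrow> ('a \<Rightarrow> real) \<Rightarrow> real) \<Rightarrow> ('a \<Rightarrow> real) \<Rightarrow> real" where
  "rkhs_norm ip f = sqrt (ip f f)"

section \<open>The partially linear functional model\<close>

definition plm_fun ::
  "real set \<Rightarrow> (real \<Rightarrow> real) \<Rightarrow> ('z \<Rightarrow> real) \<Rightarrow> (real \<Rightarrow> real) \<times> 'z \<Rightarrow> real" where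
  "plm_fun T \<beta> g = (\<lambda>(x, z). (\<integral>t. x t * \<beta> t \<partial>lebesgue_on T) + g z)"

definition cov_kernel :: "'w measure \<Rightarrow> ('w \<Rightarrow> real \<Rightarrow> real) \<Rightarrow> real \<Rightarrow> real \<Rightarrow> real" where
  "cov_kernel P X s t = (\<integral>\<omega>. X \<omega> s * X \<omega> t \<partial>P)"

text \<open>The conditional expectation of \<open>X\<close> given \<open>Z\<close> is the random function whose value at \<open>t\<close> is
  that of \<open>X t\<close>; as elements of the function space, it is zero if it is for almost every \<open>t\<close>.\<close>

definition cond_exp_zero ::
  "'w measure \<Rightarrow> real set \<Rightarrow> 'z measure \<Rightarrow> ('w \<Rightarrow> real \<Rightarrow> real) \<Rightarrow> ('w \<Rightarrow> 'z) \<Rightarrow> bool" where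
  "cond_exp_zero P T N X Z \<longleftrightarrow>
     (AE t in lebesgue_on T. AE \<omega> in P.
        real_cond_exp P (vimage_algebra (space P) Z N) (\<lambda>\<omega>'. X \<omega>' t) \<omega> = 0)"

text \<open>The norm of a fixed function \<open>f\<close> of the random element \<open>V\<close>.\<close>

definition rv_norm :: "'w measure \<Rightarrow> ('w \<Rightarrow> 'v) \<Rightarrow> ('v \<Rightarrow> real) \<Rightarrow> real" where
  "rv_norm P V f = sqrt (\<integral>\<omega>. (f (V \<omega>))\<^sup>2 \<partial>P)"

definition plm_objective ::
  "real set \<Rightarrow> ((real \<Rightarrow> real) \<Rightarrow> (real \<Rightarrow> real) \<Rightarrow> real) \<Rightarrow> (('z \<Rightarrow> real) \<Rightarrow> ('z \<Rightarrow> real) \<Rightarrow> real) \<Rightarrow>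
   real \<Rightarrow> real \<Rightarrow> nat \<Rightarrow> (nat \<Rightarrow> real \<Rightarrow> real) \<Rightarrow> (nat \<Rightarrow> 'z) \<Rightarrow> (nat \<Rightarrow> real) \<Rightarrow>
   (real \<Rightarrow> real) \<times> ('z \<Rightarrow> real) \<Rightarrow> real" where
  "plm_objective T ipK ipG lam \<xi> n x z y = (\<lambda>(\<beta>, g).
     (1 / real n) * (\<Sum>i<n. (y i - (\<integral>t. x i t * \<beta> t \<partial>lebesgue_on T) - g (z i))\<^sup>2)
     + lam\<^sup>2 * (rkhs_norm ipK \<beta>)\<^sup>2 + \<xi>\<^sup>2 * (rkhs_norm ipG g)\<^sup>2)"

section \<open>Asymptotic notation\<close>

definition same_order :: "(nat \<Rightarrow> real) \<Rightarrow> (nat \<Rightarrow> real) \<Rightarrow> bool" where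
  "same_order a b \<longleftrightarrow>
     (\<exists>C1>0. \<exists>C2>0. ereal C1 \<le> liminf (\<lambda>n. ereal (a n / b n)) \<and>
                     limsup (\<lambda>n. ereal (a n / b n)) \<le> ereal C2)"

text \<open>
  Boundedness in probability at rate \<open>b\<close>. The exceptional event is covered by a measurable set
  because \<^const>\<open>measure\<close> is zero on non-measurable sets; for measurable \<open>V n\<close> this is
  the usual definition.
\<close>

definition bigO_prob :: "'w measure \<Rightarrow> (nat \<Rightarrow> 'w \<Rightarrow> real) \<Rightarrow> (nat \<Rightarrow> real) \<Rightarrow> bool" where
  "bigO_prob Q V b \<longleftrightarrow>
     (\<forall>\<epsilon>>0. \<exists>C>0. \<forall>\<^sub>F n in sequentially.
        \<exists>A\<in>sets Q. {\<omega> \<in> space Q. \<bar>V n \<omega>\<bar> > C * b n} \<subseteq> A \<and> measure Q A \<le> \<epsilon>)"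

end

theory Submission
  imports Defs
begin

text \<open>
  The estimator is analysed by second moments only. In each reproducing kernel space there is an
  orthonormal system \<open>v\<^sub>k\<close> whose members are uncorrelated with variances \<open>s\<^sub>k\<close> as functionals of the
  covariate, and almost surely every element of the space acts on the covariate through its
  coefficients along this system. With respect to the norm \<open>\<Sum> (s\<^sub>k + b) c\<^sub>k\<^sup>2\<close>, the deviation of the
  empirical from the population quadratic form has mean squared Hilbert--Schmidt norm at most
  \<open>\<kappa> N(b) / (n b)\<close>, where \<open>\<kappa>\<close> bounds the squared feature norm and \<open>N(b) = \<Sum> s\<^sub>k / (s\<^sub>k + b)\<close>. At \<open>b = \<lambda>\<^sup>2\<close>
  this is merely bounded, as \<open>N(\<lambda>\<^sup>2) = O(n \<lambda>\<^sup>2)\<close>; it becomes small at \<open>b = L \<lambda>\<^sup>2\<close> with a large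
  constant \<open>L\<close>, and a constant factor in \<open>b\<close> is absorbed by the penalty. Since \<open>E[X | Z] = 0\<close>, the
  empirical cross term between the two components is centered, and the same computation with the
  smaller effective dimension \<open>N(\<lambda>\<^sup>2)\<close> bounds it by \<open>O(\<lambda> / \<xi>)\<close> times the product of the two norms.
  Testing the normal equations with the total error gives the rate \<open>\<xi>\<close>, and testing them with the
  functional error alone then gives the rate \<open>\<lambda>\<close> for the functional component.
\<close>

section \<open>Hilbert spaces of functions\<close>

text \<open>The estimator depends on the sample, so its error cannot be inserted into a law of large
  numbers for one fixed function. Every empirical bound is therefore stated on a single event for
  all coefficient sequences at once. The Hilbert-Schmidt norm makes this cheap: it dominates the
  operator norm, and its mean square is a sum of variances, so Markov's inequality suffices. In a
  product of two features one factor is bounded pointwise and only the other is summed, which avoids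
  fourth moments. For the cross term the choice of factor is decisive: bounding the functional
  features pointwise and summing the nonparametric ones would give the order
  \<open>\<xi> / \<lambda>\<close>, which diverges. The systems \<open>v\<close> need not span the
  kernel spaces: a direction orthogonal to them acts on the covariate as zero almost surely and is
  seen by the penalty alone. The total error has to be tested first because the equation for the
  functional error still contains the nonparametric error through the cross term.\<close>

locale hfs =
  fixes S :: "'a set" and H :: "('a \<Rightarrow> real) set" and ip :: "('a \<Rightarrow> real) \<Rightarrow> ('a \<Rightarrow> real) \<Rightarrow> real"
  assumes hfs: "hilbert_function_space S H ip"
begin

lemma lin_mem: "f \<in> H \<Longrightarrow> g \<in> H \<Longrightarrow> (\<lambda>x. a * f x + b * g x) \<in> H"
  and zero_mem: "(\<lambda>x. 0) \<in> H"
  and ip_commute: "f \<in> H \<Longrightarrow> g \<in> H \<Longrightarrow> ip f g = ip g f"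
  and ip_lin: "f \<in> H \<Longrightarrow> g \<in> H \<Longrightarrow> h \<in> H \<Longrightarrow>
      ip (\<lambda>x. a * f x + b * g x) h = a * ip f h + b * ip g h"
  and ip_ge0: "f \<in> H \<Longrightarrow> 0 \<le> ip f f"
  and ip_eq0: "f \<in> H \<Longrightarrow> ip f f = 0 \<Longrightarrow> f = (\<lambda>x. 0)"
  and complete: "(\<And>n::nat. F n \<in> H) \<Longrightarrow>
      (\<And>e. e > 0 \<Longrightarrow> \<exists>N. \<forall>m\<ge>N. \<forall>n\<ge>N. rkhs_norm ip (\<lambda>x. F m x - F n x) < e) \<Longrightarrow>
      \<exists>f\<in>H. (\<lambda>n. rkhs_norm ip (\<lambda>x. F n x - f x)) \<longlonglongrightarrow> 0"
  using hfs unfolding hilbert_function_space_def rkhs_norm_def by blast+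

lemma diff_mem: "f \<in> H \<Longrightarrow> g \<in> H \<Longrightarrow> (\<lambda>x. f x - g x) \<in> H"
  using lin_mem[of f g 1 "-1"] by simp

lemma scale_mem: "f \<in> H \<Longrightarrow> (\<lambda>x. a * f x) \<in> H"
  using lin_mem[of f f a 0] by simp

lemma ip_diff: "f \<in> H \<Longrightarrow> g \<in> H \<Longrightarrow> h \<in> H \<Longrightarrow> ip (\<lambda>x. f x - g x) h = ip f h - ip g h"
  using ip_lin[of f g h 1 "-1"] by simp

lemma ip_scale: "f \<in> H \<Longrightarrow> h \<in> H \<Longrightarrow> ip (\<lambda>x. a * f x) h = a * ip f h"
  using ip_lin[of f f h a 0] by simp

lemma ip_scale2: "f \<in> H \<Longrightarrow> h \<in> H \<Longrightarrow> ip h (\<lambda>x. a * f x) = a * ip h f"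
  using ip_scale[of f h a] ip_commute[of h f] ip_commute[of h "\<lambda>x. a * f x"] scale_mem[of f a] by simp

lemma ip_zero: "h \<in> H \<Longrightarrow> ip (\<lambda>x. 0) h = 0" "h \<in> H \<Longrightarrow> ip h (\<lambda>x. 0) = 0"
  using ip_scale[of h h 0] ip_commute zero_mem by fastforce+

lemma ip_square:
  assumes "f \<in> H" "g \<in> H"
  shows "ip (\<lambda>x. a * f x + b * g x) (\<lambda>x. a * f x + b * g x)
    = a\<^sup>2 * ip f f + 2 * a * b * ip f g + b\<^sup>2 * ip g g"
proof -
  let ?h = "\<lambda>x. a * f x + b * g x"
  have h: "?h \<in> H" using assms lin_mem by auto
  have "ip f ?h = a * ip f f + b * ip f g" "ip g ?h = a * ip f g + b * ip g g"
    using ip_lin[OF assms assms(1), of a b] ip_lin[OF assms assms(2), of a b]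
      ip_commute[OF assms(1) h] ip_commute[OF assms(2) h] ip_commute[OF assms] by simp_all
  then show ?thesis
    using ip_lin[OF assms h, of a b] by (simp add: power2_eq_square algebra_simps)
qed

lemma norm_sq: "f \<in> H \<Longrightarrow> (rkhs_norm ip f)\<^sup>2 = ip f f"
  unfolding rkhs_norm_def using ip_ge0 by simp

lemma norm_ge0: "f \<in> H \<Longrightarrow> 0 \<le> rkhs_norm ip f"
  unfolding rkhs_norm_def using ip_ge0 by simp

lemma Cauchy_Schwarz:
  assumes "f \<in> H" "g \<in> H"
  shows "\<bar>ip f g\<bar> \<le> rkhs_norm ip f * rkhs_norm ip g"
proof -
  have "(ip f g)\<^sup>2 \<le> ip f f * ip g g"
  proof (cases "ip g g = 0")
    case True
    then have "g = (\<lambda>x. 0)" using ip_eq0 assms by auto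
    then show ?thesis using ip_zero assms by auto
  next
    case False
    then have pos: "ip g g > 0" using ip_ge0[OF assms(2)] by simp
    have "0 \<le> ip (\<lambda>x. ip g g * f x + (- ip f g) * g x) (\<lambda>x. ip g g * f x + (- ip f g) * g x)"
      using ip_ge0 lin_mem assms by blast
    also have "\<dots> = ip g g * (ip f f * ip g g - (ip f g)\<^sup>2)"
      unfolding ip_square[OF assms] by (simp add: power2_eq_square algebra_simps)
    finally show ?thesis using pos by (simp add: zero_le_mult_iff)
  qed
  then have "sqrt ((ip f g)\<^sup>2) \<le> sqrt (ip f f * ip g g)" by (rule real_sqrt_le_mono)
  then show ?thesis by (simp add: rkhs_norm_def real_sqrt_mult)
qed

text \<open>The representer is the minimizer of \<open>\<Phi> f = ip f f - 2 * F f\<close>, which is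
  bounded below because \<open>F\<close> is bounded. The parallelogram identity \<open>par\<close>
  makes a minimizing sequence Cauchy, and near-minimality along the line in direction
  \<open>p\<close> forces its inner product with \<open>p\<close> towards
  \<open>F p\<close>.\<close>

lemma riesz:
  assumes lin: "\<And>f g a b. f \<in> H \<Longrightarrow> g \<in> H \<Longrightarrow> F (\<lambda>x. a * f x + b * g x) = a * F f + b * F g"
    and bnd: "\<And>f. f \<in> H \<Longrightarrow> \<bar>F f\<bar> \<le> \<kappa> * rkhs_norm ip f"
  shows "\<exists>h\<in>H. \<forall>f\<in>H. F f = ip f h"
proof -
  define \<Phi> where "\<Phi> f = ip f f - 2 * F f" for f
  define I where "I = Inf (\<Phi> ` H)"
  have lb: "\<Phi> f \<ge> - \<kappa>\<^sup>2" if "f \<in> H" for f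
  proof -
    have "0 \<le> (rkhs_norm ip f - \<kappa>)\<^sup>2" by simp
    then show ?thesis using bnd[OF that] norm_sq[OF that] unfolding \<Phi>_def
      by (simp add: power2_diff algebra_simps abs_le_iff)
  qed
  have bdd: "bdd_below (\<Phi> ` H)" using lb by (auto intro!: bdd_belowI)
  have I_le: "I \<le> \<Phi> f" if "f \<in> H" for f
    unfolding I_def using that by (intro cInf_lower[OF _ bdd]) auto
  have "\<exists>f\<in>H. \<Phi> f < I + inverse (real (Suc n))" for n
  proof -
    have "\<exists>y\<in>\<Phi> ` H. y < I + inverse (real (Suc n))"
      using cInf_lessD[of "\<Phi> ` H" "I + inverse (real (Suc n))"] zero_mem unfolding I_def by auto
    then show ?thesis by auto
  qed
  then have "\<forall>n. \<exists>f. f \<in> H \<and> \<Phi> f < I + inverse (real (Suc n))" by blast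
  from choice[OF this] obtain f
    where fH: "\<And>n. f n \<in> H" and f: "\<And>n. \<Phi> (f n) < I + inverse (real (Suc n))" by auto
  have \<Phi>_sq: "\<Phi> (\<lambda>x. a * p x + b * q x)
      = a\<^sup>2 * ip p p + 2 * a * b * ip p q + b\<^sup>2 * ip q q - 2 * a * F p - 2 * b * F q"
    if "p \<in> H" "q \<in> H" for p q a b
    unfolding \<Phi>_def using ip_square[OF that] lin[OF that] by simp
  have par: "ip (\<lambda>x. p x - q x) (\<lambda>x. p x - q x)
     = 2 * \<Phi> p + 2 * \<Phi> q - 4 * \<Phi> (\<lambda>x. (1/2) * p x + (1/2) * q x)" if "p \<in> H" "q \<in> H" for p q
    using ip_square[OF that, of 1 "-1"] \<Phi>_sq[OF that, of "1/2" "1/2"]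
    by (simp add: \<Phi>_def power2_eq_square)
  have cau: "ip (\<lambda>x. f m x - f n x) (\<lambda>x. f m x - f n x)
      \<le> 2 * inverse (real (Suc m)) + 2 * inverse (real (Suc n))" for m n
    using par[OF fH fH, of m n] f[of m] f[of n] I_le[OF lin_mem[OF fH fH], of "1/2" m "1/2" n]
    by linarith
  have "\<exists>N. \<forall>m\<ge>N. \<forall>n\<ge>N. rkhs_norm ip (\<lambda>x. f m x - f n x) < e" if "e > 0" for e
  proof -
    have "e\<^sup>2/4 > 0" using that by simp
    then obtain N where N: "inverse (real (Suc N)) < e\<^sup>2/4" using reals_Archimedean by blast
    have "rkhs_norm ip (\<lambda>x. f m x - f n x) < e" if "m \<ge> N" "n \<ge> N" for m n
    proof -
      have "inverse (real (Suc m)) \<le> inverse (real (Suc N))"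
        "inverse (real (Suc n)) \<le> inverse (real (Suc N))" using that by (auto intro!: le_imp_inverse_le)
      then have "ip (\<lambda>x. f m x - f n x) (\<lambda>x. f m x - f n x) < e\<^sup>2" using cau[of m n] N by linarith
      from real_sqrt_less_mono[OF this] show ?thesis unfolding rkhs_norm_def using \<open>e > 0\<close> by simp
    qed
    then show ?thesis by blast
  qed
  then obtain h where h: "h \<in> H" and lim: "(\<lambda>n. rkhs_norm ip (\<lambda>x. f n x - h x)) \<longlonglongrightarrow> 0"
    using complete[of f] fH by blast
  have "F p = ip p h" if p: "p \<in> H" for p
  proof -
    have q: "(ip (f n) p - F p)\<^sup>2 \<le> (ip p p + 1) * inverse (real (Suc n))" for n
    proof -
      define d where "d = ip (f n) p - F p"
      \<comment> \<open>This \<open>t\<close> minimizes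
        \<open>2 * t * d + t\<^sup>2 * (ip p p + 1)\<close>; the added 1 keeps the denominator
        positive when \<open>p\<close> is zero.\<close>
      define t where "t = - d / (ip p p + 1)"
      have pp: "ip p p + 1 > 0" using ip_ge0[OF p] by simp
      have "I \<le> \<Phi> (\<lambda>x. 1 * f n x + t * p x)" using I_le lin_mem fH p by blast
      also have "\<dots> = \<Phi> (f n) + 2 * t * d + t\<^sup>2 * ip p p"
        unfolding \<Phi>_sq[OF fH p] by (simp add: \<Phi>_def d_def algebra_simps)
      also have "\<dots> \<le> \<Phi> (f n) + 2 * t * d + t\<^sup>2 * (ip p p + 1)"
        by (simp add: mult_left_mono)
      finally have "I \<le> \<Phi> (f n) + (2 * t * d + t\<^sup>2 * (ip p p + 1))" by simp
      also have "2 * t * d + t\<^sup>2 * (ip p p + 1) = - (d\<^sup>2 / (ip p p + 1))"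
        using pp unfolding t_def by (simp add: power2_eq_square divide_simps)
      finally have "d\<^sup>2 / (ip p p + 1) \<le> inverse (real (Suc n))" using f[of n] by linarith
      then show ?thesis using pp by (simp add: d_def field_simps)
    qed
    have "(\<lambda>n. (ip (f n) p - F p)\<^sup>2) \<longlonglongrightarrow> 0"
    proof (rule Lim_null_comparison)
      show "\<forall>\<^sub>F n in sequentially. norm ((ip (f n) p - F p)\<^sup>2)
          \<le> (ip p p + 1) * inverse (real (Suc n))" using q by simp
      show "(\<lambda>n. (ip p p + 1) * inverse (real (Suc n))) \<longlonglongrightarrow> 0"
        using tendsto_mult_left[OF LIMSEQ_inverse_real_of_nat, of "ip p p + 1"] by simp
    qed
    then have 1: "(\<lambda>n. ip (f n) p) \<longlonglongrightarrow> F p"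
      using tendsto_real_sqrt[of "\<lambda>n. (ip (f n) p - F p)\<^sup>2" 0]
      by (simp add: tendsto_rabs_zero_iff LIM_zero_iff)
    have "(\<lambda>n. ip (\<lambda>x. f n x - h x) p) \<longlonglongrightarrow> 0"
    proof (rule Lim_null_comparison)
      show "(\<lambda>n. rkhs_norm ip (\<lambda>x. f n x - h x) * rkhs_norm ip p) \<longlonglongrightarrow> 0"
        using tendsto_mult_right[OF lim, of "rkhs_norm ip p"] by simp
    qed (use Cauchy_Schwarz diff_mem fH h p in auto)
    then have "(\<lambda>n. ip (f n) p - ip h p) \<longlonglongrightarrow> 0" using ip_diff fH h p by simp
    then have "(\<lambda>n. ip (f n) p) \<longlonglongrightarrow> ip h p" by (simp add: LIM_zero_iff)
    then show ?thesis using LIMSEQ_unique[OF 1] ip_commute[OF h p] by simp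
  qed
  then show ?thesis using h by blast
qed

text \<open>Zero members are allowed so that a system indexed by all natural numbers can come from
  an operator of finite rank and can be padded at index 0.\<close>

definition ortho_system :: "(nat \<Rightarrow> 'a \<Rightarrow> real) \<Rightarrow> bool" where
  "ortho_system v \<longleftrightarrow> (\<forall>k. v k \<in> H) \<and> (\<forall>j k. j \<noteq> k \<longrightarrow> ip (v j) (v k) = 0) \<and>
     (\<forall>k. ip (v k) (v k) = 1 \<or> v k = (\<lambda>x. 0))"

lemma bessel_partial:
  assumes v: "ortho_system v" and f: "f \<in> H"
  shows "(\<Sum>k<J. (ip f (v k))\<^sup>2) \<le> ip f f"
proof -
  have vH: "v k \<in> H" for k using v by (auto simp: ortho_system_def)
  define p where "p J x = (\<Sum>k<J. ip f (v k) * v k x)" for J :: nat and x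
  have pS: "p (Suc J) = (\<lambda>x. 1 * p J x + ip f (v J) * v J x)" for J by (simp add: p_def fun_eq_iff)
  have pH: "p J \<in> H" for J
  proof (induction J)
    case 0 show ?case using zero_mem by (simp add: p_def)
  next
    case (Suc J) then show ?case unfolding pS using lin_mem vH by blast
  qed
  have p0: "p 0 = (\<lambda>x. 0)" by (simp add: p_def fun_eq_iff)
  have pv: "ip (p J) (v k) = 0" if "J \<le> k" for J k using that
  proof (induction J)
    case 0 then show ?case using ip_zero vH p0 by simp
  next
    case (Suc J) then show ?case unfolding pS ip_lin[OF pH vH vH] using v
      by (simp add: ortho_system_def)
  qed
  have fv: "ip f (v k) * ip f (v k) * ip (v k) (v k) = (ip f (v k))\<^sup>2" for k
    using v ip_zero f by (cases "v k = (\<lambda>x. 0)") (auto simp: ortho_system_def power2_eq_square)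
  have pp: "ip (p J) (p J) = (\<Sum>k<J. (ip f (v k))\<^sup>2)" for J
  proof (induction J)
    case 0 then show ?case using ip_zero zero_mem p0 by simp
  next
    case (Suc J) then show ?case unfolding pS ip_square[OF pH vH] using pv[of J J] fv[of J]
      by (simp add: power2_eq_square)
  qed
  have pf: "ip (p J) f = (\<Sum>k<J. (ip f (v k))\<^sup>2)" for J
  proof (induction J)
    case 0 then show ?case using ip_zero f p0 by simp
  next
    case (Suc J) then show ?case unfolding pS ip_lin[OF pH vH f] using ip_commute[OF f vH]
      by (simp add: power2_eq_square)
  qed
  have "0 \<le> ip (\<lambda>x. 1 * f x + (-1) * p J x) (\<lambda>x. 1 * f x + (-1) * p J x)"
    using ip_ge0 lin_mem f pH by blast
  then show ?thesis unfolding ip_square[OF f pH] using pp[of J] pf[of J] ip_commute[OF f pH]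
    by simp
qed

text \<open>The orthogonal projection of \<open>h\<close> onto the closed span of \<open>v\<close>
  is obtained as the Riesz representer of the functional with values
  \<open>\<Sum>k. ip f (v k) * ip h (v k)\<close>, which Bessel's inequality makes absolutely
  convergent and bounded. Convergence is claimed only after pairing with each \<open>f\<close>, the
  form in which functionals are expanded later.\<close>

lemma projection:
  assumes v: "ortho_system v" and h: "h \<in> H"
  shows "\<exists>p\<in>H. (\<forall>f\<in>H. (\<lambda>k. ip f (v k) * ip h (v k)) sums ip f p) \<and> (\<forall>k. ip p (v k) = ip h (v k))"
proof -
  have vH: "v k \<in> H" for k using v by (auto simp: ortho_system_def)
  define F where "F f = (\<Sum>k. ip f (v k) * ip h (v k))" for f
  have part: "(\<Sum>k<J. \<bar>ip f (v k) * ip h (v k)\<bar>) \<le> rkhs_norm ip f * rkhs_norm ip h"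
    if "f \<in> H" for f J
  proof -
    have "(\<Sum>k<J. \<bar>ip f (v k) * ip h (v k)\<bar>)
      \<le> L2_set (\<lambda>k. ip f (v k)) {..<J} * L2_set (\<lambda>k. ip h (v k)) {..<J}"
      unfolding abs_mult by (rule L2_set_mult_ineq)
    also have "\<dots> \<le> rkhs_norm ip f * rkhs_norm ip h"
      unfolding L2_set_def rkhs_norm_def
      using bessel_partial[OF v that] bessel_partial[OF v h] ip_ge0 that h
      by (intro mult_mono real_sqrt_le_mono) (auto intro: sum_nonneg)
    finally show ?thesis .
  qed
  have sabs: "summable (\<lambda>k. \<bar>ip f (v k) * ip h (v k)\<bar>)" if "f \<in> H" for f
    by (rule summableI_nonneg_bounded[OF _ part[OF that]]) simp
  have summ: "(\<lambda>k. ip f (v k) * ip h (v k)) sums F f" if "f \<in> H" for f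
    unfolding F_def by (intro summable_sums summable_rabs_cancel[OF sabs[OF that]])
  have lin: "F (\<lambda>x. a * f x + b * g x) = a * F f + b * F g" if "f \<in> H" "g \<in> H" for f g a b
  proof -
    have "(\<lambda>k. a * (ip f (v k) * ip h (v k)) + b * (ip g (v k) * ip h (v k))) sums (a * F f + b * F g)"
      by (intro sums_add sums_mult summ that)
    then have "(\<lambda>k. ip (\<lambda>x. a * f x + b * g x) (v k) * ip h (v k)) sums (a * F f + b * F g)"
      unfolding ip_lin[OF that vH] by (simp add: algebra_simps)
    then show ?thesis using summ[OF lin_mem[OF that, of a b]] sums_unique2 by blast
  qed
  have bnd: "\<bar>F f\<bar> \<le> rkhs_norm ip h * rkhs_norm ip f" if "f \<in> H" for f
  proof -
    have "\<bar>F f\<bar> \<le> (\<Sum>k. \<bar>ip f (v k) * ip h (v k)\<bar>)" unfolding F_def by (rule summable_rabs[OF sabs[OF that]])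
    also have "\<dots> \<le> rkhs_norm ip f * rkhs_norm ip h" by (rule suminf_le_const[OF sabs[OF that] part[OF that]])
    finally show ?thesis by (simp add: mult.commute)
  qed
  obtain p where p: "p \<in> H" "\<forall>f\<in>H. F f = ip f p" using riesz[OF lin bnd] by blast
  have "ip p (v k) = ip h (v k)" for k
  proof -
    have "(\<lambda>j. ip (v k) (v j) * ip h (v j)) sums (ip (v k) (v k) * ip h (v k))"
    proof -
      have "(\<lambda>j. ip (v k) (v j) * ip h (v j))
          = (\<lambda>j. if j = k then ip (v k) (v j) * ip h (v j) else 0)"
        using v by (auto simp: ortho_system_def fun_eq_iff)
      then show ?thesis using sums_single[of k "\<lambda>j. ip (v k) (v j) * ip h (v j)"] by simp
    qed
    moreover have "ip (v k) (v k) * ip h (v k) = ip h (v k)"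
      using v ip_zero h by (cases "v k = (\<lambda>x. 0)") (auto simp: ortho_system_def)
    ultimately have "F (v k) = ip h (v k)" using summ[OF vH[of k]] sums_unique2 by fastforce
    then show ?thesis using p vH ip_commute[OF p(1) vH[of k]] by simp
  qed
  then show ?thesis using p summ by auto
qed

text \<open>The exceptional null set does not depend on \<open>f\<close>: the Riesz representer of \<open>act w\<close>, less its
  projection onto the span of \<open>v\<close>, is orthogonal to the countable separating set \<open>D\<close> for almost
  every \<open>w\<close>.\<close>

lemma expansion_AE:
  assumes lin: "\<And>w f g a b. w \<in> space M \<Longrightarrow> f \<in> H \<Longrightarrow> g \<in> H \<Longrightarrow>
      act w (\<lambda>x. a * f x + b * g x) = a * act w f + b * act w g"
    and bnd: "AE w in M. \<forall>f\<in>H. \<bar>act w f\<bar> \<le> \<kappa> * rkhs_norm ip f"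
    and v: "ortho_system v"
    and null: "\<And>f. f \<in> H \<Longrightarrow> (\<And>k. ip f (v k) = 0) \<Longrightarrow> AE w in M. act w f = 0"
    and D: "countable D" "D \<subseteq> H" "\<And>f. f \<in> H \<Longrightarrow> (\<And>d. d \<in> D \<Longrightarrow> ip f d = 0) \<Longrightarrow> f = (\<lambda>x. 0)"
    and \<kappa>: "\<kappa> \<ge> 0"
  shows "AE w in M. (\<forall>f\<in>H. (\<lambda>k. ip f (v k) * act w (v k)) sums act w f) \<and>
    (\<forall>J. (\<Sum>k<J. (act w (v k))\<^sup>2) \<le> \<kappa>\<^sup>2)"
proof -
  have vH: "v k \<in> H" for k using v by (auto simp: ortho_system_def)
  define Q where "Q h p \<longleftrightarrow> p \<in> H \<and> (\<forall>f\<in>H. (\<lambda>k. ip f (v k) * ip h (v k)) sums ip f p) \<and>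
      (\<forall>k. ip p (v k) = ip h (v k))" for h p
  define pr where "pr h = Eps (Q h)" for h
  have "Q h (pr h)" if "h \<in> H" for h
  proof -
    have "\<exists>p. Q h p" using projection[OF v that] unfolding Q_def by (elim bexE) (rule exI, blast)
    then show ?thesis unfolding pr_def by (rule someI_ex)
  qed
  then have prH: "pr h \<in> H" and pr: "f \<in> H \<Longrightarrow> (\<lambda>k. ip f (v k) * ip h (v k)) sums ip f (pr h)"
    and prv: "ip (pr h) (v k) = ip h (v k)" if "h \<in> H" for f h k
    using that unfolding Q_def by blast+
  \<comment> \<open>Self-adjointness moves the projection from the representer of
    \<open>act w\<close>, which varies with \<open>w\<close>, to the separating elements, of which
    there are only countably many.\<close>
  have sym: "ip f (pr h) = ip (pr f) h" if "f \<in> H" "h \<in> H" for f h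
  proof -
    have "(\<lambda>k. ip f (v k) * ip h (v k)) sums ip h (pr f)"
      using pr[OF that] by (simp add: mult.commute)
    then have "ip f (pr h) = ip h (pr f)" using sums_unique2 pr[OF that(2,1)] by blast
    then show ?thesis using ip_commute[OF that(2) prH[OF that(1)]] by simp
  qed
  have "AE w in M. \<forall>d\<in>D. act w (\<lambda>x. d x - pr d x) = 0"
  proof (subst AE_ball_countable[OF D(1)], intro ballI null)
    fix d assume "d \<in> D" then have d: "d \<in> H" using D by auto
    then show "(\<lambda>x. d x - pr d x) \<in> H" using diff_mem prH by auto
    show "ip (\<lambda>x. d x - pr d x) (v k) = 0" for k using ip_diff prv d prH vH by simp
  qed
  with bnd AE_space show ?thesis
  proof eventually_elim
    case (elim w)
    obtain R where R: "R \<in> H" "\<And>f. f \<in> H \<Longrightarrow> act w f = ip f R"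
      using riesz[of "act w" \<kappa>] lin elim by blast
    have "(\<lambda>x. R x - pr R x) = (\<lambda>x. 0)"
    proof (rule D(3))
      show "(\<lambda>x. R x - pr R x) \<in> H" using diff_mem prH R by auto
      fix d assume "d \<in> D" then have d: "d \<in> H" using D by auto
      have "ip (\<lambda>x. R x - pr R x) d = ip R d - ip (pr R) d" using ip_diff R prH d by auto
      also have "\<dots> = ip d R - ip (pr d) R" using sym[OF d R(1)] ip_commute[OF R(1) d]
          ip_commute[OF d prH[OF R(1)]] by simp
      also have "\<dots> = act w (\<lambda>x. d x - pr d x)" using R diff_mem prH d ip_diff by simp
      also have "\<dots> = 0" using elim \<open>d \<in> D\<close> by auto
      finally show "ip (\<lambda>x. R x - pr R x) d = 0" .
    qed
    then have Rp: "pr R = R" by (simp add: fun_eq_iff)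
    have 1: "(\<lambda>k. ip f (v k) * act w (v k)) sums act w f" if "f \<in> H" for f
      using pr[OF R(1) that] R vH that ip_commute[OF R(1) vH] unfolding Rp by simp
    \<comment> \<open>Evaluating the functional at its own representer bounds the norm of the
      representer by \<open>\<kappa>\<close>; Bessel's inequality then bounds the squared feature
      values.\<close>
    have RR: "ip R R \<le> \<kappa>\<^sup>2"
    proof -
      have "ip R R \<le> \<kappa> * rkhs_norm ip R" using elim R by fastforce
      then have "(rkhs_norm ip R)\<^sup>2 \<le> \<kappa> * rkhs_norm ip R" using norm_sq R by simp
      then have "rkhs_norm ip R \<le> \<kappa>" using norm_ge0[OF R(1)] \<kappa>
        by (cases "rkhs_norm ip R = 0") (auto simp: power2_eq_square)
      then show ?thesis using norm_sq[OF R(1)] power_mono[OF _ norm_ge0[OF R(1)], of \<kappa> 2] by simp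
    qed
    have "(\<Sum>k<J. (act w (v k))\<^sup>2) \<le> \<kappa>\<^sup>2" for J
      using bessel_partial[OF v R(1), of J] RR R vH ip_commute[OF R(1) vH] by simp
    with 1 show ?case by auto
  qed
qed

end

section \<open>Empirical quadratic forms of an i.i.d. sample\<close>

text \<open>Cauchy-Schwarz over pairs of indices: the Frobenius norm of a matrix dominates its
  operator norm.\<close>

lemma bilinear_finite_bound:
  fixes D :: "nat \<Rightarrow> nat \<Rightarrow> real"
  assumes D: "(\<Sum>j<J. \<Sum>k<J. (D j k)\<^sup>2) \<le> t" and a: "(\<Sum>k<J. (a k)\<^sup>2) \<le> A" and b: "(\<Sum>k<J. (b k)\<^sup>2) \<le> B"
  shows "\<bar>\<Sum>j<J. \<Sum>k<J. a j * b k * D j k\<bar> \<le> sqrt (t * A * B)"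
proof -
  let ?I = "{..<J} \<times> {..<J}"
  have 0: "0 \<le> t" "0 \<le> A" "0 \<le> B"
    using D a b by (auto intro: order_trans[rotated] intro!: sum_nonneg)
  have "(\<Sum>j<J. \<Sum>k<J. a j * b k * D j k)\<^sup>2 = (\<Sum>(j,k)\<in>?I. (a j * b k) * D j k)\<^sup>2"
    by (simp add: sum.cartesian_product)
  also have "\<dots> = (\<Sum>p\<in>?I. (case p of (j,k) \<Rightarrow> a j * b k) * (case p of (j,k) \<Rightarrow> D j k))\<^sup>2"
    by (simp add: case_prod_beta)
  also have "\<dots> \<le> (\<Sum>p\<in>?I. (case p of (j,k) \<Rightarrow> a j * b k)\<^sup>2) * (\<Sum>p\<in>?I. (case p of (j,k) \<Rightarrow> D j k)\<^sup>2)"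
    by (rule Cauchy_Schwarz_ineq_sum)
  also have "(\<Sum>p\<in>?I. (case p of (j,k) \<Rightarrow> a j * b k)\<^sup>2) = (\<Sum>k<J. (a k)\<^sup>2) * (\<Sum>k<J. (b k)\<^sup>2)"
    by (simp add: sum_product sum.cartesian_product power_mult_distrib case_prod_beta)
  also have "(\<Sum>p\<in>?I. (case p of (j,k) \<Rightarrow> D j k)\<^sup>2) = (\<Sum>j<J. \<Sum>k<J. (D j k)\<^sup>2)"
    by (simp add: sum.cartesian_product case_prod_beta)
  also have "(\<Sum>k<J. (a k)\<^sup>2) * (\<Sum>k<J. (b k)\<^sup>2) * (\<Sum>j<J. \<Sum>k<J. (D j k)\<^sup>2) \<le> (A * B) * t"
    using 0 by (intro mult_mono assms mult_nonneg_nonneg sum_nonneg) auto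
  finally have "(\<Sum>j<J. \<Sum>k<J. a j * b k * D j k)\<^sup>2 \<le> t * A * B" by (simp add: mult_ac)
  from real_sqrt_le_mono[OF this] show ?thesis by simp
qed

text \<open>\<open>M\<close> is the population matrix of the features and \<open>L\<close> the value
  of its form at \<open>a\<close>, \<open>b\<close>. The truncated matrices obey the Frobenius bound
  with the same \<open>t\<close> for every \<open>J\<close>, so the estimate survives the limit. As
  \<open>t\<close> does not involve the coefficients, these may depend on the sample.\<close>

lemma empirical_bilinear_bound:
  fixes a b :: "nat \<Rightarrow> real"
  assumes u: "\<And>i. i < n \<Longrightarrow> (\<lambda>k. a k * f k i) sums u i"
    and w: "\<And>i. i < n \<Longrightarrow> (\<lambda>k. b k * g k i) sums w i"
    and L: "(\<lambda>J. \<Sum>j<J. \<Sum>k<J. a j * b k * M j k) \<longlonglongrightarrow> L"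
    and D: "\<And>J. (\<Sum>j<J. \<Sum>k<J. ((1 / real n) * (\<Sum>i<n. f j i * g k i) - M j k)\<^sup>2) \<le> t"
    and a: "\<And>J. (\<Sum>k<J. (a k)\<^sup>2) \<le> A" and b: "\<And>J. (\<Sum>k<J. (b k)\<^sup>2) \<le> B"
  shows "\<bar>(1 / real n) * (\<Sum>i<n. u i * w i) - L\<bar> \<le> sqrt (t * A * B)"
proof (rule LIMSEQ_le_const2)
  let ?E = "\<lambda>J. (1 / real n) * (\<Sum>i<n. (\<Sum>j<J. a j * f j i) * (\<Sum>k<J. b k * g k i))
     - (\<Sum>j<J. \<Sum>k<J. a j * b k * M j k)"
  show "(\<lambda>J. \<bar>?E J\<bar>) \<longlonglongrightarrow> \<bar>(1 / real n) * (\<Sum>i<n. u i * w i) - L\<bar>"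
    by (intro tendsto_intros L) (use u w in \<open>auto simp: sums_def\<close>)
  have "\<bar>?E J\<bar> \<le> sqrt (t * A * B)" for J
  proof -
    have "(\<Sum>j<J. \<Sum>k<J. a j * b k * ((1 / real n) * (\<Sum>i<n. f j i * g k i)))
        = (1 / real n) * (\<Sum>j<J. \<Sum>k<J. \<Sum>i<n. (a j * f j i) * (b k * g k i))"
      by (simp add: sum_distrib_left mult_ac)
    also have "(\<Sum>j<J. \<Sum>k<J. \<Sum>i<n. (a j * f j i) * (b k * g k i))
        = (\<Sum>j<J. \<Sum>i<n. \<Sum>k<J. (a j * f j i) * (b k * g k i))"
      by (intro sum.cong refl sum.swap)
    also have "\<dots> = (\<Sum>i<n. \<Sum>j<J. \<Sum>k<J. (a j * f j i) * (b k * g k i))"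
      by (rule sum.swap)
    also have "\<dots> = (\<Sum>i<n. (\<Sum>j<J. a j * f j i) * (\<Sum>k<J. b k * g k i))"
      by (simp add: sum_product)
    finally have "?E J = (\<Sum>j<J. \<Sum>k<J. a j * b k * ((1 / real n) * (\<Sum>i<n. f j i * g k i) - M j k))"
      by (simp add: right_diff_distrib sum_subtractf)
    then show ?thesis using bilinear_finite_bound[OF D a b] by presburger
  qed
  then show "\<exists>N. \<forall>J\<ge>N. \<bar>?E J\<bar> \<le> sqrt (t * A * B)" by blast
qed

lemma empirical_linear_bound:
  fixes a :: "nat \<Rightarrow> real"
  assumes u: "\<And>i. i < n \<Longrightarrow> (\<lambda>k. a k * f k i) sums u i"
    and D: "\<And>J. (\<Sum>k<J. ((1 / real n) * (\<Sum>i<n. e i * f k i))\<^sup>2) \<le> t"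
    and a: "\<And>J. (\<Sum>k<J. (a k)\<^sup>2) \<le> A"
  shows "\<bar>(1 / real n) * (\<Sum>i<n. e i * u i)\<bar> \<le> sqrt (t * A)"
proof (rule LIMSEQ_le_const2)
  let ?E = "\<lambda>J. (1 / real n) * (\<Sum>i<n. e i * (\<Sum>k<J. a k * f k i))"
  show "(\<lambda>J. \<bar>?E J\<bar>) \<longlonglongrightarrow> \<bar>(1 / real n) * (\<Sum>i<n. e i * u i)\<bar>"
    by (intro tendsto_intros) (use u in \<open>auto simp: sums_def\<close>)
  have "\<bar>?E J\<bar> \<le> sqrt (t * A)" for J
  proof -
    have A0: "0 \<le> A" using a[of 0] by simp
    have "(\<Sum>k<J. a k * ((1 / real n) * (\<Sum>i<n. e i * f k i)))
       = (1 / real n) * (\<Sum>k<J. \<Sum>i<n. e i * (a k * f k i))"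
      by (simp add: sum_distrib_left mult_ac)
    also have "(\<Sum>k<J. \<Sum>i<n. e i * (a k * f k i)) = (\<Sum>i<n. e i * (\<Sum>k<J. a k * f k i))"
      unfolding sum_distrib_left by (rule sum.swap)
    finally have *: "?E J = (\<Sum>k<J. a k * ((1 / real n) * (\<Sum>i<n. e i * f k i)))" by simp
    have "(?E J)\<^sup>2 \<le> (\<Sum>k<J. (a k)\<^sup>2) * (\<Sum>k<J. ((1 / real n) * (\<Sum>i<n. e i * f k i))\<^sup>2)"
      unfolding * by (rule Cauchy_Schwarz_ineq_sum)
    also have "\<dots> \<le> A * t" by (intro mult_mono a D A0 sum_nonneg) auto
    finally have "(?E J)\<^sup>2 \<le> t * A" by (simp add: mult.commute)
    from real_sqrt_le_mono[OF this] show ?thesis by simp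
  qed
  then show "\<exists>N. \<forall>J\<ge>N. \<bar>?E J\<bar> \<le> sqrt (t * A)" by blast
qed

text \<open>The exceptional sets increase with \<open>J\<close>, so continuity from below gives
  their union the same bound that Markov's inequality gives each of them.\<close>

lemma (in prob_space) markov_incseq:
  fixes S :: "nat \<Rightarrow> 'a \<Rightarrow> real"
  assumes int: "\<And>J. integrable M (S J)" and nn: "\<And>J x. 0 \<le> S J x"
    and mono: "\<And>J x. S J x \<le> S (Suc J) x" and E: "\<And>J. expectation (S J) \<le> c" and t: "t > 0"
  shows "\<exists>A\<in>sets M. prob A \<le> c / t \<and> (\<forall>x\<in>space M - A. \<forall>J. S J x \<le> t)"
proof (intro bexI conjI ballI allI)
  define A where "A J = {x\<in>space M. S J x > t}" for J
  have [measurable]: "S J \<in> borel_measurable M" for J using int by auto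
  have A: "A J \<in> sets M" for J unfolding A_def by measurable
  have inc: "incseq A" by (intro incseq_SucI) (use mono in \<open>auto simp: A_def intro: less_le_trans\<close>)
  have "prob (A J) \<le> c / t" for J
  proof -
    have "prob (A J) \<le> prob {x\<in>space M. S J x \<ge> t}" by (intro finite_measure_mono) (auto simp: A_def)
    also have "\<dots> \<le> expectation (S J) / t"
      by (rule integral_Markov_inequality_measure[where A = "{}"]) (use int nn t in auto)
    also have "\<dots> \<le> c / t" using E t by (simp add: divide_right_mono)
    finally show ?thesis .
  qed
  moreover have "(\<lambda>J. prob (A J)) \<longlonglongrightarrow> prob (\<Union>J. A J)"
    by (rule finite_Lim_measure_incseq) (use A inc in auto)
  ultimately show "prob (\<Union>J. A J) \<le> c / t" by (intro LIMSEQ_le_const2) auto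
  show "(\<Union>J. A J) \<in> sets M" using A by auto
  show "S J x \<le> t" if "x \<in> space M - (\<Union>J. A J)" for x J using that by (auto simp: A_def not_less)
qed

lemma (in prob_space) mean_square_orthogonal:
  fixes Y :: "nat \<Rightarrow> 'a \<Rightarrow> real"
  assumes int: "\<And>i j. integrable M (\<lambda>x. Y i x * Y j x)"
    and E: "\<And>i j. expectation (\<lambda>x. Y i x * Y j x) = (if i = j then v else 0)"
    and n: "n > 0"
  shows "integrable M (\<lambda>x. ((1 / real n) * (\<Sum>i<n. Y i x))\<^sup>2)"
    "expectation (\<lambda>x. ((1 / real n) * (\<Sum>i<n. Y i x))\<^sup>2) = v / real n"
proof -
  have *: "((1 / real n) * (\<Sum>i<n. Y i x))\<^sup>2 = (1 / real n)\<^sup>2 * (\<Sum>i<n. \<Sum>j<n. Y i x * Y j x)" for x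
    by (simp add: power_mult_distrib power2_eq_square sum_product)
  show "integrable M (\<lambda>x. ((1 / real n) * (\<Sum>i<n. Y i x))\<^sup>2)"
    unfolding * using int by simp
  have "expectation (\<lambda>x. ((1 / real n) * (\<Sum>i<n. Y i x))\<^sup>2)
      = (1 / real n)\<^sup>2 * (\<Sum>i<n. \<Sum>j<n. expectation (\<lambda>x. Y i x * Y j x))"
    unfolding * using int by simp
  also have "\<dots> = v / real n" unfolding E using n by (simp add: power2_eq_square)
  finally show "expectation (\<lambda>x. ((1 / real n) * (\<Sum>i<n. Y i x))\<^sup>2) = v / real n" .
qed

lemma sigma_sets_compose_subset:
  assumes W: "W \<in> measurable M N" and h: "h \<in> borel_measurable N"
  shows "sigma_sets (space M) {(\<lambda>x. h (W x)) -` A \<inter> space M | A. A \<in> sets borel}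
    \<subseteq> sets (vimage_algebra (space M) W N)"
proof -
  have "(\<lambda>x. h (W x)) \<in> borel_measurable (vimage_algebra (space M) W N)"
    by (rule measurable_compose[OF measurable_vimage_algebra1 h]) (use measurable_space[OF W] in auto)
  then have "{(\<lambda>x. h (W x)) -` A \<inter> space M | A. A \<in> sets borel} \<subseteq> sets (vimage_algebra (space M) W N)"
    by (auto dest: measurable_sets)
  from sets.sigma_sets_subset[OF this] show ?thesis by simp
qed

text \<open>Independence of errors and design is given for the sigma-algebras generated by the two
  whole sequences; measurable functions of the two sides generate smaller ones.\<close>

lemma (in prob_space) indep_set_vimage_compose:
  assumes ind: "indep_set (sets (vimage_algebra (space M) U MU)) (sets (vimage_algebra (space M) V MV))"
    and U: "U \<in> measurable M MU" and V: "V \<in> measurable M MV"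
    and f: "f \<in> borel_measurable MU" and g: "g \<in> borel_measurable MV"
  shows "indep_var borel (\<lambda>x. f (U x) :: real) borel (\<lambda>x. g (V x) :: real)"
proof -
  show ?thesis unfolding indep_var_eq
  proof (intro conjI)
    show "indep_set (sigma_sets (space M) {(\<lambda>x. f (U x)) -` A \<inter> space M | A. A \<in> sets borel})
      (sigma_sets (space M) {(\<lambda>x. g (V x)) -` A \<inter> space M | A. A \<in> sets borel})"
      using ind unfolding indep_set_def
      by (rule indep_sets_mono_sets) (use sigma_sets_compose_subset[OF U f] sigma_sets_compose_subset[OF V g] in \<open>auto split: bool.splits\<close>)
  qed (use U V f g in \<open>auto intro: measurable_compose\<close>)
qed

section \<open>Second moments of averages over an i.i.d. sample\<close>

locale iid_sample = prob_space Q for Q :: "'v measure" +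
  fixes M :: "'m measure" and \<mu> :: "'m measure" and W :: "nat \<Rightarrow> 'v \<Rightarrow> 'm" and es :: "nat \<Rightarrow> 'v \<Rightarrow> real"
  assumes indep: "indep_vars (\<lambda>_. M) W UNIV"
    and law: "\<And>i. distr Q M (W i) = \<mu>"
    and es_meas: "\<And>i. es i \<in> borel_measurable Q"
    and es_int: "\<And>i j. integrable Q (\<lambda>\<omega>. es i \<omega> * es j \<omega>)"
    and es_cov: "\<And>i j. expectation (\<lambda>\<omega>. es i \<omega> * es j \<omega>) = (if i = j then 1 else 0)"
    and es_indep: "indep_set
       (sets (vimage_algebra (space Q) (\<lambda>\<omega> i. es i \<omega>) (PiM UNIV (\<lambda>_. borel))))
       (sets (vimage_algebra (space Q) (\<lambda>\<omega> i. W i \<omega>) (PiM UNIV (\<lambda>_. M))))"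
begin

lemma W_meas [measurable]: "W i \<in> measurable Q M"
  using indep by (auto simp: indep_vars_def)

lemma sets_mu [measurable_cong]: "sets \<mu> = sets M"
  using law[of 0] by (metis sets_distr)

lemma prob_space_mu: "prob_space \<mu>"
  using prob_space_distr[OF W_meas, of 0] law by simp

lemma measurable_mu: "f \<in> borel_measurable \<mu> \<longleftrightarrow> f \<in> borel_measurable M"
  by (simp only: measurable_cong_sets[OF sets_mu refl])

lemma integrable_W: "f \<in> borel_measurable \<mu> \<Longrightarrow> integrable Q (\<lambda>\<omega>. f (W i \<omega>)) \<longleftrightarrow> integrable \<mu> (f :: _ \<Rightarrow> real)"
  using integrable_distr_eq[OF W_meas, of f i] law[of i] measurable_mu by simp

lemma expectation_W: "f \<in> borel_measurable \<mu> \<Longrightarrow> expectation (\<lambda>\<omega>. f (W i \<omega>)) = integral\<^sup>L \<mu> (f :: _ \<Rightarrow> real)"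
  using integral_distr[OF W_meas, of f i] law[of i] measurable_mu by simp

lemma indep_product:
  fixes f :: "'m \<Rightarrow> real"
  assumes f: "integrable \<mu> f" and ij: "i \<noteq> j"
  shows "integrable Q (\<lambda>\<omega>. f (W i \<omega>) * f (W j \<omega>))"
    "expectation (\<lambda>\<omega>. f (W i \<omega>) * f (W j \<omega>)) = (integral\<^sup>L \<mu> f)\<^sup>2"
proof -
  have fm: "f \<in> borel_measurable \<mu>" using f by auto
  then have "f \<in> borel_measurable M" using measurable_mu by simp
  then have "indep_vars (\<lambda>_. borel) (\<lambda>i \<omega>. f (W i \<omega>)) UNIV"
    by (intro indep_vars_compose2[OF indep]) auto
  then have *: "indep_vars (\<lambda>_. borel) (\<lambda>i \<omega>. f (W i \<omega>)) {i, j}" by (rule indep_vars_subset) auto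
  have int: "integrable Q (\<lambda>\<omega>. f (W i \<omega>))" for i using integrable_W[OF fm] f by simp
  show "integrable Q (\<lambda>\<omega>. f (W i \<omega>) * f (W j \<omega>))"
    using indep_vars_integrable[OF _ * int] ij by simp
  show "expectation (\<lambda>\<omega>. f (W i \<omega>) * f (W j \<omega>)) = (integral\<^sup>L \<mu> f)\<^sup>2"
    using indep_vars_lebesgue_integral[OF _ * int] ij expectation_W[OF fm]
    by (simp add: power2_eq_square)
qed

lemma empirical_variance:
  fixes h :: "'m \<Rightarrow> real"
  assumes h: "h \<in> borel_measurable \<mu>" "integrable \<mu> (\<lambda>w. (h w)\<^sup>2)" and n: "n > 0"
  shows "integrable Q (\<lambda>\<omega>. ((1 / real n) * (\<Sum>i<n. h (W i \<omega>)) - integral\<^sup>L \<mu> h)\<^sup>2)"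
    "expectation (\<lambda>\<omega>. ((1 / real n) * (\<Sum>i<n. h (W i \<omega>)) - integral\<^sup>L \<mu> h)\<^sup>2)
      \<le> (\<integral>w. (h w)\<^sup>2 \<partial>\<mu>) / real n"
proof -
  interpret mu: prob_space \<mu> by (rule prob_space_mu)
  have hi: "integrable \<mu> h" using mu.square_integrable_imp_integrable h by auto
  define g where "g w = h w - integral\<^sup>L \<mu> h" for w
  have gi: "integrable \<mu> g" unfolding g_def using hi by auto
  have g0: "integral\<^sup>L \<mu> g = 0" unfolding g_def using hi mu.prob_space by simp
  have g2: "(\<lambda>w. (g w)\<^sup>2) = (\<lambda>w. (h w)\<^sup>2 - 2 * integral\<^sup>L \<mu> h * h w + (integral\<^sup>L \<mu> h)\<^sup>2)"
    by (simp add: g_def power2_diff fun_eq_iff)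
  have g2i: "integrable \<mu> (\<lambda>w. (g w)\<^sup>2)" unfolding g2 using hi h by auto
  have "(\<integral>w. (g w)\<^sup>2 \<partial>\<mu>) = (\<integral>w. (h w)\<^sup>2 \<partial>\<mu>) - (integral\<^sup>L \<mu> h)\<^sup>2"
    unfolding g2 using hi h mu.prob_space by (simp add: power2_eq_square)
  then have le: "(\<integral>w. (g w)\<^sup>2 \<partial>\<mu>) \<le> (\<integral>w. (h w)\<^sup>2 \<partial>\<mu>)" by simp
  have int: "integrable Q (\<lambda>\<omega>. g (W i \<omega>) * g (W j \<omega>))" for i j
    using indep_product(1)[OF gi, of i j] integrable_W[of "\<lambda>w. (g w)\<^sup>2" i] g2i gi
    by (cases "i = j") (auto simp: power2_eq_square)
  have E: "expectation (\<lambda>\<omega>. g (W i \<omega>) * g (W j \<omega>)) = (if i = j then \<integral>w. (g w)\<^sup>2 \<partial>\<mu> else 0)" for i j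
    using indep_product(2)[OF gi, of i j] expectation_W[of "\<lambda>w. (g w)\<^sup>2" i] g2i gi g0
    by (cases "i = j") (auto simp: power2_eq_square)
  have *: "(1 / real n) * (\<Sum>i<n. h (W i \<omega>)) - integral\<^sup>L \<mu> h = (1 / real n) * (\<Sum>i<n. g (W i \<omega>))" for \<omega>
    unfolding g_def using n by (simp add: sum_subtractf algebra_simps)
  show "integrable Q (\<lambda>\<omega>. ((1 / real n) * (\<Sum>i<n. h (W i \<omega>)) - integral\<^sup>L \<mu> h)\<^sup>2)"
    unfolding * by (rule mean_square_orthogonal[OF int E n])
  show "expectation (\<lambda>\<omega>. ((1 / real n) * (\<Sum>i<n. h (W i \<omega>)) - integral\<^sup>L \<mu> h)\<^sup>2)
      \<le> (\<integral>w. (h w)\<^sup>2 \<partial>\<mu>) / real n"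
    unfolding * mean_square_orthogonal(2)[OF int E n] using le by (simp add: divide_right_mono)
qed

lemma noise_variance:
  fixes h :: "'m \<Rightarrow> real"
  assumes h: "h \<in> borel_measurable \<mu>" "integrable \<mu> (\<lambda>w. (h w)\<^sup>2)" and n: "n > 0"
  shows "integrable Q (\<lambda>\<omega>. ((1 / real n) * (\<Sum>i<n. es i \<omega> * h (W i \<omega>)))\<^sup>2)"
    "expectation (\<lambda>\<omega>. ((1 / real n) * (\<Sum>i<n. es i \<omega> * h (W i \<omega>)))\<^sup>2) = (\<integral>w. (h w)\<^sup>2 \<partial>\<mu>) / real n"
proof -
  interpret mu: prob_space \<mu> by (rule prob_space_mu)
  have hi: "integrable \<mu> h" using mu.square_integrable_imp_integrable h by auto
  have hM[measurable]: "h \<in> borel_measurable M" using h measurable_mu by simp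
  have hint: "integrable Q (\<lambda>\<omega>. h (W i \<omega>) * h (W j \<omega>))" for i j
    using indep_product(1)[OF hi, of i j] integrable_W[of "\<lambda>w. (h w)\<^sup>2" i] h
    by (cases "i = j") (auto simp: power2_eq_square)
  \<comment> \<open>Errors and design separate into two independent products, so the off-diagonal
    expectations vanish through the errors although \<open>h\<close> is not centered.\<close>
  have ind: "indep_var borel (\<lambda>\<omega>. es i \<omega> * es j \<omega>) borel (\<lambda>\<omega>. h (W i \<omega>) * h (W j \<omega>))" for i j
    by (rule indep_set_vimage_compose[OF es_indep, of "\<lambda>e. e i * e j" "\<lambda>w. h (w i) * h (w j)"])
      (use es_meas measurable_space[OF W_meas] in \<open>auto intro!: measurable_PiM_single'\<close>)
  have eq: "(es i \<omega> * h (W i \<omega>)) * (es j \<omega> * h (W j \<omega>)) = (es i \<omega> * es j \<omega>) * (h (W i \<omega>) * h (W j \<omega>))" for i j \<omega>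
    by simp
  have int: "integrable Q (\<lambda>\<omega>. (es i \<omega> * h (W i \<omega>)) * (es j \<omega> * h (W j \<omega>)))" for i j
    unfolding eq by (rule indep_var_integrable[OF ind es_int hint])
  have E: "expectation (\<lambda>\<omega>. (es i \<omega> * h (W i \<omega>)) * (es j \<omega> * h (W j \<omega>)))
      = (if i = j then \<integral>w. (h w)\<^sup>2 \<partial>\<mu> else 0)" for i j
    unfolding eq indep_var_lebesgue_integral[OF ind es_int hint] es_cov
    using expectation_W[of "\<lambda>w. (h w)\<^sup>2" i] h by (auto simp: power2_eq_square)
  show "integrable Q (\<lambda>\<omega>. ((1 / real n) * (\<Sum>i<n. es i \<omega> * h (W i \<omega>)))\<^sup>2)"
    "expectation (\<lambda>\<omega>. ((1 / real n) * (\<Sum>i<n. es i \<omega> * h (W i \<omega>)))\<^sup>2) = (\<integral>w. (h w)\<^sup>2 \<partial>\<mu>) / real n"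
    by (rule mean_square_orthogonal[OF int E n])+
qed

end

text \<open>The values \<open>x k w\<close> are the coordinates of a random feature vector. The
  quantifier over \<open>J\<close> stands inside the almost sure statement, so
  \<open>\<kappa>\<close> bounds the squared length of the whole vector off a single null
  set.\<close>

definition feature_block :: "'m measure \<Rightarrow> (nat \<Rightarrow> 'm \<Rightarrow> real) \<Rightarrow> (nat \<Rightarrow> real) \<Rightarrow> real \<Rightarrow> bool" where
  "feature_block \<mu> x \<sigma> \<kappa> \<longleftrightarrow> (\<forall>k. x k \<in> borel_measurable \<mu>) \<and>
     (AE w in \<mu>. \<forall>J. (\<Sum>k<J. (x k w)\<^sup>2) \<le> \<kappa>) \<and>
     (\<forall>j k. (\<integral>w. x j w * x k w \<partial>\<mu>) = (if j = k then \<sigma> k else 0))"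

lemma (in prob_space) feature_block_facts:
  assumes "feature_block M x \<sigma> \<kappa>"
  shows "x k \<in> borel_measurable M" "AE w in M. \<forall>J. (\<Sum>k<J. (x k w)\<^sup>2) \<le> \<kappa>"
    "expectation (\<lambda>w. x j w * x k w) = (if j = k then \<sigma> k else 0)"
    "AE w in M. (x k w)\<^sup>2 \<le> \<kappa>" "integrable M (\<lambda>w. (x k w)\<^sup>2)" "expectation (\<lambda>w. (x k w)\<^sup>2) = \<sigma> k"
    "0 \<le> \<sigma> k" "(\<Sum>k<J. \<sigma> k) \<le> \<kappa>" "\<sigma> k \<le> \<kappa>" "0 \<le> \<kappa>"
proof -
  show m: "x k \<in> borel_measurable M" for k using assms by (auto simp: feature_block_def)
  show ae: "AE w in M. \<forall>J. (\<Sum>k<J. (x k w)\<^sup>2) \<le> \<kappa>" using assms by (auto simp: feature_block_def)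
  show c: "expectation (\<lambda>w. x j w * x k w) = (if j = k then \<sigma> k else 0)" for j k
    using assms unfolding feature_block_def by blast
  show b: "AE w in M. (x k w)\<^sup>2 \<le> \<kappa>" for k
    using ae
  proof eventually_elim
    case (elim w)
    have "(x k w)\<^sup>2 \<le> (\<Sum>k<Suc k. (x k w)\<^sup>2)" by (simp add: sum_nonneg)
    with elim show ?case by (meson order_trans)
  qed
  show i: "integrable M (\<lambda>w. (x k w)\<^sup>2)" for k
    by (rule integrable_const_bound[where B = \<kappa>]) (use b m in auto)
  show e: "expectation (\<lambda>w. (x k w)\<^sup>2) = \<sigma> k" for k using c[of k k] by (simp add: power2_eq_square)
  show \<sigma>0: "0 \<le> \<sigma> k" for k unfolding e[symmetric] by (rule integral_nonneg_AE) simp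
  \<comment> \<open>Integrating the bound on the squared length shows that the covariance has finite
    trace, at most \<open>\<kappa>\<close>.\<close>
  have "(\<Sum>k<J. \<sigma> k) = expectation (\<lambda>w. \<Sum>k<J. (x k w)\<^sup>2)" for J using i e by simp
  also have "\<dots> J \<le> expectation (\<lambda>w. \<kappa>)" for J
    by (rule integral_mono_AE) (use i ae in auto)
  finally show s: "(\<Sum>k<J. \<sigma> k) \<le> \<kappa>" for J by (simp add: prob_space)
  show "\<sigma> k \<le> \<kappa>" using s[of "Suc k"] sum_nonneg[of "{..<k}" \<sigma>] \<sigma>0 by simp
  show "0 \<le> \<kappa>" using s[of 0] by simp
qed

context iid_sample
begin

text \<open>The variances of all entries sum to at most the mean of
  \<open>(\<Sum>j. (f j w)\<^sup>2) * (\<Sum>k. (g k w)\<^sup>2)\<close> divided by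
  \<open>n\<close>. The first factor is bounded pointwise by \<open>F\<close>, the second in mean by
  \<open>N\<close>. This asymmetry lets the design forms and the cross form share one
  statement.\<close>

lemma hilbert_schmidt_event:
  fixes f g :: "nat \<Rightarrow> 'm \<Rightarrow> real"
  assumes f: "\<And>k. f k \<in> borel_measurable \<mu>" "AE w in \<mu>. \<forall>J. (\<Sum>k<J. (f k w)\<^sup>2) \<le> F"
    and g: "\<And>k. g k \<in> borel_measurable \<mu>" "\<And>k. integrable \<mu> (\<lambda>w. (g k w)\<^sup>2)"
      "\<And>J. (\<Sum>k<J. \<integral>w. (g k w)\<^sup>2 \<partial>\<mu>) \<le> N"
    and n: "n > 0" and t: "t > 0"
  shows "\<exists>A\<in>sets Q. prob A \<le> F * N / real n / t \<and> (\<forall>\<omega>\<in>space Q - A. \<forall>J.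
     (\<Sum>j<J. \<Sum>k<J. ((1 / real n) * (\<Sum>i<n. f j (W i \<omega>) * g k (W i \<omega>)) - (\<integral>w. f j w * g k w \<partial>\<mu>))\<^sup>2) \<le> t)"
proof (rule markov_incseq)
  interpret mu: prob_space \<mu> by (rule prob_space_mu)
  have F1: "AE w in \<mu>. (f k w)\<^sup>2 \<le> F" for k
    using f(2)
  proof eventually_elim
    case (elim w)
    have "(f k w)\<^sup>2 \<le> (\<Sum>k<Suc k. (f k w)\<^sup>2)" by (simp add: sum_nonneg)
    with elim show ?case by (meson order_trans)
  qed
  have fgi: "integrable \<mu> (\<lambda>w. (f j w * g k w)\<^sup>2)" for j k
  proof (rule Bochner_Integration.integrable_bound[where f = "\<lambda>w. F * (g k w)\<^sup>2"])
    show "AE w in \<mu>. norm ((f j w * g k w)\<^sup>2) \<le> norm (F * (g k w)\<^sup>2)"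
      using F1[of j]
    proof eventually_elim
      case (elim w)
      then have "(f j w)\<^sup>2 * (g k w)\<^sup>2 \<le> F * (g k w)\<^sup>2" by (intro mult_right_mono) auto
      then show ?case by (simp add: power_mult_distrib)
    qed
  qed (use f g in auto)
  note var = empirical_variance[OF borel_measurable_times[OF f(1) g(1)] fgi n]
  let ?D = "\<lambda>j k \<omega>. ((1 / real n) * (\<Sum>i<n. f j (W i \<omega>) * g k (W i \<omega>)) - (\<integral>w. f j w * g k w \<partial>\<mu>))\<^sup>2"
  show "integrable Q (\<lambda>\<omega>. \<Sum>j<J. \<Sum>k<J. ?D j k \<omega>)" for J
    by (intro Bochner_Integration.integrable_sum var)
  show "0 \<le> (\<Sum>j<J. \<Sum>k<J. ?D j k \<omega>)" for J \<omega> by (intro sum_nonneg) auto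
  show "(\<Sum>j<J. \<Sum>k<J. ?D j k \<omega>) \<le> (\<Sum>j<Suc J. \<Sum>k<Suc J. ?D j k \<omega>)" for J \<omega>
    unfolding sum.cartesian_product by (rule sum_mono2) auto
  show "expectation (\<lambda>\<omega>. \<Sum>j<J. \<Sum>k<J. ?D j k \<omega>) \<le> F * N / real n" for J
  proof -
    have "expectation (\<lambda>\<omega>. \<Sum>j<J. \<Sum>k<J. ?D j k \<omega>) = (\<Sum>j<J. \<Sum>k<J. expectation (?D j k))"
      using var(1) by (simp add: Bochner_Integration.integral_sum)
    also have "\<dots> \<le> (\<Sum>j<J. \<Sum>k<J. (\<integral>w. (f j w * g k w)\<^sup>2 \<partial>\<mu>) / real n)"
      by (intro sum_mono var)
    also have "\<dots> = (\<integral>w. (\<Sum>j<J. \<Sum>k<J. (f j w * g k w)\<^sup>2) \<partial>\<mu>) / real n"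
      using fgi by (simp add: sum_divide_distrib)
    also have "(\<integral>w. (\<Sum>j<J. \<Sum>k<J. (f j w * g k w)\<^sup>2) \<partial>\<mu>) \<le> (\<integral>w. F * (\<Sum>k<J. (g k w)\<^sup>2) \<partial>\<mu>)"
    proof (rule integral_mono_AE)
      show "AE w in \<mu>. (\<Sum>j<J. \<Sum>k<J. (f j w * g k w)\<^sup>2) \<le> F * (\<Sum>k<J. (g k w)\<^sup>2)"
        using f(2)
      proof eventually_elim
        case (elim w)
        have "(\<Sum>j<J. \<Sum>k<J. (f j w * g k w)\<^sup>2) = (\<Sum>j<J. (f j w)\<^sup>2) * (\<Sum>k<J. (g k w)\<^sup>2)"
          by (simp add: sum_product power_mult_distrib)
        also have "\<dots> \<le> F * (\<Sum>k<J. (g k w)\<^sup>2)" using elim by (intro mult_right_mono sum_nonneg) auto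
        finally show ?case .
      qed
    qed (use fgi g(2) in auto)
    also have "(\<integral>w. F * (\<Sum>k<J. (g k w)\<^sup>2) \<partial>\<mu>) = F * (\<Sum>k<J. \<integral>w. (g k w)\<^sup>2 \<partial>\<mu>)" using g(2) by simp
    also have "\<dots> \<le> F * N"
    proof (rule mult_left_mono[OF g(3)])
      have "AE w in \<mu>. 0 \<le> F" using F1[of 0] by eventually_elim (meson order_trans zero_le_power2)
      then show "0 \<le> F" by (simp add: mu.emeasure_space_1)
    qed
    finally show ?thesis by (simp add: divide_right_mono)
  qed
qed (rule t)

lemma noise_event:
  fixes g :: "nat \<Rightarrow> 'm \<Rightarrow> real"
  assumes g: "\<And>k. g k \<in> borel_measurable \<mu>" "\<And>k. integrable \<mu> (\<lambda>w. (g k w)\<^sup>2)"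
      "\<And>J. (\<Sum>k<J. \<integral>w. (g k w)\<^sup>2 \<partial>\<mu>) \<le> N"
    and n: "n > 0" and t: "t > 0"
  shows "\<exists>A\<in>sets Q. prob A \<le> N / real n / t \<and> (\<forall>\<omega>\<in>space Q - A. \<forall>J.
     (\<Sum>k<J. ((1 / real n) * (\<Sum>i<n. es i \<omega> * g k (W i \<omega>)))\<^sup>2) \<le> t)"
proof (rule markov_incseq)
  note var = noise_variance[OF g(1,2) n]
  let ?D = "\<lambda>k \<omega>. ((1 / real n) * (\<Sum>i<n. es i \<omega> * g k (W i \<omega>)))\<^sup>2"
  show "integrable Q (\<lambda>\<omega>. \<Sum>k<J. ?D k \<omega>)" for J
    by (intro Bochner_Integration.integrable_sum var)
  show "0 \<le> (\<Sum>k<J. ?D k \<omega>)" for J \<omega> by (intro sum_nonneg) auto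
  show "(\<Sum>k<J. ?D k \<omega>) \<le> (\<Sum>k<Suc J. ?D k \<omega>)" for J \<omega> by simp
  show "expectation (\<lambda>\<omega>. \<Sum>k<J. ?D k \<omega>) \<le> N / real n" for J
  proof -
    have "expectation (\<lambda>\<omega>. \<Sum>k<J. ?D k \<omega>) = (\<Sum>k<J. expectation (?D k))"
      using var(1) by (simp add: Bochner_Integration.integral_sum)
    also have "\<dots> = (\<Sum>k<J. \<integral>w. (g k w)\<^sup>2 \<partial>\<mu>) / real n" unfolding var(2) by (simp add: sum_divide_distrib)
    also have "\<dots> \<le> N / real n" using g(3) by (rule divide_right_mono) simp
    finally show ?thesis .
  qed
qed (rule t)

end

text \<open>The scaling turns the regularized norm
  \<open>\<Sum>k. (\<sigma> k + b) * (c k)\<^sup>2\<close> into a Euclidean one. Whitened features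
  have squared length at most \<open>\<kappa> / b\<close>, and their mean squared length is the
  effective dimension at level \<open>b\<close>.\<close>

definition whiten :: "(nat \<Rightarrow> real) \<Rightarrow> real \<Rightarrow> (nat \<Rightarrow> 'm \<Rightarrow> real) \<Rightarrow> nat \<Rightarrow> 'm \<Rightarrow> real" where
  "whiten \<sigma> b x k w = x k w / sqrt (\<sigma> k + b)"

lemma (in prob_space) whiten_facts:
  assumes x: "feature_block M x \<sigma> \<kappa>" and b: "b > 0"
  shows "whiten \<sigma> b x k \<in> borel_measurable M"
    "AE w in M. \<forall>J. (\<Sum>k<J. (whiten \<sigma> b x k w)\<^sup>2) \<le> \<kappa> / b"
    "integrable M (\<lambda>w. (whiten \<sigma> b x k w)\<^sup>2)"
    "expectation (\<lambda>w. (whiten \<sigma> b x k w)\<^sup>2) = \<sigma> k / (\<sigma> k + b)"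
    "expectation (\<lambda>w. whiten \<sigma> b x j w * whiten \<sigma> b x k w) = (if j = k then \<sigma> k / (\<sigma> k + b) else 0)"
proof -
  note x = feature_block_facts[OF x]
  have pos: "\<sigma> k + b > 0" for k using x(7)[of k] b by simp
  have sq: "(whiten \<sigma> b x k w)\<^sup>2 = (x k w)\<^sup>2 / (\<sigma> k + b)" for k w
    using pos[of k] by (simp add: whiten_def power_divide)
  have mul: "whiten \<sigma> b x j w * whiten \<sigma> b x k w = (x j w * x k w) / (sqrt (\<sigma> j + b) * sqrt (\<sigma> k + b))" for j k w
    by (simp add: whiten_def)
  show "whiten \<sigma> b x k \<in> borel_measurable M" unfolding whiten_def[abs_def] using x(1) by simp
  show "AE w in M. \<forall>J. (\<Sum>k<J. (whiten \<sigma> b x k w)\<^sup>2) \<le> \<kappa> / b"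
    using x(2)
  proof eventually_elim
    case (elim w)
    show ?case
    proof
      fix J
      have "(\<Sum>k<J. (whiten \<sigma> b x k w)\<^sup>2) \<le> (\<Sum>k<J. (x k w)\<^sup>2 / b)"
        unfolding sq using x(7) b by (intro sum_mono divide_left_mono) (auto simp: add_nonneg_pos)
      also have "\<dots> \<le> \<kappa> / b" using elim b by (simp add: sum_divide_distrib[symmetric] divide_right_mono)
      finally show "(\<Sum>k<J. (whiten \<sigma> b x k w)\<^sup>2) \<le> \<kappa> / b" .
    qed
  qed
  show "integrable M (\<lambda>w. (whiten \<sigma> b x k w)\<^sup>2)" unfolding sq using x(5) by simp
  show "expectation (\<lambda>w. (whiten \<sigma> b x k w)\<^sup>2) = \<sigma> k / (\<sigma> k + b)" unfolding sq using x(6) by simp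
  show "expectation (\<lambda>w. whiten \<sigma> b x j w * whiten \<sigma> b x k w) = (if j = k then \<sigma> k / (\<sigma> k + b) else 0)"
    unfolding mul using x(3)[of j k] pos[of k] by simp
qed

text \<open>In use \<open>C\<close> is the squared kernel norm of a function. By Bessel's inequality
  it may exceed the sum of the squared coefficients, but it is the quantity that the penalty
  contains.\<close>

lemma (in prob_space) whiten_coef:
  fixes c :: "nat \<Rightarrow> real"
  assumes x: "feature_block M x \<sigma> \<kappa>" and b: "b > 0" and c: "\<And>J. (\<Sum>k<J. (c k)\<^sup>2) \<le> C"
  shows "summable (\<lambda>k. \<sigma> k * (c k)\<^sup>2)"
    "(\<Sum>k<J. (c k * sqrt (\<sigma> k + b))\<^sup>2) \<le> (\<Sum>k. \<sigma> k * (c k)\<^sup>2) + b * C"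
    "c k * sqrt (\<sigma> k + b) * whiten \<sigma> b x k w = c k * x k w"
proof -
  note x = feature_block_facts[OF x]
  have pos: "\<sigma> k + b > 0" for k using x(7)[of k] b by simp
  have "summable (\<lambda>k. (c k)\<^sup>2)" using c by (intro summableI_nonneg_bounded) auto
  then have "summable (\<lambda>k. \<kappa> * (c k)\<^sup>2)" by (rule summable_mult)
  then show s: "summable (\<lambda>k. \<sigma> k * (c k)\<^sup>2)"
    by (rule summable_comparison_test'[where N = 0]) (use x(7,9) in \<open>auto intro!: mult_right_mono\<close>)
  have "(\<Sum>k<J. (c k * sqrt (\<sigma> k + b))\<^sup>2) = (\<Sum>k<J. \<sigma> k * (c k)\<^sup>2) + b * (\<Sum>k<J. (c k)\<^sup>2)"
    using pos by (simp add: power_mult_distrib sum.distrib sum_distrib_left algebra_simps less_imp_le)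
  also have "\<dots> \<le> (\<Sum>k. \<sigma> k * (c k)\<^sup>2) + b * C"
    using c[of J] b by (intro add_mono sum_le_suminf s mult_left_mono) (auto simp: x(7))
  finally show "(\<Sum>k<J. (c k * sqrt (\<sigma> k + b))\<^sup>2) \<le> (\<Sum>k. \<sigma> k * (c k)\<^sup>2) + b * C" .
  show "c k * sqrt (\<sigma> k + b) * whiten \<sigma> b x k w = c k * x k w"
    using pos[of k] by (simp add: whiten_def)
qed

context iid_sample
begin

text \<open>The event is chosen before \<open>c\<close>, \<open>C\<close> and \<open>u\<close>, so
  the estimate applies to the coefficients of the estimation error. The accuracy
  \<open>sqrt t\<close> is relative to the regularized norm; the failure probability is driven by
  the squared feature length \<open>\<kappa> / b\<close> times the effective dimension
  \<open>N\<close>.\<close>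

lemma design_event:
  assumes x: "feature_block \<mu> x \<sigma> \<kappa>" and b: "b > 0"
    and N: "\<And>J. (\<Sum>k<J. \<sigma> k / (\<sigma> k + b)) \<le> N" and n: "n > 0" and t: "t > 0"
  shows "\<exists>A\<in>sets Q. prob A \<le> \<kappa> / b * N / real n / t \<and> (\<forall>\<omega>\<in>space Q - A. \<forall>c C u.
     (\<forall>J. (\<Sum>k<J. (c k)\<^sup>2) \<le> C) \<longrightarrow> (\<forall>i<n. (\<lambda>k. c k * x k (W i \<omega>)) sums u i) \<longrightarrow>
     \<bar>(1 / real n) * (\<Sum>i<n. (u i)\<^sup>2) - (\<Sum>k. \<sigma> k * (c k)\<^sup>2)\<bar> \<le> sqrt t * ((\<Sum>k. \<sigma> k * (c k)\<^sup>2) + b * C))"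
proof -
  interpret mu: prob_space \<mu> by (rule prob_space_mu)
  note wx = mu.whiten_facts[OF x b]
  have pos: "\<sigma> k + b > 0" for k using mu.feature_block_facts(7)[OF x, of k] b by simp
  have N': "(\<Sum>k<J. \<integral>w. (whiten \<sigma> b x k w)\<^sup>2 \<partial>\<mu>) \<le> N" for J
    using N[of J] by (simp only: wx(4))
  obtain A where A: "A \<in> sets Q" "prob A \<le> \<kappa> / b * N / real n / t"
    and D: "\<forall>\<omega>\<in>space Q - A. \<forall>J. (\<Sum>j<J. \<Sum>k<J. ((1 / real n) *
        (\<Sum>i<n. whiten \<sigma> b x j (W i \<omega>) * whiten \<sigma> b x k (W i \<omega>)) -
        (\<integral>w. whiten \<sigma> b x j w * whiten \<sigma> b x k w \<partial>\<mu>))\<^sup>2) \<le> t"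
    using hilbert_schmidt_event[OF wx(1,2) wx(1,3) N' n t] by (elim bexE conjE) (rule that; assumption)
  have "\<bar>(1 / real n) * (\<Sum>i<n. (u i)\<^sup>2) - (\<Sum>k. \<sigma> k * (c k)\<^sup>2)\<bar> \<le> sqrt t * ((\<Sum>k. \<sigma> k * (c k)\<^sup>2) + b * C)"
    if \<omega>: "\<omega> \<in> space Q - A" and c: "\<And>J. (\<Sum>k<J. (c k)\<^sup>2) \<le> C"
      and u: "\<And>i. i < n \<Longrightarrow> (\<lambda>k. c k * x k (W i \<omega>)) sums u i" for \<omega> c C u
  proof -
    note wc = mu.whiten_coef[OF x b c]
    let ?a = "\<lambda>k. c k * sqrt (\<sigma> k + b)" let ?S = "(\<Sum>k. \<sigma> k * (c k)\<^sup>2)"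
    have "\<bar>(1 / real n) * (\<Sum>i<n. u i * u i) - ?S\<bar> \<le> sqrt (t * (?S + b * C) * (?S + b * C))"
    proof (rule empirical_bilinear_bound)
      show "(\<lambda>k. ?a k * whiten \<sigma> b x k (W i \<omega>)) sums u i" if "i < n" for i
        unfolding wc(3) using u[OF that] .
      then show "(\<lambda>k. ?a k * whiten \<sigma> b x k (W i \<omega>)) sums u i" if "i < n" for i using that .
      show "(\<Sum>k<J. (?a k)\<^sup>2) \<le> ?S + b * C" for J by (rule wc(2))
      then show "(\<Sum>k<J. (?a k)\<^sup>2) \<le> ?S + b * C" for J .
      show "(\<Sum>j<J. \<Sum>k<J. ((1 / real n) *
        (\<Sum>i<n. whiten \<sigma> b x j (W i \<omega>) * whiten \<sigma> b x k (W i \<omega>)) -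
        (if j = k then \<sigma> k / (\<sigma> k + b) else 0))\<^sup>2) \<le> t" for J
        using D[rule_format, OF \<omega>, of J] by (simp only: wx(5))
      \<comment> \<open>In whitened coordinates the population matrix is diagonal with entries
        \<open>\<sigma> k / (\<sigma> k + b)\<close>, and the weights in \<open>?a\<close> cancel
        the denominators.\<close>
      have "(\<Sum>j<J. \<Sum>k<J. ?a j * ?a k * (if j = k then \<sigma> k / (\<sigma> k + b) else 0)) = (\<Sum>k<J. \<sigma> k * (c k)\<^sup>2)" for J
      proof (intro sum.cong refl)
        fix j assume j: "j \<in> {..<J}"
        have "(\<Sum>k<J. ?a j * ?a k * (if j = k then \<sigma> k / (\<sigma> k + b) else 0))
          = (\<Sum>k<J. if j = k then ?a j * ?a k * (\<sigma> k / (\<sigma> k + b)) else 0)"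
          by (intro sum.cong) auto
        also have "\<dots> = (c j)\<^sup>2 * ((sqrt (\<sigma> j + b))\<^sup>2 * (\<sigma> j / (\<sigma> j + b)))"
          using j by (simp add: power2_eq_square)
        also have "(sqrt (\<sigma> j + b))\<^sup>2 * (\<sigma> j / (\<sigma> j + b)) = \<sigma> j"
          using pos[of j] by simp
        finally show "(\<Sum>k<J. ?a j * ?a k * (if j = k then \<sigma> k / (\<sigma> k + b) else 0)) = \<sigma> j * (c j)\<^sup>2"
          by simp
      qed
      then show "(\<lambda>J. \<Sum>j<J. \<Sum>k<J. ?a j * ?a k * (if j = k then \<sigma> k / (\<sigma> k + b) else 0)) \<longlonglongrightarrow> ?S"
        using summable_LIMSEQ[OF wc(1)] by simp
    qed
    moreover have "0 \<le> ?S + b * C"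
      using wc(2)[of 0] by simp
    then have "sqrt (t * (?S + b * C) * (?S + b * C)) = sqrt t * (?S + b * C)"
      by (simp add: real_sqrt_mult)
    ultimately show ?thesis by (simp add: power2_eq_square)
  qed
  then show ?thesis using A by blast
qed

text \<open>Here \<open>z\<close> is the pointwise bounded factor and \<open>x\<close> the summed
  one, so the effective dimension is that of the functional part. As the population matrix vanishes
  by \<open>xz\<close>, the empirical cross form consists of fluctuation alone.\<close>

lemma cross_event:
  assumes x: "feature_block \<mu> x \<sigma> \<kappa>" and z: "feature_block \<mu> z \<sigma>' \<kappa>'"
    and b: "b > 0" and b': "b' > 0"
    and xz: "\<And>j k. (\<integral>w. x j w * z k w \<partial>\<mu>) = 0"
    and N: "\<And>J. (\<Sum>k<J. \<sigma> k / (\<sigma> k + b)) \<le> N" and n: "n > 0" and t: "t > 0"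
  shows "\<exists>A\<in>sets Q. prob A \<le> \<kappa>' / b' * N / real n / t \<and> (\<forall>\<omega>\<in>space Q - A. \<forall>c C u d D w.
     (\<forall>J. (\<Sum>k<J. (c k)\<^sup>2) \<le> C) \<longrightarrow> (\<forall>i<n. (\<lambda>k. c k * x k (W i \<omega>)) sums u i) \<longrightarrow>
     (\<forall>J. (\<Sum>k<J. (d k)\<^sup>2) \<le> D) \<longrightarrow> (\<forall>i<n. (\<lambda>k. d k * z k (W i \<omega>)) sums w i) \<longrightarrow>
     \<bar>(1 / real n) * (\<Sum>i<n. w i * u i)\<bar>
       \<le> sqrt (t * ((\<Sum>k. \<sigma>' k * (d k)\<^sup>2) + b' * D) * ((\<Sum>k. \<sigma> k * (c k)\<^sup>2) + b * C)))"
proof -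
  interpret mu: prob_space \<mu> by (rule prob_space_mu)
  note wx = mu.whiten_facts[OF x b] and wz = mu.whiten_facts[OF z b']
  have 0: "(\<integral>w. whiten \<sigma>' b' z j w * whiten \<sigma> b x k w \<partial>\<mu>) = 0" for j k
  proof -
    have "whiten \<sigma>' b' z j w * whiten \<sigma> b x k w = (x k w * z j w) / (sqrt (\<sigma> k + b) * sqrt (\<sigma>' j + b'))" for w
      by (simp add: whiten_def mult_ac)
    then show ?thesis by (simp add: xz)
  qed
  have N': "(\<Sum>k<J. \<integral>w. (whiten \<sigma> b x k w)\<^sup>2 \<partial>\<mu>) \<le> N" for J
    using N[of J] by (simp only: wx(4))
  obtain A where A: "A \<in> sets Q" "prob A \<le> \<kappa>' / b' * N / real n / t"
    and D: "\<forall>\<omega>\<in>space Q - A. \<forall>J. (\<Sum>j<J. \<Sum>k<J. ((1 / real n) *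
        (\<Sum>i<n. whiten \<sigma>' b' z j (W i \<omega>) * whiten \<sigma> b x k (W i \<omega>)) - 0)\<^sup>2) \<le> t"
    using hilbert_schmidt_event[OF wz(1,2) wx(1,3) N' n t] unfolding 0
    by (elim bexE conjE) (rule that; assumption)
  have "\<bar>(1 / real n) * (\<Sum>i<n. w i * u i)\<bar>
       \<le> sqrt (t * ((\<Sum>k. \<sigma>' k * (d k)\<^sup>2) + b' * E) * ((\<Sum>k. \<sigma> k * (c k)\<^sup>2) + b * C))"
    if \<omega>: "\<omega> \<in> space Q - A" and c: "\<And>J. (\<Sum>k<J. (c k)\<^sup>2) \<le> C" and d: "\<And>J. (\<Sum>k<J. (d k)\<^sup>2) \<le> E"
      and u: "\<And>i. i < n \<Longrightarrow> (\<lambda>k. c k * x k (W i \<omega>)) sums u i"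
      and w: "\<And>i. i < n \<Longrightarrow> (\<lambda>k. d k * z k (W i \<omega>)) sums w i" for \<omega> c C u d E w
  proof -
    note wc = mu.whiten_coef[OF x b c] and wd = mu.whiten_coef[OF z b' d]
    have "\<bar>(1 / real n) * (\<Sum>i<n. w i * u i) - 0\<bar>
       \<le> sqrt (t * ((\<Sum>k. \<sigma>' k * (d k)\<^sup>2) + b' * E) * ((\<Sum>k. \<sigma> k * (c k)\<^sup>2) + b * C))"
      by (rule empirical_bilinear_bound[OF _ _ _ D[rule_format, OF \<omega>] wd(2) wc(2)])
        (use u w in \<open>auto simp: wc(3) wd(3)\<close>)
    then show ?thesis by simp
  qed
  then show ?thesis using A by blast
qed

text \<open>A linear form involves only one feature index, so the noise costs \<open>N / n\<close>
  without the factor \<open>\<kappa> / b\<close> of the quadratic forms.\<close>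

lemma noise_design_event:
  assumes x: "feature_block \<mu> x \<sigma> \<kappa>" and b: "b > 0"
    and N: "\<And>J. (\<Sum>k<J. \<sigma> k / (\<sigma> k + b)) \<le> N" and n: "n > 0" and t: "t > 0"
  shows "\<exists>A\<in>sets Q. prob A \<le> N / real n / t \<and> (\<forall>\<omega>\<in>space Q - A. \<forall>c C u.
     (\<forall>J. (\<Sum>k<J. (c k)\<^sup>2) \<le> C) \<longrightarrow> (\<forall>i<n. (\<lambda>k. c k * x k (W i \<omega>)) sums u i) \<longrightarrow>
     \<bar>(1 / real n) * (\<Sum>i<n. es i \<omega> * u i)\<bar> \<le> sqrt (t * ((\<Sum>k. \<sigma> k * (c k)\<^sup>2) + b * C)))"
proof -
  interpret mu: prob_space \<mu> by (rule prob_space_mu)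
  note wx = mu.whiten_facts[OF x b]
  have N': "(\<Sum>k<J. \<integral>w. (whiten \<sigma> b x k w)\<^sup>2 \<partial>\<mu>) \<le> N" for J
    using N[of J] by (simp only: wx(4))
  obtain A where A: "A \<in> sets Q" "prob A \<le> N / real n / t"
    and D: "\<forall>\<omega>\<in>space Q - A. \<forall>J. (\<Sum>k<J. ((1 / real n) *
        (\<Sum>i<n. es i \<omega> * whiten \<sigma> b x k (W i \<omega>)))\<^sup>2) \<le> t"
    using noise_event[OF wx(1,3) N' n t] by (elim bexE conjE) (rule that; assumption)
  have "\<bar>(1 / real n) * (\<Sum>i<n. es i \<omega> * u i)\<bar> \<le> sqrt (t * ((\<Sum>k. \<sigma> k * (c k)\<^sup>2) + b * C))"
    if \<omega>: "\<omega> \<in> space Q - A" and c: "\<And>J. (\<Sum>k<J. (c k)\<^sup>2) \<le> C"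
      and u: "\<And>i. i < n \<Longrightarrow> (\<lambda>k. c k * x k (W i \<omega>)) sums u i" for \<omega> c C u
  proof -
    note wc = mu.whiten_coef[OF x b c]
    show ?thesis
      by (rule empirical_linear_bound[OF _ D[rule_format, OF \<omega>] wc(2)]) (use u in \<open>auto simp: wc(3)\<close>)
  qed
  then show ?thesis using A by blast
qed

end

section \<open>Rates for penalized estimators\<close>

text \<open>Halving the lower constant and adding 1 to the upper one makes the inequalities for the
  limits strict, and strict inequalities hold eventually.\<close>

lemma same_order_bounds:
  assumes "same_order a b"
  obtains C1 C2 where "C1 > 0" "C2 > 0" "\<forall>\<^sub>F n in sequentially. C1 \<le> a n / b n \<and> a n / b n \<le> C2"
proof -
  obtain C1 C2 where C: "C1 > 0" "C2 > 0" "ereal C1 \<le> liminf (\<lambda>n. ereal (a n / b n))"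
      "limsup (\<lambda>n. ereal (a n / b n)) \<le> ereal C2"
    using assms by (auto simp: same_order_def)
  have "ereal (C1 / 2) < liminf (\<lambda>n. ereal (a n / b n))"
    using C by (intro less_le_trans[OF _ C(3)]) simp
  then have 1: "\<forall>\<^sub>F n in sequentially. ereal (C1 / 2) < ereal (a n / b n)" by (rule less_LiminfD)
  have "limsup (\<lambda>n. ereal (a n / b n)) < ereal (C2 + 1)"
    by (rule le_less_trans[OF C(4)]) simp
  then have 2: "\<forall>\<^sub>F n in sequentially. ereal (a n / b n) < ereal (C2 + 1)" by (rule Limsup_lessD)
  show thesis
    by (rule that[of "C1 / 2" "C2 + 1"]) (use C eventually_conj[OF 1 2] in \<open>auto elim: eventually_mono\<close>)
qed

text \<open>Comparison with the integral of \<open>x powr - a\<close>: by the mean value theorem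
  each term is at most the increment of the antiderivative over the preceding unit interval, and the
  increments telescope.\<close>

lemma sum_powr_tail:
  fixes a :: real
  assumes a: "a > 1" and p: "p \<ge> 1"
  shows "(\<Sum>k\<in>{p<..p + i}. real k powr - a) \<le> (real p powr (1 - a) - real (p + i) powr (1 - a)) / (a - 1)"
proof (induction i)
  case 0 then show ?case by simp
next
  case (Suc i)
  let ?x = "real (p + i)" and ?f = "\<lambda>x::real. x powr (1 - a)"
  have x: "?x > 0" using p by simp
  have "\<exists>z::real>?x. z < ?x + 1 \<and> ?f (?x + 1) - ?f ?x = (?x + 1 - ?x) * ((1 - a) * z powr (1 - a - 1))"
    by (rule MVT2) (use x in \<open>auto intro!: derivative_eq_intros\<close>)
  then obtain z where z: "z > ?x" "z < ?x + 1" "?f (?x + 1) - ?f ?x = (1 - a) * z powr - a" by auto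
  have "(?x + 1) powr - a \<le> z powr - a" using z x a by (intro powr_mono2') auto
  then have "(a - 1) * (?x + 1) powr - a \<le> ?f ?x - ?f (?x + 1)"
    using z a mult_left_mono[of "(?x + 1) powr - a" "z powr - a" "a - 1"] by (simp add: algebra_simps)
  then have "(?x + 1) powr - a \<le> (?f ?x - ?f (?x + 1)) / (a - 1)" using a by (simp add: field_simps)
  moreover have "{p<..p + Suc i} = insert (Suc (p + i)) {p<..p + i}" by auto
  ultimately show ?case using Suc.IH a by (simp add: diff_divide_distrib add_ac)
qed

text \<open>For \<open>r \<le> 1/2\<close> the decay hypothesis is weaker than summability of the eigenvalues, which
  holds since the kernel operators have finite trace.\<close>

lemma effective_dimension:
  fixes \<sigma> l :: "nat \<Rightarrow> real"
  assumes \<sigma>0: "\<And>k. 0 \<le> \<sigma> k" and trace: "\<And>J. (\<Sum>k<J. \<sigma> k) \<le> \<kappa>"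
    and decay: "\<And>k. k \<ge> 1 \<Longrightarrow> \<sigma> k \<le> c * real k powr (- 2 * r)" and r: "r > 0"
    and l: "C1 > 0" "\<forall>\<^sub>F n in sequentially. C1 \<le> (l n)\<^sup>2 / real n powr (- (2 * r / (2 * r + 1)))"
  shows "\<exists>C>0. \<forall>\<^sub>F n in sequentially. \<forall>J. (\<Sum>k<J. \<sigma> k / (\<sigma> k + (l n)\<^sup>2)) \<le> C * real n * (l n)\<^sup>2"
proof -
  have \<kappa>: "0 \<le> \<kappa>" using trace[of 0] by simp
  have c: "0 \<le> c" using decay[of 1] \<sigma>0[of 1] by simp
  have lb: "\<forall>\<^sub>F n in sequentially. n \<ge> 1 \<and> C1 * real n powr (- (2 * r / (2 * r + 1))) \<le> (l n)\<^sup>2"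
    using l(2) eventually_ge_at_top[of 1] by eventually_elim (auto simp: field_simps)
  have frac: "\<sigma> k / (\<sigma> k + b) \<le> \<sigma> k / b" if "b > 0" for k and b :: real
    using \<sigma>0[of k] that by (intro divide_left_mono) auto
  show ?thesis
  proof (cases "2 * r \<le> 1")
    case True
    \<comment> \<open>The summand 1 keeps the constant positive when \<open>\<kappa>\<close> is
      0.\<close>
    have "\<forall>\<^sub>F n in sequentially. \<forall>J. (\<Sum>k<J. \<sigma> k / (\<sigma> k + (l n)\<^sup>2)) \<le> (\<kappa> / C1\<^sup>2 + 1) * real n * (l n)\<^sup>2"
      using lb
    proof eventually_elim
      case (elim n)
      let ?b = "(l n)\<^sup>2" let ?p = "real n powr (- (2 * r / (2 * r + 1)))"
      have n: "real n \<ge> 1" using elim by simp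
      have p: "?p > 0" using elim by simp
      then have b: "?b > 0" using elim l(1) by (meson less_le_trans mult_pos_pos)
      \<comment> \<open>The trace bounds the effective dimension by \<open>\<kappa> / ?b\<close>,
        which is of order \<open>n * ?b\<close> once \<open>n * ?b * ?b\<close> stays away from 0.
        Under the lower bound on \<open>?b\<close> this holds because the exponent
        \<open>1 - 4 * r / (2 * r + 1)\<close> is nonnegative exactly when
        \<open>2 * r \<le> 1\<close>.\<close>
      have "C1\<^sup>2 \<le> C1\<^sup>2 * (real n powr (1 - 4 * r / (2 * r + 1)))"
      proof -
        have "1 \<le> real n powr (1 - 4 * r / (2 * r + 1))"
          by (rule ge_one_powr_ge_zero[OF n]) (use True r in \<open>simp add: field_simps\<close>)
        then show ?thesis by (simp add: mult_le_cancel_left1)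
      qed
      also have "real n powr (1 - 4 * r / (2 * r + 1)) = real n * (?p * ?p)"
        using n r by (simp add: powr_add[symmetric] powr_mult_base)
      also have "C1\<^sup>2 * (real n * (?p * ?p)) = real n * ((C1 * ?p) * (C1 * ?p))" by (simp add: power2_eq_square)
      also have "\<dots> \<le> real n * (?b * ?b)"
        using elim l(1) p by (intro mult_left_mono mult_mono) auto
      finally have 1: "C1\<^sup>2 \<le> real n * ?b * ?b" by (simp add: mult_ac)
      have 2: "\<kappa> / ?b \<le> (\<kappa> / C1\<^sup>2) * real n * ?b"
        using mult_left_mono[OF 1 \<kappa>] b l(1) by (simp add: field_simps)
      show ?case
      proof
        fix J
        have "(\<Sum>k<J. \<sigma> k / (\<sigma> k + ?b)) \<le> (\<Sum>k<J. \<sigma> k / ?b)" by (intro sum_mono frac b)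
        also have "\<dots> \<le> \<kappa> / ?b" using trace b by (simp add: sum_divide_distrib[symmetric] divide_right_mono)
        also note 2
        also have "(\<kappa> / C1\<^sup>2) * real n * ?b \<le> (\<kappa> / C1\<^sup>2 + 1) * real n * ?b"
          by (intro mult_right_mono) auto
        finally show "(\<Sum>k<J. \<sigma> k / (\<sigma> k + ?b)) \<le> (\<kappa> / C1\<^sup>2 + 1) * real n * ?b" .
      qed
    qed
    moreover have "\<kappa> / C1\<^sup>2 + 1 > 0" using \<kappa> l(1) by (intro add_nonneg_pos) auto
    ultimately show ?thesis by blast
  next
    case False
    then have a: "2 * r > 1" by simp
    \<comment> \<open>The 3 pays for the head of the sum, the fraction for its tail, and the
      division by \<open>C1\<close> for the comparison
      \<open>C1 * q \<le> real n * ?b\<close>.\<close>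
    define C where "C = (3 + c / ((2 * r - 1) * C1)) / C1"
    have "\<forall>\<^sub>F n in sequentially. \<forall>J. (\<Sum>k<J. \<sigma> k / (\<sigma> k + (l n)\<^sup>2)) \<le> C * real n * (l n)\<^sup>2"
      using lb
    proof eventually_elim
      case (elim n)
      let ?b = "(l n)\<^sup>2"
      \<comment> \<open>At index \<open>q\<close> the decay \<open>k powr - 2 * r\<close> has fallen
        to \<open>n powr - (2 * r / (2 * r + 1))\<close>. Up to it each summand is at most 1, beyond
        it the decay is used. Index 0, about which the decay says nothing, lies in the head
        \<open>{..p}\<close>, whose \<open>p + 1\<close> terms number at most
        \<open>3 * q\<close>.\<close>
      define q where "q = real n powr (1 / (2 * r + 1))"
      define p where "p = nat \<lceil>q\<rceil>"
      have n: "real n \<ge> 1" using elim by simp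
      have q1: "q \<ge> 1" unfolding q_def by (rule ge_one_powr_ge_zero[OF n]) (use r in simp)
      have p: "q \<le> real p" "real p \<le> q + 1" "p \<ge> 1" using q1 unfolding p_def by linarith+
      have qp: "real n powr (- (2 * r / (2 * r + 1))) = q powr (- 2 * r)"
        unfolding q_def by (simp add: powr_powr)
      have b: "?b > 0" using elim l(1) n by (smt (verit) mult_pos_pos powr_gt_zero)
      have bq: "C1 * q powr (- 2 * r) \<le> ?b" using elim qp by simp
      have nq: "C1 * q \<le> real n * ?b"
      proof -
        have "real n = q powr (2 * r + 1)" unfolding q_def using n r by (simp add: powr_powr)
        then have "q = real n * q powr (- 2 * r)" using q1 by (simp add: powr_add[symmetric])
        then have "C1 * q = real n * (C1 * q powr (- 2 * r))" by simp
        also have "\<dots> \<le> real n * ?b" using bq by (intro mult_left_mono) auto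
        finally show ?thesis .
      qed
      show ?case
      proof
        fix J
        have "(\<Sum>k<J. \<sigma> k / (\<sigma> k + ?b)) \<le> (\<Sum>k\<in>{..p} \<union> {p<..p + J}. \<sigma> k / (\<sigma> k + ?b))"
          using \<sigma>0 b by (intro sum_mono2) auto
        also have "\<dots> = (\<Sum>k\<in>{..p}. \<sigma> k / (\<sigma> k + ?b)) + (\<Sum>k\<in>{p<..p + J}. \<sigma> k / (\<sigma> k + ?b))"
          by (intro sum.union_disjoint) auto
        also have "(\<Sum>k\<in>{..p}. \<sigma> k / (\<sigma> k + ?b)) \<le> (\<Sum>k\<in>{..p}. 1)"
          using \<sigma>0 b by (intro sum_mono) (simp add: add_nonneg_pos)
        also have "(\<Sum>k\<in>{p<..p + J}. \<sigma> k / (\<sigma> k + ?b)) \<le> (\<Sum>k\<in>{p<..p + J}. c / ?b * real k powr - (2 * r))"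
        proof (intro sum_mono)
          fix k assume "k \<in> {p<..p + J}"
          then have "\<sigma> k \<le> c * real k powr - (2 * r)" using decay[of k] by simp
          then have "\<sigma> k / ?b \<le> c * real k powr - (2 * r) / ?b" using b by (intro divide_right_mono) auto
          then show "\<sigma> k / (\<sigma> k + ?b) \<le> c / ?b * real k powr - (2 * r)" using frac[OF b, of k] by simp
        qed
        also have "\<dots> = c / ?b * (\<Sum>k\<in>{p<..p + J}. real k powr - (2 * r))" by (simp add: sum_distrib_left)
        also have "(\<Sum>k\<in>{p<..p + J}. real k powr - (2 * r)) \<le> real p powr (1 - 2 * r) / (2 * r - 1)"
        proof -
          have "(\<Sum>k\<in>{p<..p + J}. real k powr - (2 * r))
              \<le> (real p powr (1 - 2 * r) - real (p + J) powr (1 - 2 * r)) / (2 * r - 1)"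
            by (rule sum_powr_tail[OF a p(3)])
          also have "\<dots> \<le> real p powr (1 - 2 * r) / (2 * r - 1)" using a by (intro divide_right_mono) auto
          finally show ?thesis .
        qed
        also have "real p powr (1 - 2 * r) \<le> q powr (1 - 2 * r)"
          using p q1 a by (intro powr_mono2') auto
        also have "c / ?b * (q powr (1 - 2 * r) / (2 * r - 1)) \<le> c / (C1 * q powr (- 2 * r)) * (q powr (1 - 2 * r) / (2 * r - 1))"
          using bq b c l(1) q1 a by (intro mult_right_mono divide_left_mono) auto
        also have "\<dots> = c / ((2 * r - 1) * C1) * q"
        proof -
          have "q powr (1 - 2 * r) = q * q powr (- 2 * r)" using q1 by (simp add: powr_mult_base)
          then show ?thesis using q1 by (simp add: field_simps)
        qed
        also have "(\<Sum>k\<in>{..p}. 1::real) \<le> 3 * q" using p q1 by simp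
        finally have "(\<Sum>k<J. \<sigma> k / (\<sigma> k + ?b)) \<le> 3 * q + c / ((2 * r - 1) * C1) * q"
          using c a b by (simp add: divide_right_mono mult_left_mono)
        also have "\<dots> = C * (C1 * q)" unfolding C_def using l(1) by (simp add: field_simps)
        also have "\<dots> \<le> C * (real n * ?b)"
          using nq c a l(1) by (intro mult_left_mono) (auto simp: C_def)
        finally show "(\<Sum>k<J. \<sigma> k / (\<sigma> k + ?b)) \<le> C * real n * ?b" by (simp add: mult_ac)
      qed
    qed
    moreover have "C > 0" unfolding C_def using c a l(1) by (intro divide_pos_pos add_pos_nonneg) auto
    ultimately show ?thesis by blast
  qed
qed

lemma abs_mult_le_sum_squares: "\<bar>a * b\<bar> \<le> a\<^sup>2 + (b :: real)\<^sup>2"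
proof -
  have "0 \<le> \<bar>a\<bar> * \<bar>b\<bar>" by simp
  moreover have "2 * (\<bar>a\<bar> * \<bar>b\<bar>) \<le> a\<^sup>2 + b\<^sup>2"
    using sum_squares_bound[of "\<bar>a\<bar>" "\<bar>b\<bar>"] by (simp add: mult.assoc)
  ultimately show ?thesis unfolding abs_mult by linarith
qed

text \<open>Parseval's identity for the population norm. The partial sums have the stated second
  moments because the features are uncorrelated, and Cauchy-Schwarz dominates their squares by the
  constant \<open>C * \<kappa>\<close>, so the limit passes under the integral.\<close>

lemma (in prob_space) feature_block_norm:
  fixes c :: "nat \<Rightarrow> real"
  assumes x: "feature_block M x \<sigma> \<kappa>" and c: "\<And>J. (\<Sum>k<J. (c k)\<^sup>2) \<le> C"
    and u: "AE w in M. (\<lambda>k. c k * x k w) sums u w" "u \<in> borel_measurable M"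
  shows "integrable M (\<lambda>w. (u w)\<^sup>2)" "expectation (\<lambda>w. (u w)\<^sup>2) = (\<Sum>k. \<sigma> k * (c k)\<^sup>2)"
proof -
  note x' = feature_block_facts[OF x]
  have sm: "summable (\<lambda>k. \<sigma> k * (c k)\<^sup>2)" using whiten_coef(1)[OF x, of 1 c C] c by simp
  let ?s = "\<lambda>J w. (\<Sum>k<J. c k * x k w)\<^sup>2"
  have C0: "0 \<le> C" using c[of 0] by simp
  have m: "?s J \<in> borel_measurable M" for J using x'(1) by simp
  have lim: "AE w in M. (\<lambda>J. ?s J w) \<longlonglongrightarrow> (u w)\<^sup>2"
    using u(1) by eventually_elim (auto simp: sums_def intro: tendsto_power)
  have bd: "AE w in M. norm (?s J w) \<le> C * \<kappa>" for J
    using x'(2)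
  proof eventually_elim
    case (elim w)
    have "?s J w \<le> (\<Sum>k<J. (c k)\<^sup>2) * (\<Sum>k<J. (x k w)\<^sup>2)" by (rule Cauchy_Schwarz_ineq_sum)
    also have "\<dots> \<le> C * \<kappa>" using elim c C0 by (intro mult_mono sum_nonneg) auto
    finally show ?case by simp
  qed
  have um: "(\<lambda>w. (u w)\<^sup>2) \<in> borel_measurable M" using u(2) by simp
  have ci: "integrable M (\<lambda>w. C * \<kappa>)" by simp
  note dct = integrable_dominated_convergence[OF um m ci lim bd]
    integral_dominated_convergence[OF um m ci lim bd]
  show "integrable M (\<lambda>w. (u w)\<^sup>2)" by (rule dct(1))
  have E: "expectation (?s J) = (\<Sum>k<J. \<sigma> k * (c k)\<^sup>2)" for J
  proof -
    have ij: "integrable M (\<lambda>w. x j w * x k w)" for j k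
      by (rule Bochner_Integration.integrable_bound[where f = "\<lambda>w. (x j w)\<^sup>2 + (x k w)\<^sup>2"])
        (use x'(1,5) abs_mult_le_sum_squares in auto)
    have "?s J w = (\<Sum>j<J. \<Sum>k<J. c j * c k * (x j w * x k w))" for w
      by (simp add: power2_eq_square sum_product mult_ac)
    then have "expectation (?s J) = (\<Sum>j<J. \<Sum>k<J. c j * c k * expectation (\<lambda>w. x j w * x k w))"
      using ij by simp
    also have "\<dots> = (\<Sum>j<J. \<Sum>k<J. if j = k then c j * c k * \<sigma> k else 0)"
      unfolding x'(3) by (intro sum.cong) auto
    also have "\<dots> = (\<Sum>k<J. \<sigma> k * (c k)\<^sup>2)" by (auto simp: power2_eq_square intro!: sum.cong)
    finally show ?thesis .
  qed
  show "expectation (\<lambda>w. (u w)\<^sup>2) = (\<Sum>k. \<sigma> k * (c k)\<^sup>2)"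
    using LIMSEQ_unique[OF dct(2)] summable_LIMSEQ[OF sm] unfolding E by blast
qed

text \<open>\<open>a = A\<^sup>2\<close> and \<open>b = B\<^sup>2\<close> are the penalized squared norms of the estimation errors of the
  functional and the nonparametric component. Since the cross term is \<open>O(l / x)\<close> times \<open>A * B\<close> and
  \<open>B = O(x)\<close>, it contributes only \<open>O(l * A)\<close> to the second normal equation.\<close>

lemma rates_from_normal_equations:
  fixes A B l x :: real
  assumes nn: "0 \<le> A" "0 \<le> B" "0 \<le> \<gamma>" "0 \<le> \<gamma>'" "0 < l" "0 < x" "l \<le> x"
    and A: "A\<^sup>2 = a + l\<^sup>2 * \<gamma>\<^sup>2" and B: "B\<^sup>2 = b + x\<^sup>2 * \<gamma>'\<^sup>2" and ab: "0 \<le> a" "0 \<le> b"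
    and UW: "0 \<le> U" "0 \<le> V"
    and U: "\<bar>U - a\<bar> \<le> (1/2) * (a + L * l\<^sup>2 * \<gamma>\<^sup>2)" and V: "\<bar>V - b\<bar> \<le> (1/2) * (b + L * x\<^sup>2 * \<gamma>'\<^sup>2)"
    and L: "0 \<le> L"
    and X: "\<bar>X\<bar> \<le> S * (l / x) * (A * B)" and small: "S * (l / x) \<le> 1 / (4 * (1 + L))"
    and e1: "\<bar>e1\<bar> \<le> S * (l * A)" and e2: "\<bar>e2\<bar> \<le> S * (x * B)" and S: "0 \<le> S"
    and p: "\<gamma>\<^sup>2 - B0 * \<gamma> \<le> p" and q: "\<gamma>'\<^sup>2 - B0 * \<gamma>' \<le> q" and B0: "0 \<le> B0"
    and eq1: "U + V + 2 * X + l\<^sup>2 * p + x\<^sup>2 * q = e1 + e2"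
    and eq2: "U + X + l\<^sup>2 * p = e1"
  defines "K \<equiv> 8 * (1 + L) * (S + B0)"
  shows "B \<le> K * x" "A \<le> 2 * (1 + L) * (S + B0 + S * K) * l"
proof -
  \<comment> \<open>This is the coercivity constant of \<open>lower\<close>: an empirical form that
    deviates by half of the population form and by \<open>L / 2\<close> penalties still controls the
    population form once the penalty is added. The assumption \<open>small\<close> says that the
    cross term uses at most half of \<open>c\<close>.\<close>
  define c where "c = 1 / (2 * (1 + L))"
  define T where "T = S * (l / x)"
  have c: "0 < c" using L by (simp add: c_def)
  have T: "T \<le> c / 2" "0 \<le> T" using small L S nn by (auto simp: T_def c_def)
  have lower: "c * (a' + g) \<le> U' + g"
    if "0 \<le> U'" "\<bar>U' - a'\<bar> \<le> (1/2) * (a' + L * g)" "0 \<le> a'" "0 \<le> g" for U' a' g :: real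
  proof -
    have "a' - L * g \<le> 2 * U'" using abs_le_D2[OF that(2)] by simp
    then have "a' + g \<le> 2 * U' + (1 + L) * g" by (simp add: algebra_simps)
    also have "\<dots> \<le> 2 * (1 + L) * (U' + g)"
    proof -
      have "0 \<le> L * U'" "0 \<le> L * g" using that L by auto
      then show ?thesis using that by (simp add: algebra_simps)
    qed
    finally show ?thesis using L by (simp add: c_def field_simps)
  qed
  have lA: "c * A\<^sup>2 \<le> U + l\<^sup>2 * \<gamma>\<^sup>2"
    unfolding A by (rule lower) (use U UW ab in \<open>auto simp: mult.assoc\<close>)
  have lB: "c * B\<^sup>2 \<le> V + x\<^sup>2 * \<gamma>'\<^sup>2"
    unfolding B by (rule lower) (use V UW ab in \<open>auto simp: mult.assoc\<close>)
  have gA: "l * \<gamma> \<le> A" by (rule power2_le_imp_le) (use A ab nn in \<open>auto simp: power_mult_distrib\<close>)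
  have gB: "x * \<gamma>' \<le> B" by (rule power2_le_imp_le) (use B ab nn in \<open>auto simp: power_mult_distrib\<close>)
  \<comment> \<open>Through \<open>l * \<gamma> \<le> A\<close> the bias
    \<open>B0 * l\<^sup>2 * \<gamma>\<close> takes the shape \<open>l * A\<close> of the noise
    terms.\<close>
  have pA: "l\<^sup>2 * \<gamma>\<^sup>2 \<le> l\<^sup>2 * p + B0 * (l * A)"
  proof -
    have "l\<^sup>2 * (\<gamma>\<^sup>2 - B0 * \<gamma>) \<le> l\<^sup>2 * p" by (rule mult_left_mono[OF p]) simp
    moreover have "B0 * (l * (l * \<gamma>)) \<le> B0 * (l * A)" using gA B0 nn by (intro mult_left_mono) auto
    ultimately show ?thesis by (simp add: algebra_simps power2_eq_square)
  qed
  have qB: "x\<^sup>2 * \<gamma>'\<^sup>2 \<le> x\<^sup>2 * q + B0 * (x * B)"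
  proof -
    have "x\<^sup>2 * (\<gamma>'\<^sup>2 - B0 * \<gamma>') \<le> x\<^sup>2 * q" by (rule mult_left_mono[OF q]) simp
    moreover have "B0 * (x * (x * \<gamma>')) \<le> B0 * (x * B)" using gB B0 nn by (intro mult_left_mono) auto
    ultimately show ?thesis by (simp add: algebra_simps power2_eq_square)
  qed
  have X': "\<bar>X\<bar> \<le> T * (A * B)" using X by (simp add: T_def)
  have "c * A\<^sup>2 + c * B\<^sup>2 \<le> e1 + e2 - 2 * X + B0 * (l * A) + B0 * (x * B)"
    using lA lB pA qB eq1 by linarith
  also have "\<dots> \<le> (S + B0) * (l * A) + (S + B0) * (x * B) + 2 * (T * (A * B))"
    using e1 e2 X' by (simp add: abs_le_iff algebra_simps)
  \<comment> \<open>The cross term is absorbed by half of the coercive left side. The remaining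
    \<open>l\<close> is then enlarged to \<open>x\<close>, since this equation yields only the
    slower rate.\<close>
  also have "2 * (T * (A * B)) \<le> T * (A\<^sup>2 + B\<^sup>2)"
    using mult_left_mono[OF sum_squares_bound[of A B] T(2)] by (simp add: algebra_simps)
  also have "\<dots> \<le> (c / 2) * (A\<^sup>2 + B\<^sup>2)" using T by (intro mult_right_mono) auto
  also have "(S + B0) * (l * A) \<le> (S + B0) * (x * A)" using nn S B0 by (intro mult_left_mono mult_right_mono) auto
  finally have *: "(c / 2) * (A\<^sup>2 + B\<^sup>2) \<le> (S + B0) * x * (A + B)" by (simp add: algebra_simps)
  have "(A + B)\<^sup>2 \<le> 2 * (A\<^sup>2 + B\<^sup>2)" using sum_squares_bound[of A B] by (simp add: power2_sum)
  then have "(c / 4) * (A + B)\<^sup>2 \<le> (c / 4) * (2 * (A\<^sup>2 + B\<^sup>2))" by (rule mult_left_mono) (use c in simp)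
  also have "\<dots> = (c / 2) * (A\<^sup>2 + B\<^sup>2)" by simp
  also note *
  finally have "(c / 4) * (A + B) * (A + B) \<le> (S + B0) * x * (A + B)"
    by (simp add: power2_eq_square mult.assoc)
  moreover have "0 \<le> (S + B0) * x" using S B0 nn by simp
  ultimately have "(c / 4) * (A + B) \<le> (S + B0) * x"
    using nn by (cases "A + B = 0") (auto simp: mult_le_cancel_right)
  \<comment> \<open>Dividing by \<open>c / 4\<close> produces the factor \<open>8 * (1 + L)\<close>
    of \<open>K\<close>.\<close>
  then have "A + B \<le> K * x" using L by (simp add: c_def K_def field_simps)
  then show BK: "B \<le> K * x" using nn by simp
  have "c * A\<^sup>2 \<le> e1 - X + B0 * (l * A)" using lA pA eq2 by linarith
  also have "\<dots> \<le> (S + B0) * (l * A) + T * (A * B)" using e1 X' by (simp add: abs_le_iff algebra_simps)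
  also have "T * (A * B) \<le> T * (A * (K * x))" using BK T nn by (intro mult_left_mono) auto
  also have "T * (A * (K * x)) = S * K * (l * A)" using nn by (simp add: T_def)
  finally have "c * A * A \<le> (S + B0 + S * K) * l * A" by (simp add: algebra_simps power2_eq_square)
  moreover have "0 \<le> (S + B0 + S * K) * l" using S B0 L nn by (simp add: K_def)
  ultimately have "c * A \<le> (S + B0 + S * K) * l"
    using nn by (cases "A = 0") (auto simp: mult_le_cancel_right)
  then show "A \<le> 2 * (1 + L) * (S + B0 + S * K) * l" using L by (simp add: c_def field_simps)
qed


context iid_sample
begin

text \<open>Any \<open>u\<close>, \<open>w\<close> expanded along the features with coefficients \<open>c\<close>, \<open>d\<close> that satisfy the two normal
  equations have population norms of order \<open>l\<close> and \<open>b\<close>; \<open>\<gamma>\<close>, \<open>\<gamma>'\<close> stand for the reproducing kernel norms and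
  \<open>p\<close>, \<open>q\<close> for the inner products of the estimators with the errors.\<close>

definition rate_bound :: "(nat \<Rightarrow> 'm \<Rightarrow> real) \<Rightarrow> (nat \<Rightarrow> 'm \<Rightarrow> real) \<Rightarrow> (nat \<Rightarrow> real) \<Rightarrow> (nat \<Rightarrow> real) \<Rightarrow>
    nat \<Rightarrow> real \<Rightarrow> real \<Rightarrow> real \<Rightarrow> real \<Rightarrow> 'v \<Rightarrow> bool" where
  "rate_bound x z \<sigma> \<sigma>' n l b B0 C \<omega> \<longleftrightarrow> (\<forall>c \<gamma> d \<gamma>' u w p q.
     0 \<le> \<gamma> \<longrightarrow> 0 \<le> \<gamma>' \<longrightarrow> (\<forall>J. (\<Sum>k<J. (c k)\<^sup>2) \<le> \<gamma>\<^sup>2) \<longrightarrow> (\<forall>J. (\<Sum>k<J. (d k)\<^sup>2) \<le> \<gamma>'\<^sup>2) \<longrightarrow>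
     (\<forall>i<n. (\<lambda>k. c k * x k (W i \<omega>)) sums u i) \<longrightarrow> (\<forall>i<n. (\<lambda>k. d k * z k (W i \<omega>)) sums w i) \<longrightarrow>
     \<gamma>\<^sup>2 - B0 * \<gamma> \<le> p \<longrightarrow> \<gamma>'\<^sup>2 - B0 * \<gamma>' \<le> q \<longrightarrow>
     (1 / real n) * (\<Sum>i<n. (u i + w i)\<^sup>2) + l\<^sup>2 * p + b\<^sup>2 * q
       = (1 / real n) * (\<Sum>i<n. es i \<omega> * (u i + w i)) \<longrightarrow>
     (1 / real n) * (\<Sum>i<n. u i * (u i + w i)) + l\<^sup>2 * p = (1 / real n) * (\<Sum>i<n. es i \<omega> * u i) \<longrightarrow>
     (\<Sum>k. \<sigma> k * (c k)\<^sup>2) \<le> C * l\<^sup>2 \<and> (\<Sum>k. \<sigma>' k * (d k)\<^sup>2) \<le> C * b\<^sup>2)"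

text \<open>Five exceptional events belong to the two design forms, the cross form and the two noise
  terms; outside them the deterministic comparison of the normal equations applies. Because
  \<open>lam n / \<xi> n\<close> tends to 0, the coupling of the components eventually becomes as
  small as that comparison demands.\<close>

theorem penalized_rates:
  fixes lam \<xi> :: "nat \<Rightarrow> real"
  assumes x: "feature_block \<mu> x \<sigma> \<kappa>" and z: "feature_block \<mu> z \<sigma>' \<kappa>'"
    and xz: "\<And>j k. (\<integral>w. x j w * z k w \<partial>\<mu>) = 0"
    and pos: "\<forall>n\<ge>1. 0 < lam n \<and> 0 < \<xi> n"
    and N: "\<forall>\<^sub>F n in sequentially. \<forall>J. (\<Sum>k<J. \<sigma> k / (\<sigma> k + (lam n)\<^sup>2)) \<le> CN * real n * (lam n)\<^sup>2"
    and N': "\<forall>\<^sub>F n in sequentially. \<forall>J. (\<Sum>k<J. \<sigma>' k / (\<sigma>' k + (\<xi> n)\<^sup>2)) \<le> CN * real n * (\<xi> n)\<^sup>2"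
    and CN: "CN > 0" and ratio: "(\<lambda>n. lam n / \<xi> n) \<longlonglongrightarrow> 0" and e: "e > 0" and B0: "B0 \<ge> 0"
  shows "\<exists>C>0. \<forall>\<^sub>F n in sequentially. \<exists>A\<in>sets Q. prob A \<le> e \<and> (\<forall>\<omega>\<in>space Q - A.
     rate_bound x z \<sigma> \<sigma>' n (lam n) (\<xi> n) B0 C \<omega>)"
proof -
  interpret mu: prob_space \<mu> by (rule prob_space_mu)
  note fx = mu.feature_block_facts[OF x] and fz = mu.feature_block_facts[OF z]
  \<comment> \<open>Each of the five events may have probability \<open>e / 5\<close>. The design
    events use the threshold \<open>1/4\<close>, hence the deviation factor \<open>1/2\<close> and
    \<open>20 = 4 * 5\<close>; the summand 1 ensures \<open>L \<ge> 1\<close>. In \<open>T\<close>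
    the factor \<open>1 + \<kappa>'\<close> serves the noise events and the cross event
    together.\<close>
  define L where "L = 1 + 20 * (\<kappa> + \<kappa>') * CN / e"
  define T where "T = 5 * (1 + \<kappa>') * CN / e"
  define S where "S = sqrt T"
  define K where "K = 8 * (1 + L) * (S + B0)"
  define K2 where "K2 = 2 * (1 + L) * (S + B0 + S * K)"
  define C where "C = K\<^sup>2 + K2\<^sup>2 + 1"
  have \<kappa>0: "0 \<le> \<kappa>" "0 \<le> \<kappa>'" using fx(10) fz(10) by auto
  have L1: "1 \<le> L" using \<kappa>0 CN e by (simp add: L_def)
  have T0: "0 < T" using \<kappa>0 CN e by (simp add: T_def add_pos_nonneg)
  have S0: "0 \<le> S" "S\<^sup>2 = T" using T0 by (auto simp: S_def)
  have "(\<lambda>n. S * (lam n / \<xi> n)) \<longlonglongrightarrow> S * 0" by (intro tendsto_intros ratio)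
  then have small: "\<forall>\<^sub>F n in sequentially. S * (lam n / \<xi> n) < 1 / (4 * (1 + L))"
    by (rule order_tendstoD(2)) (use L1 in simp)
  have le1: "\<forall>\<^sub>F n in sequentially. lam n / \<xi> n < 1"
    using ratio by (rule order_tendstoD(2)) simp
  have "\<forall>\<^sub>F n in sequentially. \<exists>A\<in>sets Q. prob A \<le> e \<and> (\<forall>\<omega>\<in>space Q - A.
     rate_bound x z \<sigma> \<sigma>' n (lam n) (\<xi> n) B0 C \<omega>)"
    using N N' small le1 eventually_ge_at_top[of 1]
  proof eventually_elim
    case (elim n)
    let ?l = "lam n" and ?x = "\<xi> n"
    have n: "n > 0" and l: "?l > 0" and \<xi>: "?x > 0" using elim pos by auto
    have lx: "?l \<le> ?x" using elim \<xi> by (simp add: field_simps)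
    have l2: "?l\<^sup>2 > 0" "?x\<^sup>2 > 0" "L * ?l\<^sup>2 > 0" "L * ?x\<^sup>2 > 0" using l \<xi> L1 by auto
    \<comment> \<open>Raising the level from \<open>b\<close> to \<open>L * b\<close> can only lower
      the effective dimension, while the pointwise feature bound gains the factor
      \<open>1 / L\<close>. This makes the design exceptional events improbable.\<close>
    have NL: "(\<Sum>k<J. s k / (s k + L * b)) \<le> D" if "\<And>k. 0 \<le> s k" "(\<Sum>k<J. s k / (s k + b)) \<le> D" "b > 0"
      for s :: "nat \<Rightarrow> real" and b D J
    proof -
      have "s k / (s k + L * b) \<le> s k / (s k + b)" for k
        using that(1)[of k] that(3) L1 by (intro divide_left_mono) (auto simp: add_nonneg_pos)
      then have "(\<Sum>k<J. s k / (s k + L * b)) \<le> (\<Sum>k<J. s k / (s k + b))" by (rule sum_mono)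
      with that(2) show ?thesis by simp
    qed
    have NK: "\<And>J. (\<Sum>k<J. \<sigma> k / (\<sigma> k + ?l\<^sup>2)) \<le> CN * real n * ?l\<^sup>2"
      and NG: "\<And>J. (\<Sum>k<J. \<sigma>' k / (\<sigma>' k + ?x\<^sup>2)) \<le> CN * real n * ?x\<^sup>2" using elim by auto
    have NKL: "\<And>J. (\<Sum>k<J. \<sigma> k / (\<sigma> k + L * ?l\<^sup>2)) \<le> CN * real n * ?l\<^sup>2"
      by (rule NL[OF fx(7) NK l2(1)])
    have NGL: "\<And>J. (\<Sum>k<J. \<sigma>' k / (\<sigma>' k + L * ?x\<^sup>2)) \<le> CN * real n * ?x\<^sup>2"
      by (rule NL[OF fz(7) NG l2(2)])
    have quarter: "0 < (1/4::real)" by simp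
    have tpos: "0 < T * (?l\<^sup>2 / ?x\<^sup>2)" "0 < T * ?l\<^sup>2" "0 < T * ?x\<^sup>2" using T0 l2 by auto
    obtain A1 where A1: "A1 \<in> sets Q" "prob A1 \<le> \<kappa> / (L * ?l\<^sup>2) * (CN * real n * ?l\<^sup>2) / real n / (1/4)"
      and E1: "\<forall>\<omega>\<in>space Q - A1. \<forall>c C u. (\<forall>J. (\<Sum>k<J. (c k)\<^sup>2) \<le> C) \<longrightarrow> (\<forall>i<n. (\<lambda>k. c k * x k (W i \<omega>)) sums u i) \<longrightarrow>
        \<bar>(1 / real n) * (\<Sum>i<n. (u i)\<^sup>2) - (\<Sum>k. \<sigma> k * (c k)\<^sup>2)\<bar>
          \<le> sqrt (1/4) * ((\<Sum>k. \<sigma> k * (c k)\<^sup>2) + L * ?l\<^sup>2 * C)"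
      using design_event[OF x l2(3) NKL n quarter] by (elim bexE conjE) (rule that; assumption)
    obtain A2 where A2: "A2 \<in> sets Q" "prob A2 \<le> \<kappa>' / (L * ?x\<^sup>2) * (CN * real n * ?x\<^sup>2) / real n / (1/4)"
      and E2: "\<forall>\<omega>\<in>space Q - A2. \<forall>c C u. (\<forall>J. (\<Sum>k<J. (c k)\<^sup>2) \<le> C) \<longrightarrow> (\<forall>i<n. (\<lambda>k. c k * z k (W i \<omega>)) sums u i) \<longrightarrow>
        \<bar>(1 / real n) * (\<Sum>i<n. (u i)\<^sup>2) - (\<Sum>k. \<sigma>' k * (c k)\<^sup>2)\<bar>
          \<le> sqrt (1/4) * ((\<Sum>k. \<sigma>' k * (c k)\<^sup>2) + L * ?x\<^sup>2 * C)"
      using design_event[OF z l2(4) NGL n quarter] by (elim bexE conjE) (rule that; assumption)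
    \<comment> \<open>The threshold \<open>T * (?l\<^sup>2 / ?x\<^sup>2)\<close> has the order of
      the mean squared Hilbert-Schmidt norm; its square root is the factor
      \<open>S * (?l / ?x)\<close> of the cross term.\<close>
    obtain A3 where A3: "A3 \<in> sets Q" "prob A3 \<le> \<kappa>' / ?x\<^sup>2 * (CN * real n * ?l\<^sup>2) / real n / (T * (?l\<^sup>2 / ?x\<^sup>2))"
      and E3: "\<forall>\<omega>\<in>space Q - A3. \<forall>c C u d D w.
        (\<forall>J. (\<Sum>k<J. (c k)\<^sup>2) \<le> C) \<longrightarrow> (\<forall>i<n. (\<lambda>k. c k * x k (W i \<omega>)) sums u i) \<longrightarrow>
        (\<forall>J. (\<Sum>k<J. (d k)\<^sup>2) \<le> D) \<longrightarrow> (\<forall>i<n. (\<lambda>k. d k * z k (W i \<omega>)) sums w i) \<longrightarrow>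
        \<bar>(1 / real n) * (\<Sum>i<n. w i * u i)\<bar> \<le> sqrt (T * (?l\<^sup>2 / ?x\<^sup>2) *
          ((\<Sum>k. \<sigma>' k * (d k)\<^sup>2) + ?x\<^sup>2 * D) * ((\<Sum>k. \<sigma> k * (c k)\<^sup>2) + ?l\<^sup>2 * C))"
      using cross_event[OF x z l2(1,2) xz NK n tpos(1)] by (elim bexE conjE) (rule that; assumption)
    obtain A4 where A4: "A4 \<in> sets Q" "prob A4 \<le> CN * real n * ?l\<^sup>2 / real n / (T * ?l\<^sup>2)"
      and E4: "\<forall>\<omega>\<in>space Q - A4. \<forall>c C u. (\<forall>J. (\<Sum>k<J. (c k)\<^sup>2) \<le> C) \<longrightarrow> (\<forall>i<n. (\<lambda>k. c k * x k (W i \<omega>)) sums u i) \<longrightarrow>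
        \<bar>(1 / real n) * (\<Sum>i<n. es i \<omega> * u i)\<bar> \<le> sqrt (T * ?l\<^sup>2 * ((\<Sum>k. \<sigma> k * (c k)\<^sup>2) + ?l\<^sup>2 * C))"
      using noise_design_event[OF x l2(1) NK n tpos(2)] by (elim bexE conjE) (rule that; assumption)
    obtain A5 where A5: "A5 \<in> sets Q" "prob A5 \<le> CN * real n * ?x\<^sup>2 / real n / (T * ?x\<^sup>2)"
      and E5: "\<forall>\<omega>\<in>space Q - A5. \<forall>c C u. (\<forall>J. (\<Sum>k<J. (c k)\<^sup>2) \<le> C) \<longrightarrow> (\<forall>i<n. (\<lambda>k. c k * z k (W i \<omega>)) sums u i) \<longrightarrow>
        \<bar>(1 / real n) * (\<Sum>i<n. es i \<omega> * u i)\<bar> \<le> sqrt (T * ?x\<^sup>2 * ((\<Sum>k. \<sigma>' k * (c k)\<^sup>2) + ?x\<^sup>2 * C))"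
      using noise_design_event[OF z l2(2) NG n tpos(3)] by (elim bexE conjE) (rule that; assumption)
    note E1 = E1[rule_format] and E2 = E2[rule_format] and E3 = E3[rule_format] and E4 = E4[rule_format]
      and E5 = E5[rule_format]
    have size: "prob A1 \<le> e / 5" "prob A2 \<le> e / 5" "prob A3 \<le> e / 5" "prob A4 \<le> e / 5" "prob A5 \<le> e / 5"
    proof -
      have Le: "20 * \<kappa> * CN \<le> L * e" "20 * \<kappa>' * CN \<le> L * e"
        using e CN \<kappa>0 L1 by (auto simp: L_def field_simps add_increasing add_increasing2)
      have "4 * \<kappa> * CN / L \<le> e / 5" "4 * \<kappa>' * CN / L \<le> e / 5" using Le using L1 by (auto simp: field_simps)
      moreover have "\<kappa> / (L * ?l\<^sup>2) * (CN * real n * ?l\<^sup>2) / real n / (1/4) = 4 * \<kappa> * CN / L"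
        "\<kappa>' / (L * ?x\<^sup>2) * (CN * real n * ?x\<^sup>2) / real n / (1/4) = 4 * \<kappa>' * CN / L"
        using n l \<xi> by (auto simp: field_simps)
      ultimately show "prob A1 \<le> e / 5" "prob A2 \<le> e / 5" using A1 A2 by linarith+
      have Te: "CN / T \<le> e / 5" "\<kappa>' * CN / T \<le> e / 5"
        unfolding T_def using e CN \<kappa>0 by (auto simp: field_simps add_pos_nonneg)
      moreover have "\<kappa>' / ?x\<^sup>2 * (CN * real n * ?l\<^sup>2) / real n / (T * (?l\<^sup>2 / ?x\<^sup>2)) = \<kappa>' * CN / T"
        "CN * real n * ?l\<^sup>2 / real n / (T * ?l\<^sup>2) = CN / T" "CN * real n * ?x\<^sup>2 / real n / (T * ?x\<^sup>2) = CN / T"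
        using n l \<xi> by auto
      ultimately show "prob A3 \<le> e / 5" "prob A4 \<le> e / 5" "prob A5 \<le> e / 5" using A3 A4 A5 by linarith+
    qed
    let ?A = "A1 \<union> (A2 \<union> (A3 \<union> (A4 \<union> A5)))"
    have "prob ?A \<le> prob A1 + (prob A2 + (prob A3 + (prob A4 + prob A5)))"
      using A1 A2 A3 A4 A5 by (intro order_trans[OF measure_Un_le] add_left_mono) auto
    with size have pA: "prob ?A \<le> e" by linarith
    show ?case unfolding rate_bound_def
    proof (intro bexI[of _ ?A] conjI ballI allI impI)
      fix \<omega> c \<gamma> d \<gamma>' u w p q
      assume \<omega>: "\<omega> \<in> space Q - ?A" and \<gamma>: "0 \<le> \<gamma>" "0 \<le> \<gamma>'"
        and "\<forall>J. (\<Sum>k<J. (c k)\<^sup>2) \<le> \<gamma>\<^sup>2" "\<forall>J. (\<Sum>k<J. (d k)\<^sup>2) \<le> \<gamma>'\<^sup>2"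
        and "\<forall>i<n. (\<lambda>k. c k * x k (W i \<omega>)) sums u i" "\<forall>i<n. (\<lambda>k. d k * z k (W i \<omega>)) sums w i"
        and pq: "\<gamma>\<^sup>2 - B0 * \<gamma> \<le> p" "\<gamma>'\<^sup>2 - B0 * \<gamma>' \<le> q"
        and eq: "(1 / real n) * (\<Sum>i<n. (u i + w i)\<^sup>2) + ?l\<^sup>2 * p + ?x\<^sup>2 * q
             = (1 / real n) * (\<Sum>i<n. es i \<omega> * (u i + w i))"
          "(1 / real n) * (\<Sum>i<n. u i * (u i + w i)) + ?l\<^sup>2 * p = (1 / real n) * (\<Sum>i<n. es i \<omega> * u i)"
      then have c: "\<And>J. (\<Sum>k<J. (c k)\<^sup>2) \<le> \<gamma>\<^sup>2" and d: "\<And>J. (\<Sum>k<J. (d k)\<^sup>2) \<le> \<gamma>'\<^sup>2"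
        and u: "\<And>i. i < n \<Longrightarrow> (\<lambda>k. c k * x k (W i \<omega>)) sums u i"
        and w: "\<And>i. i < n \<Longrightarrow> (\<lambda>k. d k * z k (W i \<omega>)) sums w i" by auto
      have \<omega>': "\<omega> \<in> space Q - A1" "\<omega> \<in> space Q - A2" "\<omega> \<in> space Q - A3" "\<omega> \<in> space Q - A4" "\<omega> \<in> space Q - A5"
        using \<omega> by auto
      define a where "a = (\<Sum>k. \<sigma> k * (c k)\<^sup>2)"
      define b where "b = (\<Sum>k. \<sigma>' k * (d k)\<^sup>2)"
      have ab: "0 \<le> a" "0 \<le> b" unfolding a_def b_def
        using mu.whiten_coef(1)[OF x l2(1) c] mu.whiten_coef(1)[OF z l2(1) d] fx(7) fz(7)
        by (auto intro!: suminf_nonneg)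
      define A where "A = sqrt (a + ?l\<^sup>2 * \<gamma>\<^sup>2)"
      define B where "B = sqrt (b + ?x\<^sup>2 * \<gamma>'\<^sup>2)"
      have AB: "A\<^sup>2 = a + ?l\<^sup>2 * \<gamma>\<^sup>2" "B\<^sup>2 = b + ?x\<^sup>2 * \<gamma>'\<^sup>2" "0 \<le> A" "0 \<le> B"
        using ab by (auto simp: A_def B_def)
      have half: "sqrt (1/4) = 1/(2::real)" by (simp add: real_sqrt_divide)
      have F1: "\<bar>(1 / real n) * (\<Sum>i<n. (u i)\<^sup>2) - a\<bar> \<le> (1/2) * (a + L * ?l\<^sup>2 * \<gamma>\<^sup>2)"
        using E1[OF \<omega>'(1) c u] unfolding half a_def .
      have F2: "\<bar>(1 / real n) * (\<Sum>i<n. (w i)\<^sup>2) - b\<bar> \<le> (1/2) * (b + L * ?x\<^sup>2 * \<gamma>'\<^sup>2)"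
        using E2[OF \<omega>'(2) d w] unfolding half b_def .
      have "sqrt (T * (?l\<^sup>2 / ?x\<^sup>2) * (b + ?x\<^sup>2 * \<gamma>'\<^sup>2) * (a + ?l\<^sup>2 * \<gamma>\<^sup>2)) = S * (?l / ?x) * (A * B)"
        unfolding AB(1,2)[symmetric] S_def using AB(3,4) l \<xi> by (simp add: real_sqrt_mult real_sqrt_divide)
      then have F3: "\<bar>(1 / real n) * (\<Sum>i<n. w i * u i)\<bar> \<le> S * (?l / ?x) * (A * B)"
        using E3[OF \<omega>'(3) c u d w] unfolding a_def b_def by simp
      have "sqrt (T * ?l\<^sup>2 * (a + ?l\<^sup>2 * \<gamma>\<^sup>2)) = S * (?l * A)" "sqrt (T * ?x\<^sup>2 * (b + ?x\<^sup>2 * \<gamma>'\<^sup>2)) = S * (?x * B)"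
        unfolding AB(1,2)[symmetric] S_def using AB(3,4) l \<xi> by (simp_all add: real_sqrt_mult)
      then have F4: "\<bar>(1 / real n) * (\<Sum>i<n. es i \<omega> * u i)\<bar> \<le> S * (?l * A)"
        and F5: "\<bar>(1 / real n) * (\<Sum>i<n. es i \<omega> * w i)\<bar> \<le> S * (?x * B)"
        using E4[OF \<omega>'(4) c u] E5[OF \<omega>'(5) d w] unfolding a_def b_def by simp_all
      have q1: "(1 / real n) * (\<Sum>i<n. (u i)\<^sup>2) + (1 / real n) * (\<Sum>i<n. (w i)\<^sup>2)
          + 2 * ((1 / real n) * (\<Sum>i<n. w i * u i)) + ?l\<^sup>2 * p + ?x\<^sup>2 * q
          = (1 / real n) * (\<Sum>i<n. es i \<omega> * u i) + (1 / real n) * (\<Sum>i<n. es i \<omega> * w i)"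
        using eq(1) by (simp add: power2_sum sum.distrib sum_distrib_left algebra_simps)
      have q2: "(1 / real n) * (\<Sum>i<n. (u i)\<^sup>2) + (1 / real n) * (\<Sum>i<n. w i * u i) + ?l\<^sup>2 * p
          = (1 / real n) * (\<Sum>i<n. es i \<omega> * u i)"
        using eq(2) by (simp add: power2_eq_square sum.distrib algebra_simps)
      have L0: "0 \<le> L" using L1 by simp
      have sm: "S * (?l / ?x) \<le> 1 / (4 * (1 + L))" using elim by simp
      have nn: "0 \<le> (1 / real n) * (\<Sum>i<n. (u i)\<^sup>2)" "0 \<le> (1 / real n) * (\<Sum>i<n. (w i)\<^sup>2)"
        by (simp_all add: sum_nonneg)
      note res = rates_from_normal_equations[OF AB(3,4) \<gamma> l \<xi> lx AB(1,2) ab nn F1 F2 L0 F3 sm F4 F5 S0(1) pq B0 q1 q2,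
          folded K_def, folded K2_def]
      have K0: "0 \<le> K" "0 \<le> K2" using S0 L0 B0 by (auto simp: K_def K2_def)
      have "a \<le> A\<^sup>2" "b \<le> B\<^sup>2" using AB by auto
      moreover have "A\<^sup>2 \<le> (K2 * ?l)\<^sup>2" "B\<^sup>2 \<le> (K * ?x)\<^sup>2" using res AB(3,4) by (auto intro!: power_mono)
      moreover have "K2\<^sup>2 * ?l\<^sup>2 \<le> C * ?l\<^sup>2" "K\<^sup>2 * ?x\<^sup>2 \<le> C * ?x\<^sup>2"
        by (auto simp: C_def intro!: mult_right_mono)
      ultimately show "(\<Sum>k. \<sigma> k * (c k)\<^sup>2) \<le> C * ?l\<^sup>2" "(\<Sum>k. \<sigma>' k * (d k)\<^sup>2) \<le> C * ?x\<^sup>2"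
        unfolding a_def b_def by (auto simp: power_mult_distrib)
    qed (use A1 A2 A3 A4 A5 pA in auto)
  qed
  moreover have "C > 0" by (simp add: C_def add_nonneg_pos)
  ultimately show ?thesis by blast
qed

end

section \<open>Square integrable functions and reproducing kernel spaces\<close>

lemma sq_int_measurable: "f \<in> sq_int \<mu> \<Longrightarrow> f \<in> borel_measurable \<mu>"
  by (simp add: sq_int_def)

lemma sq_int_mult:
  assumes "f \<in> sq_int \<mu>" "g \<in> sq_int \<mu>"
  shows "integrable \<mu> (\<lambda>x. f x * g x)"
proof (rule Bochner_Integration.integrable_bound[where f = "\<lambda>x. (f x)\<^sup>2 + (g x)\<^sup>2"])
  show "AE x in \<mu>. norm (f x * g x) \<le> norm ((f x)\<^sup>2 + (g x)\<^sup>2)"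
    using abs_mult_le_sum_squares by simp
qed (use assms in \<open>auto simp: sq_int_def\<close>)

lemma sq_int_lin:
  assumes "f \<in> sq_int \<mu>" "g \<in> sq_int \<mu>"
  shows "(\<lambda>x. a * f x + b * g x) \<in> sq_int \<mu>"
proof -
  have "(a * f x + b * g x)\<^sup>2 = a\<^sup>2 * (f x)\<^sup>2 + 2 * a * b * (f x * g x) + b\<^sup>2 * (g x)\<^sup>2" for x
    by (simp add: power2_eq_square algebra_simps)
  then show ?thesis using assms sq_int_mult[OF assms] by (auto simp: sq_int_def)
qed

lemma sq_int_diff: "f \<in> sq_int \<mu> \<Longrightarrow> g \<in> sq_int \<mu> \<Longrightarrow> (\<lambda>x. f x - g x) \<in> sq_int \<mu>"
  using sq_int_lin[of f \<mu> g 1 "-1"] by simp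

lemma sq_int_scale: "f \<in> sq_int \<mu> \<Longrightarrow> (\<lambda>x. a * f x) \<in> sq_int \<mu>"
  using sq_int_lin[of f \<mu> f a 0] by simp

lemma l2_inner_commute: "l2_inner \<mu> f g = l2_inner \<mu> g f"
  by (simp add: l2_inner_def mult.commute)

lemma l2_inner_lin:
  assumes "f \<in> sq_int \<mu>" "g \<in> sq_int \<mu>" "h \<in> sq_int \<mu>"
  shows "l2_inner \<mu> h (\<lambda>x. a * f x + b * g x) = a * l2_inner \<mu> h f + b * l2_inner \<mu> h g"
proof -
  have "l2_inner \<mu> h (\<lambda>x. a * f x + b * g x) = (\<integral>x. a * (h x * f x) + b * (h x * g x) \<partial>\<mu>)"
    by (simp add: l2_inner_def algebra_simps)
  then show ?thesis using sq_int_mult[OF assms(3,1)] sq_int_mult[OF assms(3,2)]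
    by (simp add: l2_inner_def)
qed

lemma l2_inner_diff_left:
  assumes "f \<in> sq_int \<mu>" "g \<in> sq_int \<mu>" "h \<in> sq_int \<mu>"
  shows "l2_inner \<mu> (\<lambda>x. f x - g x) h = l2_inner \<mu> f h - l2_inner \<mu> g h"
  using l2_inner_lin[OF assms, of 1 "-1"] by (simp add: l2_inner_commute)

lemma l2_inner_scale: "l2_inner \<mu> (\<lambda>x. a * f x) g = a * l2_inner \<mu> f g"
  by (simp add: l2_inner_def mult.assoc)

lemma l2_inner_cong_AE:
  assumes "AE x in \<mu>. f x = f' x" "f \<in> borel_measurable \<mu>" "f' \<in> borel_measurable \<mu>" "g \<in> borel_measurable \<mu>"
  shows "l2_inner \<mu> f g = l2_inner \<mu> f' g"
  unfolding l2_inner_def by (rule integral_cong_AE) (use assms in auto)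

lemma l2_inner_ge0: "0 \<le> l2_inner \<mu> f f"
  unfolding l2_inner_def by (rule integral_nonneg_AE) simp

lemma l2_norm_sq: "(l2_norm \<mu> f)\<^sup>2 = l2_inner \<mu> f f"
  unfolding l2_norm_def using l2_inner_ge0 by simp

lemma l2_norm_ge0: "0 \<le> l2_norm \<mu> f"
  unfolding l2_norm_def using l2_inner_ge0 by simp

lemma l2_inner_eq0:
  assumes "f \<in> sq_int \<mu>" "l2_inner \<mu> f f = 0"
  shows "AE x in \<mu>. f x = 0"
proof -
  have "integrable \<mu> (\<lambda>x. f x * f x)" using assms sq_int_mult by blast
  then have "AE x in \<mu>. f x * f x = 0"
    using assms(2) integral_nonneg_eq_0_iff_AE[of \<mu> "\<lambda>x. f x * f x"] by (simp add: l2_inner_def)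
  then show ?thesis by simp
qed

lemma l2_inner_square:
  assumes "f \<in> sq_int \<mu>" "g \<in> sq_int \<mu>"
  shows "l2_inner \<mu> (\<lambda>x. a * f x + b * g x) (\<lambda>x. a * f x + b * g x)
    = a\<^sup>2 * l2_inner \<mu> f f + 2 * a * b * l2_inner \<mu> f g + b\<^sup>2 * l2_inner \<mu> g g"
proof -
  have "l2_inner \<mu> (\<lambda>x. a * f x + b * g x) (\<lambda>x. a * f x + b * g x)
    = (\<integral>x. a\<^sup>2 * (f x * f x) + 2 * a * b * (f x * g x) + b\<^sup>2 * (g x * g x) \<partial>\<mu>)"
    by (simp add: l2_inner_def power2_eq_square algebra_simps)
  then show ?thesis
    using sq_int_mult[OF assms] sq_int_mult[OF assms(1,1)] sq_int_mult[OF assms(2,2)]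
    by (simp add: l2_inner_def)
qed

lemma l2_Cauchy_Schwarz:
  assumes "f \<in> sq_int \<mu>" "g \<in> sq_int \<mu>"
  shows "\<bar>l2_inner \<mu> f g\<bar> \<le> l2_norm \<mu> f * l2_norm \<mu> g"
proof -
  have "(l2_inner \<mu> f g)\<^sup>2 \<le> l2_inner \<mu> f f * l2_inner \<mu> g g"
  proof (cases "l2_inner \<mu> g g = 0")
    case True
    then have "AE x in \<mu>. g x = 0" using l2_inner_eq0 assms by blast
    then have "l2_inner \<mu> g f = l2_inner \<mu> (\<lambda>x. 0) f"
      by (rule l2_inner_cong_AE) (use assms in \<open>auto simp: sq_int_def\<close>)
    then have "l2_inner \<mu> f g = 0"
      using l2_inner_commute[of \<mu> f g] by (simp add: l2_inner_def[of \<mu> "\<lambda>x. 0"])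
    then show ?thesis using True by simp
  next
    case False
    then have pos: "l2_inner \<mu> g g > 0" using l2_inner_ge0[of \<mu> g] by simp
    let ?h = "\<lambda>x. l2_inner \<mu> g g * f x + (- l2_inner \<mu> f g) * g x"
    have "0 \<le> l2_inner \<mu> ?h ?h" by (rule l2_inner_ge0)
    also have "\<dots> = l2_inner \<mu> g g * (l2_inner \<mu> f f * l2_inner \<mu> g g - (l2_inner \<mu> f g)\<^sup>2)"
      unfolding l2_inner_square[OF assms] by (simp add: power2_eq_square algebra_simps)
    finally show ?thesis using pos by (simp add: zero_le_mult_iff)
  qed
  then have "sqrt ((l2_inner \<mu> f g)\<^sup>2) \<le> sqrt (l2_inner \<mu> f f * l2_inner \<mu> g g)" by (rule real_sqrt_le_mono)
  then show ?thesis by (simp add: l2_norm_def real_sqrt_mult)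
qed

lemma l2_norm_diff:
  assumes "f \<in> sq_int \<mu>" "g \<in> sq_int \<mu>"
  shows "\<bar>l2_norm \<mu> f - l2_norm \<mu> g\<bar> \<le> l2_norm \<mu> (\<lambda>x. f x - g x)"
proof -
  have "(l2_norm \<mu> (\<lambda>x. f x - g x))\<^sup>2 = (l2_norm \<mu> f)\<^sup>2 - 2 * l2_inner \<mu> f g + (l2_norm \<mu> g)\<^sup>2"
    using l2_inner_square[OF assms, of 1 "-1"] by (simp add: l2_norm_sq)
  moreover have "l2_inner \<mu> f g \<le> l2_norm \<mu> f * l2_norm \<mu> g" using l2_Cauchy_Schwarz[OF assms] by simp
  ultimately have "\<bar>l2_norm \<mu> f - l2_norm \<mu> g\<bar>\<^sup>2 \<le> (l2_norm \<mu> (\<lambda>x. f x - g x))\<^sup>2"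
    by (simp add: power2_diff)
  then show ?thesis by (rule power2_le_imp_le) (rule l2_norm_ge0)
qed

lemma space_l2_borel [simp]: "space (l2_borel \<mu>) = sq_int \<mu>"
  unfolding l2_borel_def by (rule space_measure_of) auto

text \<open>The preimage of an open set under a Lipschitz functional is norm-open and thus one of
  the generators of \<open>l2_borel\<close>.\<close>

lemma measurable_l2_lipschitz:
  fixes F :: "('a \<Rightarrow> real) \<Rightarrow> real"
  assumes "\<And>f g. f \<in> sq_int \<mu> \<Longrightarrow> g \<in> sq_int \<mu> \<Longrightarrow> \<bar>F g - F f\<bar> \<le> C * l2_norm \<mu> (\<lambda>x. g x - f x)"
  shows "F \<in> borel_measurable (l2_borel \<mu>)"
proof (rule borel_measurableI)
  fix S :: "real set" assume S: "open S"
  have "F -` S \<inter> sq_int \<mu> \<in> sets (l2_borel \<mu>)"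
    unfolding l2_borel_def
  proof (rule in_measure_of, force, safe)
    fix f assume f: "F f \<in> S" "f \<in> sq_int \<mu>"
    then obtain e where e: "e > 0" "ball (F f) e \<subseteq> S" using S by (auto simp: open_contains_ball)
    define d where "d = e / (\<bar>C\<bar> + 1)"
    have d: "d > 0" using e by (simp add: d_def add_nonneg_pos)
    have "g \<in> F -` S \<inter> sq_int \<mu>" if g: "g \<in> sq_int \<mu>" "l2_norm \<mu> (\<lambda>x. g x - f x) < d" for g
    proof -
      have "\<bar>F g - F f\<bar> \<le> C * l2_norm \<mu> (\<lambda>x. g x - f x)" using assms f g by blast
      also have "\<dots> \<le> (\<bar>C\<bar> + 1) * l2_norm \<mu> (\<lambda>x. g x - f x)"
        by (intro mult_right_mono l2_norm_ge0) simp
      also have "\<dots> < (\<bar>C\<bar> + 1) * d" using g by (intro mult_strict_left_mono) auto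
      also have "\<dots> = e" by (simp add: d_def)
      finally have "F g \<in> ball (F f) e" by (simp add: dist_real_def abs_minus_commute)
      then show ?thesis using e g by auto
    qed
    then show "\<exists>e>0. \<forall>g\<in>sq_int \<mu>. l2_norm \<mu> (\<lambda>x. g x - f x) < e \<longrightarrow> g \<in> F -` S \<inter> sq_int \<mu>"
      using d by blast
  qed
  then show "F -` S \<inter> space (l2_borel \<mu>) \<in> sets (l2_borel \<mu>)" by simp
qed

lemma measurable_l2_norm: "l2_norm \<mu> \<in> borel_measurable (l2_borel \<mu>)"
  by (rule measurable_l2_lipschitz[where C = 1]) (use l2_norm_diff in auto)

lemma measurable_l2_inner:
  assumes h: "h \<in> sq_int \<mu>"
  shows "(\<lambda>f. l2_inner \<mu> f h) \<in> borel_measurable (l2_borel \<mu>)"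
proof (rule measurable_l2_lipschitz[where C = "l2_norm \<mu> h"])
  fix f g assume fg: "f \<in> sq_int \<mu>" "g \<in> sq_int \<mu>"
  show "\<bar>l2_inner \<mu> g h - l2_inner \<mu> f h\<bar> \<le> l2_norm \<mu> h * l2_norm \<mu> (\<lambda>x. g x - f x)"
    using l2_Cauchy_Schwarz[OF sq_int_diff[OF fg(2,1)] h] l2_inner_diff_left[OF fg(2,1) h]
    by (simp add: mult.commute)
qed

locale continuous_rkhs =
  fixes S :: "'a::euclidean_space set" and k :: "'a \<Rightarrow> 'a \<Rightarrow> real" and H :: "('a \<Rightarrow> real) set"
    and ip :: "('a \<Rightarrow> real) \<Rightarrow> ('a \<Rightarrow> real) \<Rightarrow> real" and D :: real
  assumes rkhs: "rkhs S k H ip" and k_nn: "nonneg_definite_kernel S k"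
    and k_cont: "continuous_on (S \<times> S) (\<lambda>(x, y). k x y)"
    and k_bdd: "\<And>x. x \<in> S \<Longrightarrow> \<bar>k x x\<bar> \<le> D" and D0: "0 \<le> D"
begin

sublocale hfs S H ip
  using rkhs by unfold_locales (simp add: rkhs_def)

definition ksec :: "'a \<Rightarrow> 'a \<Rightarrow> real" where
  "ksec x = (\<lambda>y. if y \<in> S then k x y else 0)"

lemma ksec_mem: "x \<in> S \<Longrightarrow> ksec x \<in> H"
  and ksec_repr: "x \<in> S \<Longrightarrow> f \<in> H \<Longrightarrow> ip f (ksec x) = f x"
  using rkhs by (auto simp: rkhs_def ksec_def)

lemma k_sym: "x \<in> S \<Longrightarrow> y \<in> S \<Longrightarrow> k x y = k y x"
  using k_nn by (auto simp: nonneg_definite_kernel_def)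

lemma vanish: "f \<in> H \<Longrightarrow> x \<notin> S \<Longrightarrow> f x = 0"
  using hfs unfolding hilbert_function_space_def by blast

lemma eval_bound:
  assumes "x \<in> S" "f \<in> H"
  shows "\<bar>f x\<bar> \<le> sqrt D * rkhs_norm ip f"
proof -
  have "ip (ksec x) (ksec x) = k x x" using ksec_repr[OF assms(1) ksec_mem] assms by (simp add: ksec_def)
  then have "rkhs_norm ip (ksec x) \<le> sqrt D"
    unfolding rkhs_norm_def using k_bdd[OF assms(1)] by simp
  then have "rkhs_norm ip f * rkhs_norm ip (ksec x) \<le> rkhs_norm ip f * sqrt D"
    using norm_ge0[OF assms(2)] by (rule mult_left_mono)
  then show ?thesis
    using Cauchy_Schwarz[OF assms(2) ksec_mem[OF assms(1)]] ksec_repr[OF assms] by (simp add: mult.commute)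
qed

text \<open>The difference \<open>f x - f y\<close> is at most the norm of \<open>f\<close> times
  that of \<open>ksec x - ksec y\<close>, whose square \<open>k x x - 2 * k x y + k y y\<close>
  tends to 0 by continuity of the kernel.\<close>

lemma continuous_mem:
  assumes f: "f \<in> H"
  shows "continuous_on S f"
  unfolding continuous_on_def
proof
  fix y assume y: "y \<in> S"
  have k2: "continuous_on S (\<lambda>x. k (g x) (h x))" if "continuous_on S g" "continuous_on S h" "g ` S \<subseteq> S" "h ` S \<subseteq> S" for g h
  proof -
    have "continuous_on S ((\<lambda>(x, y). k x y) \<circ> (\<lambda>x. (g x, h x)))"
      by (rule continuous_on_compose) (use that in \<open>auto intro!: continuous_intros continuous_on_subset[OF k_cont]\<close>)
    then show ?thesis by (simp add: comp_def)
  qed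
  let ?d = "\<lambda>x. k x x - 2 * k x y + k y y"
  have "continuous_on S ?d" by (intro continuous_intros k2) (use y in auto)
  then have "(?d \<longlongrightarrow> ?d y) (at y within S)" using y unfolding continuous_on_def by blast
  then have "((\<lambda>x. rkhs_norm ip f * sqrt (?d x)) \<longlongrightarrow> rkhs_norm ip f * sqrt (?d y)) (at y within S)"
    by (rule tendsto_mult_left[OF tendsto_real_sqrt])
  then have lim: "((\<lambda>x. rkhs_norm ip f * sqrt (?d x)) \<longlongrightarrow> 0) (at y within S)" by simp
  have "((\<lambda>x. f x - f y) \<longlongrightarrow> 0) (at y within S)"
  proof (rule Lim_null_comparison[OF _ lim])
    have "norm (f x - f y) \<le> rkhs_norm ip f * sqrt (?d x)" if x: "x \<in> S" for x
    proof -
      have dm: "(\<lambda>t. ksec x t - ksec y t) \<in> H" using diff_mem ksec_mem x y by auto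
      have "ip (\<lambda>t. ksec x t - ksec y t) f = f x - f y"
        using ip_diff[OF ksec_mem[OF x] ksec_mem[OF y] f] ksec_repr[OF x f] ksec_repr[OF y f]
          ip_commute[OF f ksec_mem[OF x]] ip_commute[OF f ksec_mem[OF y]] by simp
      then have 1: "\<bar>f x - f y\<bar> \<le> rkhs_norm ip (\<lambda>t. ksec x t - ksec y t) * rkhs_norm ip f"
        using Cauchy_Schwarz[OF dm f] by simp
      have "ip (\<lambda>t. ksec x t - ksec y t) (\<lambda>t. ksec x t - ksec y t) = ?d x"
        using ip_square[OF ksec_mem[OF x] ksec_mem[OF y], of 1 "-1"]
          ksec_repr[OF x ksec_mem[OF x]] ksec_repr[OF y ksec_mem[OF y]] ksec_repr[OF y ksec_mem[OF x]] x y
        by (simp add: ksec_def)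
      then show ?thesis using 1 by (simp add: rkhs_norm_def mult.commute)
    qed
    then show "\<forall>\<^sub>F x in at y within S. norm (f x - f y) \<le> rkhs_norm ip f * sqrt (?d x)"
      by (auto simp: eventually_at_filter)
  qed
  then show "(f \<longlongrightarrow> f y) (at y within S)" by (rule LIM_zero_cancel)
qed

text \<open>Kernel sections at a countable dense set of points suffice: an element orthogonal to
  them vanishes at those points and is continuous. This makes a common null set for all of
  \<open>H\<close> possible.\<close>

lemma countable_separating:
  obtains E where "countable E" "E \<subseteq> H" "\<And>f. f \<in> H \<Longrightarrow> (\<And>d. d \<in> E \<Longrightarrow> ip f d = 0) \<Longrightarrow> f = (\<lambda>x. 0)"
proof -
  obtain T where T: "countable T" "T \<subseteq> S" "S \<subseteq> closure T" using separable by blast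
  show thesis
  proof (rule that[of "ksec ` T"])
    fix f assume f: "f \<in> H" and z: "\<And>d. d \<in> ksec ` T \<Longrightarrow> ip f d = 0"
    have fT: "f x = 0" if "x \<in> T" for x using z[of "ksec x"] ksec_repr[of x f] f that T by auto
    have "closedin (top_of_set S) {x \<in> S. f x = 0}"
      by (rule continuous_closedin_preimage_constant[OF continuous_mem[OF f]])
    then obtain U where U: "closed U" "{x \<in> S. f x = 0} = S \<inter> U" by (auto simp: closedin_closed)
    then have "T \<subseteq> U" using fT T by auto
    then have "S \<subseteq> U" using closure_minimal[of T U] U(1) T(3) by blast
    then have "f x = 0" if "x \<in> S" for x using U(2) that by blast
    then have "f x = 0" for x using vanish[OF f] by blast
    then show "f = (\<lambda>x. 0)" by auto
  qed (use T ksec_mem in auto)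
qed

end

text \<open>Instantiated with Lebesgue measure on the time domain and with the law of
  \<open>Z\<close>; \<open>cont_meas\<close> abstracts from their different sigma-algebras.\<close>

locale rkhs_in_l2 = continuous_rkhs S k H ip D + finite_measure \<nu>
  for S :: "'a::euclidean_space set" and k H ip D and \<nu> :: "'a measure" +
  assumes space_nu: "space \<nu> = S" and cont_meas: "\<And>f. continuous_on S f \<Longrightarrow> (f :: 'a \<Rightarrow> real) \<in> borel_measurable \<nu>"
begin

lemma mem_sq_int:
  assumes f: "f \<in> H"
  shows "f \<in> sq_int \<nu>"
proof -
  have "norm ((f x)\<^sup>2) \<le> (sqrt D * rkhs_norm ip f)\<^sup>2" if "x \<in> space \<nu>" for x
    using power_mono[OF eval_bound[OF _ f, of x], of 2] that space_nu by simp
  then have "AE x in \<nu>. norm ((f x)\<^sup>2) \<le> (sqrt D * rkhs_norm ip f)\<^sup>2" by (rule AE_I2)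
  then have "integrable \<nu> (\<lambda>x. (f x)\<^sup>2)"
    by (rule integrable_const_bound) (use cont_meas[OF continuous_mem[OF f]] in auto)
  then show ?thesis using cont_meas[OF continuous_mem[OF f]] by (simp add: sq_int_def)
qed

lemma l2_norm_bound:
  assumes f: "f \<in> H"
  shows "l2_norm \<nu> f \<le> sqrt (D * measure \<nu> S) * rkhs_norm ip f"
proof -
  have "f x * f x \<le> D * ip f f" if "x \<in> S" for x
  proof -
    have "(f x)\<^sup>2 \<le> (sqrt D * rkhs_norm ip f)\<^sup>2"
      using power_mono[OF eval_bound[OF that f], of 2] by simp
    then have "(f x)\<^sup>2 \<le> D * ip f f" using D0 norm_sq[OF f] by (simp add: power_mult_distrib)
    then show ?thesis by (simp add: power2_eq_square)
  qed
  then have "l2_inner \<nu> f f \<le> (\<integral>x. D * ip f f \<partial>\<nu>)"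
    unfolding l2_inner_def using space_nu sq_int_mult[OF mem_sq_int mem_sq_int, OF f f]
    by (intro integral_mono) auto
  also have "\<dots> = D * measure \<nu> S * ip f f" using space_nu by simp
  finally have "sqrt (l2_inner \<nu> f f) \<le> sqrt (D * measure \<nu> S * ip f f)" by (rule real_sqrt_le_mono)
  then show ?thesis by (simp add: l2_norm_def rkhs_norm_def real_sqrt_mult)
qed

lemma pairing_bound:
  assumes "h \<in> sq_int \<nu>" "f \<in> H"
  shows "\<bar>l2_inner \<nu> h f\<bar> \<le> sqrt (D * measure \<nu> S) * l2_norm \<nu> h * rkhs_norm ip f"
proof -
  have "\<bar>l2_inner \<nu> h f\<bar> \<le> l2_norm \<nu> h * l2_norm \<nu> f" by (rule l2_Cauchy_Schwarz[OF assms(1) mem_sq_int[OF assms(2)]])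
  also have "\<dots> \<le> l2_norm \<nu> h * (sqrt (D * measure \<nu> S) * rkhs_norm ip f)"
    by (intro mult_left_mono l2_norm_bound assms l2_norm_ge0)
  finally show ?thesis by (simp add: mult_ac)
qed

text \<open>The adjoint of the inclusion of \<open>H\<close> into the square integrable functions.
  From the almost everywhere class of the kernel operator applied to \<open>h\<close> it selects the
  member lying in \<open>H\<close>, so that inner products of \<open>H\<close> reduce to
  integrals.\<close>

definition repr :: "('a \<Rightarrow> real) \<Rightarrow> 'a \<Rightarrow> real" where
  "repr h = (SOME p. p \<in> H \<and> (\<forall>f\<in>H. l2_inner \<nu> h f = ip f p))"

lemma repr_mem: "h \<in> sq_int \<nu> \<Longrightarrow> repr h \<in> H"
  and repr_ip: "h \<in> sq_int \<nu> \<Longrightarrow> f \<in> H \<Longrightarrow> ip f (repr h) = l2_inner \<nu> h f"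
proof -
  assume h: "h \<in> sq_int \<nu>"
  have "\<exists>p\<in>H. \<forall>f\<in>H. l2_inner \<nu> h f = ip f p"
  proof (rule riesz)
    show "\<bar>l2_inner \<nu> h f\<bar> \<le> (sqrt (D * measure \<nu> S) * l2_norm \<nu> h) * rkhs_norm ip f" if "f \<in> H" for f
      by (rule pairing_bound[OF h that])
  qed (rule l2_inner_lin[OF mem_sq_int mem_sq_int h])
  then have "\<exists>p. p \<in> H \<and> (\<forall>f\<in>H. l2_inner \<nu> h f = ip f p)" by blast
  from someI_ex[OF this] have *: "repr h \<in> H \<and> (\<forall>f\<in>H. l2_inner \<nu> h f = ip f (repr h))"
    unfolding repr_def .
  then show "repr h \<in> H" ..
  show "f \<in> H \<Longrightarrow> ip f (repr h) = l2_inner \<nu> h f" using * by simp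
qed

lemma repr_kernel_op:
  assumes h: "h \<in> sq_int \<nu>" and t: "t \<in> S"
  shows "repr h t = kernel_op \<nu> k h t"
proof -
  have "repr h t = ip (ksec t) (repr h)"
    using ksec_repr[OF t repr_mem[OF h]] ip_commute[OF repr_mem[OF h] ksec_mem[OF t]] by simp
  also have "\<dots> = l2_inner \<nu> h (ksec t)" by (rule repr_ip[OF h ksec_mem[OF t]])
  also have "\<dots> = kernel_op \<nu> k h t"
    unfolding l2_inner_def kernel_op_def
    by (rule Bochner_Integration.integral_cong) (use k_sym t space_nu in \<open>auto simp: ksec_def\<close>)
  finally show ?thesis .
qed

end

section \<open>Orthonormal systems diagonalizing the covariance operators\<close>

lemma sq_int_abs: "f \<in> sq_int \<mu> \<Longrightarrow> (\<lambda>x. \<bar>f x\<bar>) \<in> sq_int \<mu>"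
  by (auto simp: sq_int_def)

text \<open>Joint measurability serves Fubini's theorem; measurability into \<open>l2_borel\<close>
  makes norms and pairings of the curve random variables.\<close>

locale random_curve = P: prob_space P + tau: finite_measure \<tau>
  for P :: "'w measure" and \<tau> :: "real measure" and X :: "'w \<Rightarrow> real \<Rightarrow> real" +
  assumes X_joint: "(\<lambda>(\<omega>, t). X \<omega> t) \<in> borel_measurable (P \<Otimes>\<^sub>M \<tau>)"
    and X_meas: "X \<in> measurable P (l2_borel \<tau>)"
    and X_moment: "integrable P (\<lambda>\<omega>. (l2_norm \<tau> (X \<omega>))\<^sup>2)"
begin

lemmas measurable_integral_P = P.borel_measurable_lebesgue_integral

sublocale pair_sigma_finite P \<tau> ..

lemma X_joint' [measurable]: "(\<lambda>p. X (fst p) (snd p)) \<in> borel_measurable (P \<Otimes>\<^sub>M \<tau>)"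
  using X_joint by (simp add: case_prod_beta)

lemma X_at: "t \<in> space \<tau> \<Longrightarrow> (\<lambda>\<omega>. X \<omega> t) \<in> borel_measurable P"
  using measurable_compose[OF measurable_Pair2' X_joint', of t] by simp

lemma X_sq_int: "\<omega> \<in> space P \<Longrightarrow> X \<omega> \<in> sq_int \<tau>"
  using measurable_space[OF X_meas] by simp

lemma X_norm_sq_int: "(\<lambda>\<omega>. l2_norm \<tau> (X \<omega>)) \<in> sq_int P"
  using measurable_compose[OF X_meas measurable_l2_norm] X_moment by (simp add: sq_int_def)

lemma pairing_sq_int:
  assumes f: "f \<in> sq_int \<tau>"
  shows "(\<lambda>\<omega>. l2_inner \<tau> (X \<omega>) f) \<in> sq_int P"
proof -
  have m: "(\<lambda>\<omega>. l2_inner \<tau> (X \<omega>) f) \<in> borel_measurable P"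
    by (rule measurable_compose[OF X_meas measurable_l2_inner[OF f]])
  have "(l2_inner \<tau> (X \<omega>) f)\<^sup>2 \<le> (l2_norm \<tau> f)\<^sup>2 * (l2_norm \<tau> (X \<omega>))\<^sup>2" if "\<omega> \<in> space P" for \<omega>
    using power_mono[OF l2_Cauchy_Schwarz[OF X_sq_int[OF that] f], of 2]
    by (simp add: power_mult_distrib mult.commute)
  then have "AE \<omega> in P. norm ((l2_inner \<tau> (X \<omega>) f)\<^sup>2) \<le> norm ((l2_norm \<tau> f)\<^sup>2 * (l2_norm \<tau> (X \<omega>))\<^sup>2)"
    by (intro AE_I2) (simp add: abs_mult)
  then have "integrable P (\<lambda>\<omega>. (l2_inner \<tau> (X \<omega>) f)\<^sup>2)"
    by (rule Bochner_Integration.integrable_bound[rotated 2]) (use m X_moment in simp_all)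
  with m show ?thesis by (simp add: sq_int_def)
qed

text \<open>Applied with \<open>h\<close> the value of the curve at a fixed time, a pairing of the
  curve, and a function of \<open>Z\<close>. The moment condition on \<open>h\<close> dominates the
  double integral because the time integral of \<open>\<bar>X \<omega> t * g t\<bar>\<close> is at
  most the product of the two norms.\<close>

lemma fubini:
  assumes h: "h \<in> borel_measurable P" "integrable P (\<lambda>\<omega>. \<bar>h \<omega>\<bar> * l2_norm \<tau> (X \<omega>))"
    and g: "g \<in> sq_int \<tau>"
  shows "(\<integral>t. (\<integral>\<omega>. X \<omega> t * h \<omega> \<partial>P) * g t \<partial>\<tau>) = (\<integral>\<omega>. h \<omega> * l2_inner \<tau> (X \<omega>) g \<partial>P)"
proof -
  have gm: "g \<in> borel_measurable \<tau>" using g by (rule sq_int_measurable)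
  have Xg: "integrable \<tau> (\<lambda>t. X \<omega> t * g t)" if "\<omega> \<in> space P" for \<omega>
    by (rule sq_int_mult[OF X_sq_int[OF that] g])
  have an: "l2_norm \<tau> (\<lambda>t. \<bar>f t\<bar>) = l2_norm \<tau> f" for f by (simp add: l2_norm_def l2_inner_def)
  have bd: "(\<integral>t. \<bar>X \<omega> t * g t\<bar> \<partial>\<tau>) \<le> l2_norm \<tau> (X \<omega>) * l2_norm \<tau> g" if "\<omega> \<in> space P" for \<omega>
    using l2_Cauchy_Schwarz[OF sq_int_abs[OF X_sq_int[OF that]] sq_int_abs[OF g]] by (simp add: an l2_inner_def abs_mult)
  have int: "integrable (P \<Otimes>\<^sub>M \<tau>) (\<lambda>(\<omega>, t). X \<omega> t * h \<omega> * g t)"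
  proof (rule Fubini_integrable)
    show m: "(\<lambda>(\<omega>, t). X \<omega> t * h \<omega> * g t) \<in> borel_measurable (P \<Otimes>\<^sub>M \<tau>)"
      using h(1) gm by (simp add: case_prod_beta)
    have eq: "(\<integral>t. norm (case (\<omega>, t) of (\<omega>, t) \<Rightarrow> X \<omega> t * h \<omega> * g t) \<partial>\<tau>) = \<bar>h \<omega>\<bar> * (\<integral>t. \<bar>X \<omega> t * g t\<bar> \<partial>\<tau>)" for \<omega>
      unfolding integral_mult_right_zero[symmetric] by (simp add: abs_mult mult_ac)
    show "integrable P (\<lambda>\<omega>. \<integral>t. norm (case (\<omega>, t) of (\<omega>, t) \<Rightarrow> X \<omega> t * h \<omega> * g t) \<partial>\<tau>)"
    proof (rule Bochner_Integration.integrable_bound)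
      show "integrable P (\<lambda>\<omega>. (\<bar>h \<omega>\<bar> * l2_norm \<tau> (X \<omega>)) * l2_norm \<tau> g)" using h(2) by simp
      show "(\<lambda>\<omega>. \<integral>t. norm (case (\<omega>, t) of (\<omega>, t) \<Rightarrow> X \<omega> t * h \<omega> * g t) \<partial>\<tau>) \<in> borel_measurable P"
        using m by (intro tau.borel_measurable_lebesgue_integral) (simp add: case_prod_beta)
      have "norm (\<bar>h \<omega>\<bar> * (\<integral>t. \<bar>X \<omega> t * g t\<bar> \<partial>\<tau>)) \<le> norm ((\<bar>h \<omega>\<bar> * l2_norm \<tau> (X \<omega>)) * l2_norm \<tau> g)"
        if "\<omega> \<in> space P" for \<omega>
      proof -
        have "0 \<le> (\<integral>t. \<bar>X \<omega> t * g t\<bar> \<partial>\<tau>)" by (rule integral_nonneg_AE) simp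
        moreover have "\<bar>h \<omega>\<bar> * (\<integral>t. \<bar>X \<omega> t * g t\<bar> \<partial>\<tau>) \<le> \<bar>h \<omega>\<bar> * (l2_norm \<tau> (X \<omega>) * l2_norm \<tau> g)"
          by (rule mult_left_mono[OF bd[OF that]]) simp
        ultimately show ?thesis using l2_norm_ge0[of \<tau>] by (simp add: abs_mult mult.assoc)
      qed
      then show "AE \<omega> in P. norm (\<integral>t. norm (case (\<omega>, t) of (\<omega>, t) \<Rightarrow> X \<omega> t * h \<omega> * g t) \<partial>\<tau>)
          \<le> norm ((\<bar>h \<omega>\<bar> * l2_norm \<tau> (X \<omega>)) * l2_norm \<tau> g)"
        unfolding eq by (intro AE_I2) auto
    qed
    have "integrable \<tau> (\<lambda>t. X \<omega> t * h \<omega> * g t)" if "\<omega> \<in> space P" for \<omega>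
      using integrable_mult_right[OF Xg[OF that], of "h \<omega>"] by (simp add: mult_ac)
    then show "AE \<omega> in P. integrable \<tau> (\<lambda>t. case (\<omega>, t) of (\<omega>, t) \<Rightarrow> X \<omega> t * h \<omega> * g t)"
      by (intro AE_I2) simp
  qed
  have "(\<integral>t. (\<integral>\<omega>. X \<omega> t * h \<omega> \<partial>P) * g t \<partial>\<tau>) = (\<integral>t. (\<integral>\<omega>. X \<omega> t * h \<omega> * g t \<partial>P) \<partial>\<tau>)"
    by simp
  also have "\<dots> = (\<integral>\<omega>. (\<integral>t. X \<omega> t * h \<omega> * g t \<partial>\<tau>) \<partial>P)"
    by (rule Fubini_integral[OF int])
  also have "\<dots> = (\<integral>\<omega>. h \<omega> * l2_inner \<tau> (X \<omega>) g \<partial>P)"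
  proof (rule Bochner_Integration.integral_cong[OF refl])
    fix \<omega>
    have "(\<integral>t. X \<omega> t * h \<omega> * g t \<partial>\<tau>) = (\<integral>t. h \<omega> * (X \<omega> t * g t) \<partial>\<tau>)" by (simp add: mult_ac)
    then show "(\<integral>t. X \<omega> t * h \<omega> * g t \<partial>\<tau>) = h \<omega> * l2_inner \<tau> (X \<omega>) g" by (simp add: l2_inner_def)
  qed
  finally show ?thesis .
qed

lemma second_moment:
  "AE t in \<tau>. (\<lambda>\<omega>. X \<omega> t) \<in> sq_int P" "integrable \<tau> (\<lambda>t. l2_inner P (\<lambda>\<omega>. X \<omega> t) (\<lambda>\<omega>. X \<omega> t))"
proof -
  have eq: "(\<integral>t. norm ((X \<omega> t)\<^sup>2) \<partial>\<tau>) = (l2_norm \<tau> (X \<omega>))\<^sup>2" for \<omega>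
    unfolding l2_norm_sq l2_inner_def by (simp add: power2_eq_square)
  have int: "integrable (P \<Otimes>\<^sub>M \<tau>) (\<lambda>(\<omega>, t). (X \<omega> t)\<^sup>2)"
  proof (rule Fubini_integrable)
    show "(\<lambda>(\<omega>, t). (X \<omega> t)\<^sup>2) \<in> borel_measurable (P \<Otimes>\<^sub>M \<tau>)" by (simp add: case_prod_beta)
    show "integrable P (\<lambda>\<omega>. \<integral>t. norm (case (\<omega>, t) of (\<omega>, t) \<Rightarrow> (X \<omega> t)\<^sup>2) \<partial>\<tau>)"
      unfolding prod.case eq by (rule X_moment)
    show "AE \<omega> in P. integrable \<tau> (\<lambda>t. case (\<omega>, t) of (\<omega>, t) \<Rightarrow> (X \<omega> t)\<^sup>2)"
      using X_sq_int by (intro AE_I2) (simp add: sq_int_def)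
  qed
  show "AE t in \<tau>. (\<lambda>\<omega>. X \<omega> t) \<in> sq_int P"
    using AE_integrable_snd[OF int] AE_space by eventually_elim (use X_at in \<open>auto simp: sq_int_def\<close>)
  show "integrable \<tau> (\<lambda>t. l2_inner P (\<lambda>\<omega>. X \<omega> t) (\<lambda>\<omega>. X \<omega> t))"
    using integrable_snd[OF int] by (simp add: l2_inner_def power2_eq_square)
qed

abbreviation "cov_op \<equiv> kernel_op \<tau> (cov_kernel P X)"

text \<open>The identity is restricted to almost every \<open>t\<close> because the value of the
  curve at a single time is known to have a second moment only for almost every time.\<close>

lemma cov_op_AE:
  assumes f: "f \<in> sq_int \<tau>"
  shows "AE t in \<tau>. cov_op f t = (\<integral>\<omega>. X \<omega> t * l2_inner \<tau> (X \<omega>) f \<partial>P)"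
  using second_moment(1)
proof eventually_elim
  case (elim t)
  have "(\<lambda>\<omega>. \<bar>X \<omega> t\<bar>) \<in> sq_int P" using elim by (rule sq_int_abs)
  then have "integrable P (\<lambda>\<omega>. \<bar>X \<omega> t\<bar> * l2_norm \<tau> (X \<omega>))" by (rule sq_int_mult[OF _ X_norm_sq_int])
  from fubini[OF sq_int_measurable[OF elim] this f]
  show ?case by (simp add: kernel_op_def cov_kernel_def)
qed

lemma cov_op_measurable:
  assumes f: "f \<in> sq_int \<tau>"
  shows "cov_op f \<in> borel_measurable \<tau>"
proof -
  have [measurable]: "f \<in> borel_measurable \<tau>" using f by (rule sq_int_measurable)
  have 1: "(\<lambda>p. X (snd p) (fst (fst p))) \<in> borel_measurable ((\<tau> \<Otimes>\<^sub>M \<tau>) \<Otimes>\<^sub>M P)"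
    using measurable_compose[OF _ X_joint', of "\<lambda>p. (snd p, fst (fst p))" "(\<tau> \<Otimes>\<^sub>M \<tau>) \<Otimes>\<^sub>M P"] by simp
  have 2: "(\<lambda>p. X (snd p) (snd (fst p))) \<in> borel_measurable ((\<tau> \<Otimes>\<^sub>M \<tau>) \<Otimes>\<^sub>M P)"
    using measurable_compose[OF _ X_joint', of "\<lambda>p. (snd p, snd (fst p))" "(\<tau> \<Otimes>\<^sub>M \<tau>) \<Otimes>\<^sub>M P"] by simp
  have "(\<lambda>q. \<integral>\<omega>. X \<omega> (snd q) * X \<omega> (fst q) \<partial>P) \<in> borel_measurable (\<tau> \<Otimes>\<^sub>M \<tau>)"
    by (rule measurable_integral_P) (use 1 2 in \<open>simp add: case_prod_beta\<close>)
  then have "(\<lambda>(t, s). (\<integral>\<omega>. X \<omega> s * X \<omega> t \<partial>P) * f s) \<in> borel_measurable (\<tau> \<Otimes>\<^sub>M \<tau>)"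
    by (simp add: case_prod_beta)
  then have "(\<lambda>t. \<integral>s. (\<integral>\<omega>. X \<omega> s * X \<omega> t \<partial>P) * f s \<partial>\<tau>) \<in> borel_measurable \<tau>"
    by (rule tau.borel_measurable_lebesgue_integral)
  then show ?thesis by (simp add: kernel_op_def[abs_def] cov_kernel_def)
qed

lemma cov_op_sq_int:
  assumes f: "f \<in> sq_int \<tau>"
  shows "cov_op f \<in> sq_int \<tau>"
proof -
  let ?xi = "\<lambda>\<omega>. l2_inner \<tau> (X \<omega>) f"
  have "AE t in \<tau>. norm ((cov_op f t)\<^sup>2) \<le> norm (l2_inner P (\<lambda>\<omega>. X \<omega> t) (\<lambda>\<omega>. X \<omega> t) * l2_inner P ?xi ?xi)"
    using cov_op_AE[OF f] second_moment(1)
  proof eventually_elim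
    case (elim t)
    have "cov_op f t = l2_inner P (\<lambda>\<omega>. X \<omega> t) ?xi" using elim by (simp add: l2_inner_def)
    then have "\<bar>cov_op f t\<bar>\<^sup>2 \<le> (l2_norm P (\<lambda>\<omega>. X \<omega> t) * l2_norm P ?xi)\<^sup>2"
      using l2_Cauchy_Schwarz[OF elim(2) pairing_sq_int[OF f]] by (intro power_mono) auto
    then show ?case by (simp add: power_mult_distrib l2_norm_sq l2_inner_ge0)
  qed
  then have "integrable \<tau> (\<lambda>t. (cov_op f t)\<^sup>2)"
    by (rule Bochner_Integration.integrable_bound[rotated 2])
      (use second_moment(2) cov_op_measurable[OF f] in simp_all)
  then show ?thesis using cov_op_measurable[OF f] by (simp add: sq_int_def)
qed

text \<open>This turns operator identities into statements about random variables: with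
  \<open>g = f\<close>, a vanishing form means that the pairing with \<open>f\<close> is zero almost
  surely.\<close>

lemma cov_op_inner:
  assumes f: "f \<in> sq_int \<tau>" and g: "g \<in> sq_int \<tau>"
  shows "l2_inner \<tau> (cov_op f) g = (\<integral>\<omega>. l2_inner \<tau> (X \<omega>) f * l2_inner \<tau> (X \<omega>) g \<partial>P)"
proof -
  let ?xi = "\<lambda>\<omega>. l2_inner \<tau> (X \<omega>) f"
  note xi = pairing_sq_int[OF f]
  have "(\<lambda>\<omega>. \<bar>?xi \<omega>\<bar>) \<in> sq_int P" using xi by (rule sq_int_abs)
  then have i: "integrable P (\<lambda>\<omega>. \<bar>?xi \<omega>\<bar> * l2_norm \<tau> (X \<omega>))" by (rule sq_int_mult[OF _ X_norm_sq_int])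
  have m: "(\<lambda>t. \<integral>\<omega>. X \<omega> t * ?xi \<omega> \<partial>P) \<in> borel_measurable \<tau>"
  proof (rule measurable_integral_P)
    have "(\<lambda>p. X (snd p) (fst p)) \<in> borel_measurable (\<tau> \<Otimes>\<^sub>M P)"
      using measurable_compose[OF _ X_joint', of "\<lambda>p. (snd p, fst p)" "\<tau> \<Otimes>\<^sub>M P"] by simp
    then show "(\<lambda>(t, \<omega>). X \<omega> t * ?xi \<omega>) \<in> borel_measurable (\<tau> \<Otimes>\<^sub>M P)"
      using sq_int_measurable[OF xi] by (simp add: case_prod_beta)
  qed
  have "l2_inner \<tau> (cov_op f) g = (\<integral>t. (\<integral>\<omega>. X \<omega> t * ?xi \<omega> \<partial>P) * g t \<partial>\<tau>)"
    unfolding l2_inner_def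
  proof (rule integral_cong_AE)
    show "AE t in \<tau>. cov_op f t * g t = (\<integral>\<omega>. X \<omega> t * (\<integral>s. X \<omega> s * f s \<partial>\<tau>) \<partial>P) * g t"
      using cov_op_AE[OF f] by eventually_elim (simp add: l2_inner_def)
  qed (use cov_op_measurable[OF f] m sq_int_measurable[OF g] in \<open>auto simp: l2_inner_def\<close>)
  also have "\<dots> = (\<integral>\<omega>. ?xi \<omega> * l2_inner \<tau> (X \<omega>) g \<partial>P)"
    by (rule fubini[OF sq_int_measurable[OF xi] i g])
  finally show ?thesis .
qed

end

text \<open>With \<open>S\<close> the square root of the kernel operator and \<open>\<phi>\<^sub>k\<close> the eigenfunctions of \<open>S C S\<close>, the
  functions \<open>S \<phi>\<^sub>k\<close> are orthonormal in the reproducing kernel space and uncorrelated as linear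
  functionals of \<open>X\<close>; \<open>repr (C (S \<phi>\<^sub>k)) / s\<^sub>k\<close> is the element of the space that represents \<open>S \<phi>\<^sub>k\<close>.\<close>

lemma functional_features:
  assumes rk: "rkhs_in_l2 T K H ip D \<tau>" and rc: "random_curve P \<tau> X"
    and S: "l2_sqrt \<tau> (kernel_op \<tau> K) S"
    and s: "l2_eigenvalues \<tau> (S \<circ> kernel_op \<tau> (cov_kernel P X) \<circ> S) s"
  shows "\<exists>v. hfs.ortho_system H ip v \<and>
    (\<forall>j k. (\<integral>\<omega>. l2_inner \<tau> (X \<omega>) (v j) * l2_inner \<tau> (X \<omega>) (v k) \<partial>P)
       = (if j = k then (if 1 \<le> k \<and> 0 < s k then s k else 0) else 0)) \<and>
    (\<forall>f\<in>H. (\<forall>k. ip f (v k) = 0) \<longrightarrow> (AE \<omega> in P. l2_inner \<tau> (X \<omega>) f = 0))"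
proof -
  interpret rkhs_in_l2 T K H ip D \<tau> by (rule rk)
  interpret random_curve P \<tau> X by (rule rc)
  define I where "I = {k. 1 \<le> k \<and> 0 < s k}"
  have S_sq: "S f \<in> sq_int \<tau>" if "f \<in> sq_int \<tau>" for f
    using S that by (auto simp: l2_sqrt_def bounded_l2_op_def)
  have S_lin: "AE x in \<tau>. S (\<lambda>y. a * f y + b * g y) x = a * S f x + b * S g x"
    if "f \<in> sq_int \<tau>" "g \<in> sq_int \<tau>" for f g a b
    using S that unfolding l2_sqrt_def bounded_l2_op_def by blast
  obtain B where S_bd: "\<And>f. f \<in> sq_int \<tau> \<Longrightarrow> l2_norm \<tau> (S f) \<le> B * l2_norm \<tau> f"
    using S unfolding l2_sqrt_def bounded_l2_op_def by blast
  have S_adj: "l2_inner \<tau> (S f) g = l2_inner \<tau> f (S g)" if "f \<in> sq_int \<tau>" "g \<in> sq_int \<tau>" for f g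
    using S that unfolding l2_sqrt_def by blast
  have SS: "AE x in \<tau>. S (S f) x = kernel_op \<tau> K f x" if "f \<in> sq_int \<tau>" for f
    using S that unfolding l2_sqrt_def by blast
  \<comment> \<open>\<open>S\<close> acts on functions rather than on classes; that it respects
    almost everywhere equality follows from its boundedness and almost everywhere linearity.\<close>
  have S_cong: "AE x in \<tau>. S f x = S g x" if fg: "f \<in> sq_int \<tau>" "g \<in> sq_int \<tau>" "AE x in \<tau>. f x = g x" for f g
  proof -
    have d: "(\<lambda>x. f x - g x) \<in> sq_int \<tau>" using fg sq_int_diff by blast
    have "l2_inner \<tau> (\<lambda>x. f x - g x) (\<lambda>x. f x - g x) = l2_inner \<tau> (\<lambda>x. 0) (\<lambda>x. f x - g x)"
      by (rule l2_inner_cong_AE) (use fg sq_int_measurable[OF d] in auto)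
    then have "l2_norm \<tau> (\<lambda>x. f x - g x) = 0" by (simp add: l2_norm_def l2_inner_def)
    then have "l2_norm \<tau> (S (\<lambda>x. f x - g x)) = 0"
      using S_bd[OF d] l2_norm_ge0[of \<tau> "S (\<lambda>x. f x - g x)"] by simp
    then have "AE x in \<tau>. S (\<lambda>x. f x - g x) x = 0"
      using l2_inner_eq0[OF S_sq[OF d]] l2_norm_sq[of \<tau> "S (\<lambda>x. f x - g x)"] by simp
    moreover have "AE x in \<tau>. S (\<lambda>x. f x - g x) x = S f x - S g x"
      using S_lin[OF fg(1,2), of 1 "-1"] by simp
    ultimately show ?thesis by eventually_elim simp
  qed
  have repr_SS: "AE x in \<tau>. repr f x = S (S f) x" if "f \<in> sq_int \<tau>" for f
    using SS[OF that] AE_space by eventually_elim (simp add: repr_kernel_op[OF that] space_nu)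
  let ?C = cov_op
  obtain \<phi> where \<phi>: "\<forall>k\<in>I. \<phi> k \<in> sq_int \<tau>"
    "\<forall>j\<in>I. \<forall>k\<in>I. l2_inner \<tau> (\<phi> j) (\<phi> k) = (if j = k then 1 else 0)"
    "\<forall>k\<in>I. AE x in \<tau>. S (?C (S (\<phi> k))) x = s k * \<phi> k x"
    "\<forall>f\<in>sq_int \<tau>. (\<forall>k\<in>I. l2_inner \<tau> f (\<phi> k) = 0) \<longrightarrow> (AE x in \<tau>. S (?C (S f)) x = 0)"
    using s unfolding l2_eigenvalues_def Let_def I_def[symmetric] comp_def
    by (elim conjE exE) (rule that; assumption)
  note \<phi>_sq = \<phi>(1)[rule_format] and \<phi>_on = \<phi>(2)[rule_format] and \<phi>_ev = \<phi>(3)[rule_format]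
    and \<phi>_null = \<phi>(4)[rule_format]
  have C_sq: "?C (S (\<phi> k)) \<in> sq_int \<tau>" if "k \<in> I" for k
    using cov_op_sq_int S_sq \<phi>_sq that by blast
  have SCS_inner: "l2_inner \<tau> (S (?C (S (\<phi> j)))) g = s j * l2_inner \<tau> (\<phi> j) g" if "j \<in> I" "g \<in> sq_int \<tau>" for j g
  proof -
    have "l2_inner \<tau> (S (?C (S (\<phi> j)))) g = l2_inner \<tau> (\<lambda>x. s j * \<phi> j x) g"
      by (rule l2_inner_cong_AE[OF \<phi>_ev])
        (use that S_sq[OF C_sq] \<phi>_sq in \<open>auto intro!: sq_int_measurable sq_int_scale\<close>)
    then show ?thesis by (simp add: l2_inner_scale)
  qed
  define v where "v k = (if k \<in> I then (\<lambda>x. (1 / s k) * repr (?C (S (\<phi> k))) x) else (\<lambda>x. 0))" for k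
  have vH: "v k \<in> H" for k
    using scale_mem[OF repr_mem[OF C_sq], of k "1 / s k"] zero_mem by (auto simp: v_def)
  have v_ae: "AE x in \<tau>. v k x = S (\<phi> k) x" if k: "k \<in> I" for k
  proof -
    have sk: "s k > 0" using k by (simp add: I_def)
    have 1: "(\<lambda>x. s k * \<phi> k x) \<in> sq_int \<tau>" using sq_int_scale \<phi>_sq k by blast
    have "AE x in \<tau>. S (S (?C (S (\<phi> k)))) x = S (\<lambda>x. s k * \<phi> k x) x"
      by (rule S_cong[OF S_sq[OF C_sq[OF k]] 1 \<phi>_ev[OF k]])
    moreover have "AE x in \<tau>. S (\<lambda>x. s k * \<phi> k x) x = s k * S (\<phi> k) x"
      using S_lin[OF \<phi>_sq[OF k] \<phi>_sq[OF k], of "s k" 0] by simp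
    ultimately show ?thesis using repr_SS[OF C_sq[OF k]]
      by eventually_elim (use k sk in \<open>simp add: v_def\<close>)
  qed
  have ip_v: "ip f (v k) = l2_inner \<tau> f (?C (S (\<phi> k))) / s k" if "f \<in> H" "k \<in> I" for f k
    unfolding v_def if_P[OF that(2)] ip_scale2[OF repr_mem[OF C_sq[OF that(2)]] that(1)]
      repr_ip[OF C_sq[OF that(2)] that(1)] by (simp add: l2_inner_commute)
  have pair_v: "l2_inner \<tau> (v j) g = l2_inner \<tau> (S (\<phi> j)) g" if "j \<in> I" "g \<in> sq_int \<tau>" for j g
    by (rule l2_inner_cong_AE[OF v_ae])
      (use that mem_sq_int[OF vH] S_sq[OF \<phi>_sq] in \<open>auto intro: sq_int_measurable\<close>)
  have on: "ip (v j) (v k) = (if j = k then 1 else 0)" if jk: "j \<in> I" "k \<in> I" for j k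
  proof -
    have "ip (v j) (v k) = l2_inner \<tau> (S (\<phi> j)) (?C (S (\<phi> k))) / s k"
      using ip_v[OF vH jk(2)] pair_v[OF jk(1) C_sq[OF jk(2)]] by simp
    also have "l2_inner \<tau> (S (\<phi> j)) (?C (S (\<phi> k))) = l2_inner \<tau> (S (?C (S (\<phi> k)))) (\<phi> j)"
      using S_adj[OF \<phi>_sq[OF jk(1)] C_sq[OF jk(2)]] by (simp add: l2_inner_commute)
    also have "\<dots> = s k * l2_inner \<tau> (\<phi> k) (\<phi> j)" by (rule SCS_inner[OF jk(2) \<phi>_sq[OF jk(1)]])
    finally show ?thesis using \<phi>_on[OF jk(2,1)] jk by (auto simp: I_def)
  qed
  have z: "v k = (\<lambda>x. 0)" if "k \<notin> I" for k using that by (simp add: v_def)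
  have ortho: "ortho_system v" unfolding ortho_system_def
  proof (intro conjI allI impI)
    show "v k \<in> H" for k by (rule vH)
    show "ip (v j) (v k) = 0" if "j \<noteq> k" for j k
      using on[of j k] z[of j] z[of k] ip_zero zero_mem vH that by (cases "j \<in> I"; cases "k \<in> I") auto
    show "ip (v k) (v k) = 1 \<or> v k = (\<lambda>x. 0)" for k using on[of k k] z[of k] by (cases "k \<in> I") auto
  qed
  have v_sq: "v k \<in> sq_int \<tau>" for k by (rule mem_sq_int[OF vH])
  have X_v: "l2_inner \<tau> (X \<omega>) (v k) = l2_inner \<tau> (X \<omega>) (S (\<phi> k))" if "k \<in> I" "\<omega> \<in> space P" for k \<omega>
    using pair_v[OF that(1) X_sq_int[OF that(2)]] by (simp add: l2_inner_commute)
  have cov: "(\<integral>\<omega>. l2_inner \<tau> (X \<omega>) (v j) * l2_inner \<tau> (X \<omega>) (v k) \<partial>P)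
       = (if j = k then (if 1 \<le> k \<and> 0 < s k then s k else 0) else 0)" for j k
  proof (cases "j \<in> I \<and> k \<in> I")
    case True
    then have jk: "j \<in> I" "k \<in> I" by auto
    have "(\<integral>\<omega>. l2_inner \<tau> (X \<omega>) (v j) * l2_inner \<tau> (X \<omega>) (v k) \<partial>P)
      = (\<integral>\<omega>. l2_inner \<tau> (X \<omega>) (S (\<phi> j)) * l2_inner \<tau> (X \<omega>) (S (\<phi> k)) \<partial>P)"
      by (rule Bochner_Integration.integral_cong[OF refl]) (simp add: X_v jk)
    also have "\<dots> = l2_inner \<tau> (?C (S (\<phi> j))) (S (\<phi> k))"
      by (rule cov_op_inner[OF S_sq S_sq, OF \<phi>_sq \<phi>_sq, OF jk, symmetric])
    also have "\<dots> = l2_inner \<tau> (S (?C (S (\<phi> j)))) (\<phi> k)"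
      by (rule S_adj[OF C_sq[OF jk(1)] \<phi>_sq[OF jk(2)], symmetric])
    also have "\<dots> = s j * l2_inner \<tau> (\<phi> j) (\<phi> k)" by (rule SCS_inner[OF jk(1) \<phi>_sq[OF jk(2)]])
    finally show ?thesis using \<phi>_on[OF jk] jk by (auto simp: I_def)
  next
    case False
    then have "v j = (\<lambda>x. 0) \<or> v k = (\<lambda>x. 0)" using z by blast
    then show ?thesis using False by (auto simp: I_def l2_inner_def)
  qed
  \<comment> \<open>Orthogonality to the system says that \<open>S (?C f)\<close> is orthogonal to
    every \<open>\<phi> k\<close>, hence annihilated by \<open>S C S\<close>. For
    \<open>g = S (S (?C f))\<close> this means \<open>S (?C g) = 0\<close>, so the pairing of
    \<open>X\<close> with \<open>g\<close> vanishes almost surely. The squared kernel norm of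
    \<open>repr (?C f)\<close> is the mixed second moment of the pairings with \<open>f\<close> and
    \<open>g\<close>, thus 0, and then the second moment of the pairing with \<open>f\<close> is 0
    as well. No representation of \<open>f\<close> in the form \<open>S h\<close> is needed.\<close>
  have null: "AE \<omega> in P. l2_inner \<tau> (X \<omega>) f = 0" if f: "f \<in> H" and fv: "\<And>k. ip f (v k) = 0" for f
  proof -
    have fs: "f \<in> sq_int \<tau>" by (rule mem_sq_int[OF f])
    have Cf: "?C f \<in> sq_int \<tau>" by (rule cov_op_sq_int[OF fs])
    have SCf: "S (?C f) \<in> sq_int \<tau>" by (rule S_sq[OF Cf])
    define g where "g = S (S (?C f))"
    have g: "g \<in> sq_int \<tau>" unfolding g_def by (rule S_sq[OF SCf])
    have Cg: "?C g \<in> sq_int \<tau>" by (rule cov_op_sq_int[OF g])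
    have "l2_inner \<tau> (S (?C f)) (\<phi> k) = 0" if k: "k \<in> I" for k
    proof -
      have "l2_inner \<tau> (S (?C f)) (\<phi> k) = l2_inner \<tau> (?C f) (S (\<phi> k))" by (rule S_adj[OF Cf \<phi>_sq[OF k]])
      also have "\<dots> = l2_inner \<tau> (?C (S (\<phi> k))) f"
        unfolding cov_op_inner[OF fs S_sq[OF \<phi>_sq[OF k]]] cov_op_inner[OF S_sq[OF \<phi>_sq[OF k]] fs]
        by (simp add: mult.commute)
      also have "\<dots> = 0" using ip_v[OF f k] fv[of k] k by (simp add: I_def l2_inner_commute)
      finally show ?thesis .
    qed
    then have "AE x in \<tau>. S (?C g) x = 0" using \<phi>_null[OF SCf] by (simp add: g_def)
    then have "l2_inner \<tau> (S (?C g)) (S (?C f)) = l2_inner \<tau> (\<lambda>x. 0) (S (?C f))"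
      by (rule l2_inner_cong_AE) (use S_sq[OF Cg] SCf in \<open>auto intro: sq_int_measurable\<close>)
    then have "l2_inner \<tau> (?C g) g = 0"
      using S_adj[OF Cg SCf] by (simp add: g_def l2_inner_def[of \<tau> "\<lambda>x. 0"])
    then have "l2_inner P (\<lambda>\<omega>. l2_inner \<tau> (X \<omega>) g) (\<lambda>\<omega>. l2_inner \<tau> (X \<omega>) g) = 0"
      using cov_op_inner[OF g g] by (simp add: l2_inner_def[of P])
    then have gX: "AE \<omega> in P. l2_inner \<tau> (X \<omega>) g = 0" by (rule l2_inner_eq0[OF pairing_sq_int[OF g]])
    have "l2_inner \<tau> (?C f) (repr (?C f)) = l2_inner \<tau> (repr (?C f)) (?C f)" by (rule l2_inner_commute)
    also have "\<dots> = l2_inner \<tau> g (?C f)"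
      unfolding g_def by (rule l2_inner_cong_AE[OF repr_SS[OF Cf]])
        (use mem_sq_int[OF repr_mem[OF Cf]] S_sq[OF SCf] Cf in \<open>auto intro: sq_int_measurable\<close>)
    also have "\<dots> = (\<integral>\<omega>. l2_inner \<tau> (X \<omega>) f * l2_inner \<tau> (X \<omega>) g \<partial>P)"
      using cov_op_inner[OF fs g] by (simp add: l2_inner_commute)
    also have "\<dots> = (\<integral>\<omega>. 0 \<partial>P)"
      by (rule integral_cong_AE)
        (use gX sq_int_measurable[OF pairing_sq_int[OF fs]] sq_int_measurable[OF pairing_sq_int[OF g]] in auto)
    finally have "ip (repr (?C f)) (repr (?C f)) = 0" using repr_ip[OF Cf repr_mem[OF Cf]] by simp
    then have "repr (?C f) = (\<lambda>x. 0)" by (rule ip_eq0[OF repr_mem[OF Cf]])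
    then have "l2_inner \<tau> (?C f) f = 0" using repr_ip[OF Cf f] ip_zero(2)[OF f] by simp
    then have "l2_inner P (\<lambda>\<omega>. l2_inner \<tau> (X \<omega>) f) (\<lambda>\<omega>. l2_inner \<tau> (X \<omega>) f) = 0"
      using cov_op_inner[OF fs fs] by (simp add: l2_inner_def[of P])
    then show ?thesis by (rule l2_inner_eq0[OF pairing_sq_int[OF fs]])
  qed
  show ?thesis using ortho cov null by blast
qed

text \<open>As \<open>repr (\<phi> k)\<close> is \<open>s k * \<phi> k\<close> almost everywhere,
  division by \<open>sqrt (s k)\<close> yields the Mercer system
  \<open>sqrt (s k) * \<phi> k\<close>, realized inside \<open>H\<close>. An \<open>f\<close>
  orthogonal to it is orthogonal to all eigenfunctions, so \<open>repr f\<close> is 0, and with it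
  \<open>l2_inner \<rho> f f\<close>, which equals \<open>ip f (repr f)\<close>.\<close>

lemma nonparametric_features:
  assumes rk: "rkhs_in_l2 S G H ip D \<rho>"
    and s: "l2_eigenvalues \<rho> (kernel_op \<rho> G) s"
  shows "\<exists>v. hfs.ortho_system H ip v \<and>
    (\<forall>j k. l2_inner \<rho> (v j) (v k) = (if j = k then (if 1 \<le> k \<and> 0 < s k then s k else 0) else 0)) \<and>
    (\<forall>f\<in>H. (\<forall>k. ip f (v k) = 0) \<longrightarrow> (AE x in \<rho>. f x = 0))"
proof -
  interpret rkhs_in_l2 S G H ip D \<rho> by (rule rk)
  define I where "I = {k. 1 \<le> k \<and> 0 < s k}"
  have repr_AE: "AE x in \<rho>. repr f x = kernel_op \<rho> G f x" if "f \<in> sq_int \<rho>" for f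
    using AE_space by eventually_elim (simp add: repr_kernel_op[OF that] space_nu)
  have repr_sq: "repr f \<in> sq_int \<rho>" if "f \<in> sq_int \<rho>" for f by (rule mem_sq_int[OF repr_mem[OF that]])
  obtain \<phi> where \<phi>: "\<forall>k\<in>I. \<phi> k \<in> sq_int \<rho>"
    "\<forall>j\<in>I. \<forall>k\<in>I. l2_inner \<rho> (\<phi> j) (\<phi> k) = (if j = k then 1 else 0)"
    "\<forall>k\<in>I. AE x in \<rho>. kernel_op \<rho> G (\<phi> k) x = s k * \<phi> k x"
    "\<forall>f\<in>sq_int \<rho>. (\<forall>k\<in>I. l2_inner \<rho> f (\<phi> k) = 0) \<longrightarrow> (AE x in \<rho>. kernel_op \<rho> G f x = 0)"
    using s unfolding l2_eigenvalues_def Let_def I_def[symmetric] 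
    by (elim conjE exE) (rule that; assumption)
  note \<phi>_sq = \<phi>(1)[rule_format] and \<phi>_on = \<phi>(2)[rule_format] and \<phi>_ev = \<phi>(3)[rule_format]
    and \<phi>_null = \<phi>(4)[rule_format]
  define v where "v k = (if k \<in> I then (\<lambda>x. (1 / sqrt (s k)) * repr (\<phi> k) x) else (\<lambda>x. 0))" for k
  have vH: "v k \<in> H" for k
    using scale_mem[OF repr_mem[OF \<phi>_sq], of k "1 / sqrt (s k)"] zero_mem by (auto simp: v_def)
  have v_sq: "v k \<in> sq_int \<rho>" for k by (rule mem_sq_int[OF vH])
  have v_ae: "AE x in \<rho>. v k x = sqrt (s k) * \<phi> k x" if k: "k \<in> I" for k
  proof -
    have "s k > 0" using k by (simp add: I_def)
    then have div: "s k / sqrt (s k) = sqrt (s k)" by (simp add: real_div_sqrt)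
    show ?thesis using repr_AE[OF \<phi>_sq[OF k]] \<phi>_ev[OF k]
    proof eventually_elim
      case (elim x)
      then have "v k x = s k / sqrt (s k) * \<phi> k x" using k by (simp add: v_def)
      then show ?case unfolding div .
    qed
  qed
  have ip_v: "ip f (v k) = l2_inner \<rho> f (\<phi> k) / sqrt (s k)" if "f \<in> H" "k \<in> I" for f k
    unfolding v_def if_P[OF that(2)] ip_scale2[OF repr_mem[OF \<phi>_sq[OF that(2)]] that(1)]
      repr_ip[OF \<phi>_sq[OF that(2)] that(1)] by (simp add: l2_inner_commute)
  have pair_v: "l2_inner \<rho> (v j) g = sqrt (s j) * l2_inner \<rho> (\<phi> j) g" if "j \<in> I" "g \<in> sq_int \<rho>" for j g
  proof -
    have "l2_inner \<rho> (v j) g = l2_inner \<rho> (\<lambda>x. sqrt (s j) * \<phi> j x) g"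
      by (rule l2_inner_cong_AE[OF v_ae])
        (use that v_sq \<phi>_sq in \<open>auto intro!: sq_int_measurable sq_int_scale\<close>)
    then show ?thesis by (simp add: l2_inner_scale)
  qed
  have on: "ip (v j) (v k) = (if j = k then 1 else 0)" if jk: "j \<in> I" "k \<in> I" for j k
    using ip_v[OF vH jk(2)] pair_v[OF jk(1) \<phi>_sq[OF jk(2)]] \<phi>_on[OF jk] jk by (auto simp: I_def)
  have z: "v k = (\<lambda>x. 0)" if "k \<notin> I" for k using that by (simp add: v_def)
  have ortho: "ortho_system v" unfolding ortho_system_def
  proof (intro conjI allI impI)
    show "v k \<in> H" for k by (rule vH)
    show "ip (v j) (v k) = 0" if "j \<noteq> k" for j k
      using on[of j k] z[of j] z[of k] ip_zero zero_mem vH that by (cases "j \<in> I"; cases "k \<in> I") auto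
    show "ip (v k) (v k) = 1 \<or> v k = (\<lambda>x. 0)" for k using on[of k k] z[of k] by (cases "k \<in> I") auto
  qed
  have cov: "l2_inner \<rho> (v j) (v k) = (if j = k then (if 1 \<le> k \<and> 0 < s k then s k else 0) else 0)" for j k
  proof (cases "j \<in> I \<and> k \<in> I")
    case True
    then have jk: "j \<in> I" "k \<in> I" by auto
    have "l2_inner \<rho> (v j) (v k) = sqrt (s j) * l2_inner \<rho> (v k) (\<phi> j)"
      using pair_v[OF jk(1) v_sq[of k]] by (simp only: l2_inner_commute[of \<rho> "v k"])
    also have "\<dots> = sqrt (s j) * (sqrt (s k) * l2_inner \<rho> (\<phi> k) (\<phi> j))"
      using pair_v[OF jk(2) \<phi>_sq[OF jk(1)]] by simp
    finally show ?thesis using \<phi>_on[OF jk(2,1)] jk by (auto simp: I_def simp flip: mult.assoc)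
  next
    case False
    then have "v j = (\<lambda>x. 0) \<or> v k = (\<lambda>x. 0)" using z by blast
    then show ?thesis using False by (auto simp: I_def l2_inner_def)
  qed
  have null: "AE x in \<rho>. f x = 0" if f: "f \<in> H" and fv: "\<And>k. ip f (v k) = 0" for f
  proof -
    have fs: "f \<in> sq_int \<rho>" by (rule mem_sq_int[OF f])
    have "l2_inner \<rho> f (\<phi> k) = 0" if "k \<in> I" for k
      using ip_v[OF f that] fv[of k] that by (simp add: I_def)
    then have "AE x in \<rho>. repr f x = 0"
      using \<phi>_null[OF fs] repr_AE[OF fs] by (auto elim: eventually_elim2)
    then have "l2_inner \<rho> (repr f) f = l2_inner \<rho> (\<lambda>x. 0) f"
      by (rule l2_inner_cong_AE) (use fs repr_sq[OF fs] in \<open>auto intro: sq_int_measurable\<close>)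
    then have "ip (repr f) (repr f) = 0"
      using repr_ip[OF fs repr_mem[OF fs]] l2_inner_commute[of \<rho> f "repr f"]
      by (simp add: l2_inner_def[of \<rho> "\<lambda>x. 0"])
    then have "repr f = (\<lambda>x. 0)" by (rule ip_eq0[OF repr_mem[OF fs]])
    then have "l2_inner \<rho> f f = 0" using repr_ip[OF fs f] ip_zero(2)[OF f] by simp
    then show ?thesis by (rule l2_inner_eq0[OF fs])
  qed
  show ?thesis using ortho cov null by blast
qed

section \<open>Normal equations and the sample\<close>

text \<open>For \<open>E\<close> nonzero the step \<open>- E / (\<bar>F\<bar> + 1)\<close> makes the
  expression negative, whatever the sign of \<open>F\<close>.\<close>

lemma quadratic_stationary:
  fixes E F :: real
  assumes "\<And>t. 0 \<le> 2 * t * E + t\<^sup>2 * F"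
  shows "E = 0"
proof (rule ccontr)
  assume E: "E \<noteq> 0"
  define d where "d = \<bar>F\<bar> + 1"
  have d: "d > 0" "F < d" by (auto simp: d_def)
  have "0 \<le> (2 * (- E / d) * E + (- E / d)\<^sup>2 * F) * d\<^sup>2" using assms[of "- E / d"] by simp
  also have "\<dots> = E\<^sup>2 * (F - 2 * d)" using d by (simp add: power2_eq_square field_simps)
  finally have "0 \<le> F - 2 * d" using E by (simp add: zero_le_mult_iff)
  then show False using d by linarith
qed

text \<open>Along the line through the minimizer in direction \<open>(b, c)\<close> the objective is
  an exact quadratic in the step, so its linear coefficient vanishes. The hypothesis
  \<open>int\<close> makes the Bochner integral additive along this line.\<close>

lemma normal_equation:
  assumes HK: "hilbert_function_space S HK ipK" and HG: "hilbert_function_space S' HG ipG"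
    and int: "\<forall>i<n. \<forall>\<beta>\<in>HK. integrable (lebesgue_on T) (\<lambda>t. x i t * \<beta> t)"
    and min: "is_arg_min (plm_objective T ipK ipG l \<xi> n x z y) (\<lambda>(\<beta>, g). \<beta> \<in> HK \<and> g \<in> HG) (\<beta>h, gh)"
    and b: "b \<in> HK" and c: "c \<in> HG"
  shows "(1 / real n) * (\<Sum>i<n. (y i - (\<integral>t. x i t * \<beta>h t \<partial>lebesgue_on T) - gh (z i)) *
      ((\<integral>t. x i t * b t \<partial>lebesgue_on T) + c (z i))) = l\<^sup>2 * ipK \<beta>h b + \<xi>\<^sup>2 * ipG gh c"
proof -
  interpret K: hfs S HK ipK by unfold_locales (rule HK)
  interpret G: hfs S' HG ipG by unfold_locales (rule HG)
  have h: "\<beta>h \<in> HK" "gh \<in> HG" using min by (auto simp: is_arg_min_def)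
  define e where "e i = y i - (\<integral>t. x i t * \<beta>h t \<partial>lebesgue_on T) - gh (z i)" for i
  define h where "h i = (\<integral>t. x i t * b t \<partial>lebesgue_on T) + c (z i)" for i
  let ?J = "plm_objective T ipK ipG l \<xi> n x z y"
  let ?E = "l\<^sup>2 * ipK \<beta>h b + \<xi>\<^sup>2 * ipG gh c - (1 / real n) * (\<Sum>i<n. e i * h i)"
  let ?F = "(1 / real n) * (\<Sum>i<n. (h i)\<^sup>2) + l\<^sup>2 * ipK b b + \<xi>\<^sup>2 * ipG c c"
  have "?E = 0"
  proof (rule quadratic_stationary)
    fix t :: real
    let ?b = "\<lambda>u. 1 * \<beta>h u + t * b u" and ?g = "\<lambda>u. 1 * gh u + t * c u"
    have mem: "?b \<in> HK" "?g \<in> HG" using K.lin_mem G.lin_mem \<open>\<beta>h \<in> HK\<close> \<open>gh \<in> HG\<close> b c by blast+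
    then have le: "?J (\<beta>h, gh) \<le> ?J (?b, ?g)" using min by (auto simp: is_arg_min_def not_less)
    have shift: "y i - (\<integral>u. x i u * ?b u \<partial>lebesgue_on T) - ?g (z i) = e i - t * h i" if "i < n" for i
    proof -
      have "(\<integral>u. x i u * ?b u \<partial>lebesgue_on T)
          = (\<integral>u. x i u * \<beta>h u + t * (x i u * b u) \<partial>lebesgue_on T)" by (simp add: algebra_simps)
      also have "\<dots> = (\<integral>u. x i u * \<beta>h u \<partial>lebesgue_on T) + t * (\<integral>u. x i u * b u \<partial>lebesgue_on T)"
        using int[rule_format, OF that \<open>\<beta>h \<in> HK\<close>] int[rule_format, OF that b] by simp
      finally show ?thesis by (simp add: e_def h_def algebra_simps)
    qed
    have shift_sum: "(\<Sum>i<n. (y i - (\<integral>u. x i u * ?b u \<partial>lebesgue_on T) - ?g (z i))\<^sup>2)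
        = (\<Sum>i<n. (e i - t * h i)\<^sup>2)" by (intro sum.cong refl) (simp only: shift lessThan_iff)
    have "?J (?b, ?g) = (1 / real n) * (\<Sum>i<n. (e i - t * h i)\<^sup>2) + l\<^sup>2 * ipK ?b ?b + \<xi>\<^sup>2 * ipG ?g ?g"
      unfolding plm_objective_def prod.case K.norm_sq[OF mem(1)] G.norm_sq[OF mem(2)]
      by (simp only: shift_sum)
    also have "(\<Sum>i<n. (e i - t * h i)\<^sup>2) = (\<Sum>i<n. (e i)\<^sup>2) - 2 * t * (\<Sum>i<n. e i * h i) + t\<^sup>2 * (\<Sum>i<n. (h i)\<^sup>2)"
      by (simp add: power2_diff sum.distrib sum_subtractf sum_distrib_left power_mult_distrib mult_ac)
    also have "ipK ?b ?b = ipK \<beta>h \<beta>h + 2 * t * ipK \<beta>h b + t\<^sup>2 * ipK b b"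
      using K.ip_square[OF \<open>\<beta>h \<in> HK\<close> b, of 1 t] by simp
    also have "ipG ?g ?g = ipG gh gh + 2 * t * ipG gh c + t\<^sup>2 * ipG c c"
      using G.ip_square[OF \<open>gh \<in> HG\<close> c, of 1 t] by simp
    finally have shifted: "?J (?b, ?g) = (1 / real n) *
        ((\<Sum>i<n. (e i)\<^sup>2) - 2 * t * (\<Sum>i<n. e i * h i) + t\<^sup>2 * (\<Sum>i<n. (h i)\<^sup>2)) +
        l\<^sup>2 * (ipK \<beta>h \<beta>h + 2 * t * ipK \<beta>h b + t\<^sup>2 * ipK b b) +
        \<xi>\<^sup>2 * (ipG gh gh + 2 * t * ipG gh c + t\<^sup>2 * ipG c c)" .
    have base: "?J (\<beta>h, gh) = (1 / real n) * (\<Sum>i<n. (e i)\<^sup>2) + l\<^sup>2 * ipK \<beta>h \<beta>h + \<xi>\<^sup>2 * ipG gh gh"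
      unfolding plm_objective_def prod.case K.norm_sq[OF \<open>\<beta>h \<in> HK\<close>] G.norm_sq[OF \<open>gh \<in> HG\<close>] e_def ..
    have "?J (?b, ?g) = ?J (\<beta>h, gh) + (2 * t * ?E + t\<^sup>2 * ?F)"
      unfolding shifted base by (simp add: algebra_simps)
    with le show "0 \<le> 2 * t * ?E + t\<^sup>2 * ?F" by linarith
  qed
  then show ?thesis by (simp add: e_def h_def)
qed

text \<open>For almost every fixed \<open>t\<close> the function of \<open>Z\<close> can be paired
  with the conditional expectation of \<open>X \<omega> t\<close>, which gives 0. The exceptional
  null set of \<open>P\<close> depends on \<open>t\<close>, so the time integral is kept outermost
  and interchanged by Fubini's theorem.\<close>

lemma (in random_curve) uncorrelated_of_cond_exp_zero:
  assumes Z: "Z \<in> measurable P N"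
    and ce: "AE t in \<tau>. AE \<omega> in P. real_cond_exp P (vimage_algebra (space P) Z N) (\<lambda>\<omega>'. X \<omega>' t) \<omega> = 0"
    and h: "h \<in> borel_measurable N" "\<And>z. z \<in> space N \<Longrightarrow> \<bar>h z\<bar> \<le> B" and g: "g \<in> sq_int \<tau>"
  shows "(\<integral>\<omega>. l2_inner \<tau> (X \<omega>) g * h (Z \<omega>) \<partial>P) = 0"
proof -
  let ?F = "vimage_algebra (space P) Z N"
  have ZF: "Z \<in> measurable ?F N" by (rule measurable_vimage_algebra1) (use measurable_space[OF Z] in auto)
  have sub: "subalgebra P ?F"
    unfolding subalgebra_def using Z by (simp add: sets_image_in_sets)
  interpret F: finite_measure_subalgebra P ?F by unfold_locales (rule sub)
  have hF: "(\<lambda>\<omega>. h (Z \<omega>)) \<in> borel_measurable ?F" by (rule measurable_compose[OF ZF h(1)])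
  have hP: "(\<lambda>\<omega>. h (Z \<omega>)) \<in> borel_measurable P" by (rule measurable_compose[OF Z h(1)])
  have hB: "AE \<omega> in P. norm (h (Z \<omega>)) \<le> B" using h(2) measurable_space[OF Z] by (intro AE_I2) auto
  have hsq: "(\<lambda>\<omega>. h (Z \<omega>)) \<in> sq_int P"
  proof -
    have "AE \<omega> in P. norm ((h (Z \<omega>))\<^sup>2) \<le> B\<^sup>2"
      using hB by eventually_elim (metis norm_power power_mono norm_ge_zero)
    then have "integrable P (\<lambda>\<omega>. (h (Z \<omega>))\<^sup>2)"
      by (rule P.integrable_const_bound) (use hP in simp)
    with hP show ?thesis by (simp add: sq_int_def)
  qed
  have "AE t in \<tau>. (\<integral>\<omega>. X \<omega> t * h (Z \<omega>) \<partial>P) * g t = 0"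
    using ce second_moment(1)
  proof eventually_elim
    case (elim t)
    have i: "integrable P (\<lambda>\<omega>. h (Z \<omega>) * X \<omega> t)" by (rule sq_int_mult[OF hsq elim(2)])
    have "(\<integral>\<omega>. h (Z \<omega>) * X \<omega> t \<partial>P) = (\<integral>\<omega>. h (Z \<omega>) * real_cond_exp P ?F (\<lambda>\<omega>'. X \<omega>' t) \<omega> \<partial>P)"
      by (rule F.real_cond_exp_intg(2)[OF i hF sq_int_measurable[OF elim(2)], symmetric])
    also have "\<dots> = (\<integral>\<omega>. 0 \<partial>P)"
      by (rule integral_cong_AE) (use elim(1) hP in auto)
    finally show ?case by (simp add: mult.commute)
  qed
  then have "(\<integral>t. (\<integral>\<omega>. X \<omega> t * h (Z \<omega>) \<partial>P) * g t \<partial>\<tau>) = 0" by (rule integral_eq_zero_AE)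
  moreover have "(\<integral>t. (\<integral>\<omega>. X \<omega> t * h (Z \<omega>) \<partial>P) * g t \<partial>\<tau>) = (\<integral>\<omega>. h (Z \<omega>) * l2_inner \<tau> (X \<omega>) g \<partial>P)"
    by (rule fubini[OF hP sq_int_mult[OF sq_int_abs[OF hsq] X_norm_sq_int] g])
  ultimately show ?thesis by (simp add: mult.commute)
qed

lemma (in prob_space) iid_std_normal_moments:
  assumes ind: "indep_vars (\<lambda>_. borel) e UNIV" and D: "\<And>i. distributed M lborel (e i) std_normal_density"
  shows "integrable M (\<lambda>\<omega>. e i \<omega> * e j \<omega>)" "expectation (\<lambda>\<omega>. e i \<omega> * e j \<omega>) = (if i = j then 1 else 0)"
proof -
  have int2: "integrable M (\<lambda>\<omega>. (e i \<omega>)\<^sup>2)" for i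
    using distributed_integrable[OF D, of "\<lambda>x. x\<^sup>2" i] integrable_std_normal_moment[of 2] by simp
  have m: "e i \<in> borel_measurable M" for i using ind by (auto simp: indep_vars_def)
  have int1: "integrable M (e i)" for i using square_integrable_imp_integrable[OF m int2] by simp
  have E: "expectation (e i) = 0" for i by (rule standard_normal_distributed_expectation[OF D])
  have V: "expectation (\<lambda>\<omega>. (e i \<omega>)\<^sup>2) = 1" for i
    using standard_normal_distributed_variance[OF D, of i] by (simp add: E)
  show "integrable M (\<lambda>\<omega>. e i \<omega> * e j \<omega>)"
  proof (cases "i = j")
    case True then show ?thesis using int2[of i] by (simp add: power2_eq_square)
  next
    case False
    then show ?thesis using indep_vars_integrable[OF _ indep_vars_subset[OF ind, of "{i, j}"] int1] by simp
  qed
  show "expectation (\<lambda>\<omega>. e i \<omega> * e j \<omega>) = (if i = j then 1 else 0)"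
  proof (cases "i = j")
    case True then show ?thesis using V[of i] by (simp add: power2_eq_square)
  next
    case False
    then show ?thesis
      using indep_vars_lebesgue_integral[OF _ indep_vars_subset[OF ind, of "{i, j}"] int1] E by simp
  qed
qed

text \<open>Sampling is described for triples that include the response; projecting the response
  away leaves i.i.d. covariates with the law of \<open>(X, Z)\<close>.\<close>

lemma iid_sample_of_triples:
  assumes Q: "prob_space Q"
    and ind: "prob_space.indep_vars Q (\<lambda>_. M1 \<Otimes>\<^sub>M M2 \<Otimes>\<^sub>M borel) (\<lambda>i \<omega>. (Xs i \<omega>, Zs i \<omega>, Ys i \<omega> :: real)) UNIV"
    and law: "\<And>i. distr Q (M1 \<Otimes>\<^sub>M M2 \<Otimes>\<^sub>M borel) (\<lambda>\<omega>. (Xs i \<omega>, Zs i \<omega>, Ys i \<omega>)) =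
      distr P (M1 \<Otimes>\<^sub>M M2 \<Otimes>\<^sub>M borel) (\<lambda>\<omega>. (X \<omega>, Z \<omega>, Y \<omega>))"
    and meas: "X \<in> measurable P M1" "Z \<in> measurable P M2" "Y \<in> borel_measurable P"
    and e_ind: "prob_space.indep_vars Q (\<lambda>_. borel) es UNIV"
    and e_normal: "\<And>i. distributed Q lborel (es i) std_normal_density"
    and e_design: "prob_space.indep_set Q
         (sets (vimage_algebra (space Q) (\<lambda>\<omega> i. es i \<omega>) (PiM UNIV (\<lambda>_. borel))))
         (sets (vimage_algebra (space Q) (\<lambda>\<omega> i. (Xs i \<omega>, Zs i \<omega>)) (PiM UNIV (\<lambda>_. M1 \<Otimes>\<^sub>M M2))))"
  shows "iid_sample Q (M1 \<Otimes>\<^sub>M M2) (distr P (M1 \<Otimes>\<^sub>M M2) (\<lambda>\<omega>. (X \<omega>, Z \<omega>))) (\<lambda>i \<omega>. (Xs i \<omega>, Zs i \<omega>)) es"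
proof -
  interpret prob_space Q by (rule Q)
  let ?pr = "\<lambda>(x, z, y :: real). (x, z)"
  have pr: "?pr \<in> measurable (M1 \<Otimes>\<^sub>M M2 \<Otimes>\<^sub>M borel) (M1 \<Otimes>\<^sub>M M2)" by (simp add: case_prod_beta)
  have tr: "random_variable (M1 \<Otimes>\<^sub>M M2 \<Otimes>\<^sub>M borel) (\<lambda>\<omega>. (Xs i \<omega>, Zs i \<omega>, Ys i \<omega>))" for i
    using ind by (auto simp: indep_vars_def)
  show ?thesis
  proof
    show "indep_vars (\<lambda>_. M1 \<Otimes>\<^sub>M M2) (\<lambda>i \<omega>. (Xs i \<omega>, Zs i \<omega>)) UNIV"
      using indep_vars_compose2[OF ind, of "\<lambda>_. ?pr" "\<lambda>_. M1 \<Otimes>\<^sub>M M2"] pr by simp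
    fix i
    have "distr Q (M1 \<Otimes>\<^sub>M M2) (\<lambda>\<omega>. (Xs i \<omega>, Zs i \<omega>))
        = distr (distr Q (M1 \<Otimes>\<^sub>M M2 \<Otimes>\<^sub>M borel) (\<lambda>\<omega>. (Xs i \<omega>, Zs i \<omega>, Ys i \<omega>))) (M1 \<Otimes>\<^sub>M M2) ?pr"
      using distr_distr[OF pr tr[of i]] by (simp add: comp_def)
    also have "\<dots> = distr (distr P (M1 \<Otimes>\<^sub>M M2 \<Otimes>\<^sub>M borel) (\<lambda>\<omega>. (X \<omega>, Z \<omega>, Y \<omega>))) (M1 \<Otimes>\<^sub>M M2) ?pr"
      by (simp only: law)
    also have "\<dots> = distr P (M1 \<Otimes>\<^sub>M M2) (\<lambda>\<omega>. (X \<omega>, Z \<omega>))"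
      using distr_distr[OF pr, of "\<lambda>\<omega>. (X \<omega>, Z \<omega>, Y \<omega>)" P] meas by (simp add: comp_def)
    finally show "distr Q (M1 \<Otimes>\<^sub>M M2) (\<lambda>\<omega>. (Xs i \<omega>, Zs i \<omega>)) = distr P (M1 \<Otimes>\<^sub>M M2) (\<lambda>\<omega>. (X \<omega>, Z \<omega>))" .
  qed (use iid_std_normal_moments[OF e_ind e_normal] e_ind e_design in \<open>auto simp: indep_vars_def\<close>)
qed

text \<open>The squared ratio is bounded by a constant times
  \<open>n powr - (a - b)\<close>.\<close>

lemma powr_ratio_tendsto_0:
  fixes l x :: "nat \<Rightarrow> real"
  assumes pos: "\<And>n. n \<ge> 1 \<Longrightarrow> 0 < l n \<and> 0 < x n"
    and l: "\<forall>\<^sub>F n in sequentially. (l n)\<^sup>2 / real n powr - a \<le> C" and x: "\<forall>\<^sub>F n in sequentially. c \<le> (x n)\<^sup>2 / real n powr - b"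
    and c: "c > 0" and ab: "b < a"
  shows "(\<lambda>n. l n / x n) \<longlonglongrightarrow> 0"
proof -
  have "(\<lambda>n. (C / c) * real n powr - (a - b)) \<longlonglongrightarrow> (C / c) * 0"
    by (intro tendsto_mult_left tendsto_neg_powr filterlim_real_sequentially) (use ab in simp)
  then have lim: "(\<lambda>n. (C / c) * real n powr - (a - b)) \<longlonglongrightarrow> 0" by simp
  have "(\<lambda>n. (l n / x n)\<^sup>2) \<longlonglongrightarrow> 0"
  proof (rule Lim_null_comparison[OF _ lim])
    show "\<forall>\<^sub>F n in sequentially. norm ((l n / x n)\<^sup>2) \<le> (C / c) * real n powr - (a - b)"
      using l x eventually_ge_at_top[of 1]
    proof eventually_elim
      case (elim n)
      let ?p = "real n powr - a" and ?q = "real n powr - b"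
      have n: "real n > 0" and lx: "0 < l n" "0 < x n" using elim pos[of n] by auto
      have pq: "?p > 0" "?q > 0" using n by auto
      have "(l n)\<^sup>2 \<le> C * ?p" "c * ?q \<le> (x n)\<^sup>2" using elim pq by (simp_all add: field_simps)
      moreover from this(1) have "0 \<le> C * ?p" by (rule order_trans[OF zero_le_power2])
      ultimately have "(l n)\<^sup>2 / (x n)\<^sup>2 \<le> (C * ?p) / (c * ?q)"
        using c pq by (intro frac_le) auto
      also have "\<dots> = (C / c) * (?p / ?q)" by simp
      also have "?p / ?q = real n powr - (a - b)" by (simp add: powr_diff[symmetric])
      finally show ?case by (simp add: power_divide)
    qed
  qed
  then have "(\<lambda>n. sqrt ((l n / x n)\<^sup>2)) \<longlonglongrightarrow> sqrt 0" by (rule tendsto_real_sqrt)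
  then have "(\<lambda>n. \<bar>l n / x n\<bar>) \<longlonglongrightarrow> 0" by (simp only: real_sqrt_abs real_sqrt_zero)
  then show ?thesis by (rule tendsto_rabs_zero_cancel)
qed

section \<open>The partially linear functional model\<close>

text \<open>\<open>act p f\<close> is the number through which the covariate \<open>p\<close> sees
  \<open>f\<close>: the integral against the curve for one component, the value at \<open>Z\<close>
  for the other. \<open>D\<close> is a countable separating set such as the kernel sections at a
  dense set.\<close>

lemma (in hfs) feature_block_of_system:
  fixes act :: "'m \<Rightarrow> ('a \<Rightarrow> real) \<Rightarrow> real"
  assumes V: "V \<in> measurable P M"
    and lin: "\<And>p f g a b. p \<in> space M \<Longrightarrow> f \<in> H \<Longrightarrow> g \<in> H \<Longrightarrow>
      act p (\<lambda>x. a * f x + b * g x) = a * act p f + b * act p g"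
    and meas: "\<And>f. f \<in> H \<Longrightarrow> (\<lambda>p. act p f) \<in> borel_measurable M"
    and bnd: "AE p in distr P M V. \<forall>f\<in>H. \<bar>act p f\<bar> \<le> \<kappa> * rkhs_norm ip f" and \<kappa>: "\<kappa> \<ge> 0"
    and v: "ortho_system v"
    and cov: "\<And>j k. (\<integral>\<omega>. act (V \<omega>) (v j) * act (V \<omega>) (v k) \<partial>P) = (if j = k then \<sigma> k else 0)"
    and null: "\<And>f. f \<in> H \<Longrightarrow> (\<And>k. ip f (v k) = 0) \<Longrightarrow> AE \<omega> in P. act (V \<omega>) f = 0"
    and D: "countable D" "D \<subseteq> H" "\<And>f. f \<in> H \<Longrightarrow> (\<And>d. d \<in> D \<Longrightarrow> ip f d = 0) \<Longrightarrow> f = (\<lambda>x. 0)"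
  shows "feature_block (distr P M V) (\<lambda>k p. act p (v k)) \<sigma> (\<kappa>\<^sup>2)"
    "AE p in distr P M V. \<forall>f\<in>H. (\<lambda>k. ip f (v k) * act p (v k)) sums act p f"
proof -
  have vH: "v k \<in> H" for k using v by (auto simp: ortho_system_def)
  have AE: "AE p in distr P M V. (\<forall>f\<in>H. (\<lambda>k. ip f (v k) * act p (v k)) sums act p f) \<and>
      (\<forall>J. (\<Sum>k<J. (act p (v k))\<^sup>2) \<le> \<kappa>\<^sup>2)"
  proof (rule expansion_AE[OF _ bnd v _ D \<kappa>])
    show "AE p in distr P M V. act p f = 0" if f: "f \<in> H" and fv: "\<And>k. ip f (v k) = 0" for f
    proof (subst AE_distr_iff[OF V])
      have [measurable]: "(\<lambda>p. act p f) \<in> borel_measurable M" by (rule meas[OF f])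
      show "{p \<in> space M. act p f = 0} \<in> sets M" by measurable
    qed (rule null[OF f fv])
  qed (simp add: lin)
  show "AE p in distr P M V. \<forall>f\<in>H. (\<lambda>k. ip f (v k) * act p (v k)) sums act p f"
    using AE by eventually_elim blast
  have "(\<integral>p. act p (v j) * act p (v k) \<partial>distr P M V) = (if j = k then \<sigma> k else 0)" for j k
    unfolding cov[symmetric] by (rule integral_distr[OF V]) (intro borel_measurable_times meas vH)
  moreover have "AE p in distr P M V. \<forall>J. (\<Sum>k<J. (act p (v k))\<^sup>2) \<le> \<kappa>\<^sup>2"
    using AE by eventually_elim blast
  ultimately show "feature_block (distr P M V) (\<lambda>k p. act p (v k)) \<sigma> (\<kappa>\<^sup>2)"
    using meas[OF vH] by (simp add: feature_block_def)
qed

lemma bigO_prob_of_rate: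
  assumes V: "\<And>e. e > 0 \<Longrightarrow> \<exists>C>0. \<forall>\<^sub>F n in sequentially. \<exists>A\<in>sets Q. measure Q A \<le> e \<and>
      (\<forall>\<omega>\<in>space Q - A. \<bar>V n \<omega>\<bar> \<le> C * a n)"
    and a: "\<forall>\<^sub>F n in sequentially. a n / b n \<le> C'" and b: "\<forall>\<^sub>F n in sequentially. b n > 0" and C': "C' > 0"
  shows "bigO_prob Q V b"
  unfolding bigO_prob_def
proof (intro allI impI)
  fix e :: real assume "e > 0"
  from V[OF this] obtain C where C: "C > 0" and ev: "\<forall>\<^sub>F n in sequentially. \<exists>A\<in>sets Q. measure Q A \<le> e \<and>
      (\<forall>\<omega>\<in>space Q - A. \<bar>V n \<omega>\<bar> \<le> C * a n)" by blast
  have "\<forall>\<^sub>F n in sequentially. \<exists>A\<in>sets Q. {\<omega> \<in> space Q. \<bar>V n \<omega>\<bar> > C * C' * b n} \<subseteq> A \<and> measure Q A \<le> e"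
    using ev a b
  proof eventually_elim
    case (elim n)
    then obtain A where A: "A \<in> sets Q" "measure Q A \<le> e" "\<And>\<omega>. \<omega> \<in> space Q - A \<Longrightarrow> \<bar>V n \<omega>\<bar> \<le> C * a n" by blast
    have "a n \<le> C' * b n" using elim by (simp add: field_simps)
    then have "C * a n \<le> C * C' * b n" using C by simp
    then have "{\<omega> \<in> space Q. \<bar>V n \<omega>\<bar> > C * C' * b n} \<subseteq> A" using A(3) by fastforce
    with A show ?case by blast
  qed
  then show "\<exists>C>0. \<forall>\<^sub>F n in sequentially. \<exists>A\<in>sets Q. {\<omega> \<in> space Q. \<bar>V n \<omega>\<bar> > C * b n} \<subseteq> A \<and> measure Q A \<le> e"
    using C C' by (intro exI[of _ "C * C'"]) simp
qed

theorem mainTheorem3: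
  fixes T :: "real set" and ZZ :: "(real ^ 'p) set"
    and K :: "real \<Rightarrow> real \<Rightarrow> real" and G :: "real ^ 'p \<Rightarrow> real ^ 'p \<Rightarrow> real"
    and HK :: "(real \<Rightarrow> real) set" and ipK :: "(real \<Rightarrow> real) \<Rightarrow> (real \<Rightarrow> real) \<Rightarrow> real"
    and HG :: "(real ^ 'p \<Rightarrow> real) set"
    and ipG :: "(real ^ 'p \<Rightarrow> real) \<Rightarrow> (real ^ 'p \<Rightarrow> real) \<Rightarrow> real"
    and P :: "'w measure" and X :: "'w \<Rightarrow> real \<Rightarrow> real" and Z :: "'w \<Rightarrow> real ^ 'p"
    and Y eps :: "'w \<Rightarrow> real"
    and Q :: "'v measure" and Xs :: "nat \<Rightarrow> 'v \<Rightarrow> real \<Rightarrow> real" and Zs :: "nat \<Rightarrow> 'v \<Rightarrow> real ^ 'p"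
    and Ys es :: "nat \<Rightarrow> 'v \<Rightarrow> real"
    and \<beta>0 :: "real \<Rightarrow> real" and g0 :: "real ^ 'p \<Rightarrow> real"
    and LK_half :: "(real \<Rightarrow> real) \<Rightarrow> real \<Rightarrow> real"
    and s s' :: "nat \<Rightarrow> real"
    and c1 c2 r m D\<^sub>x :: real
  defines "\<tau> \<equiv> lebesgue_on T"
    and "\<B> \<equiv> restrict_space borel ZZ"
  defines "\<rho> \<equiv> distr P \<B> Z"
    and "XZY_space \<equiv> l2_borel \<tau> \<Otimes>\<^sub>M \<B> \<Otimes>\<^sub>M borel"
  \<comment> \<open>spaces and kernels\<close>
  assumes T: "compact T"
    and K: "continuous_on (T \<times> T) (\<lambda>(s, t). K s t)"
      "(\<lambda>(s, t). K s t) \<in> sq_int (\<tau> \<Otimes>\<^sub>M \<tau>)" "nonneg_definite_kernel T K"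
    and G: "continuous_on (ZZ \<times> ZZ) (\<lambda>(z, z'). G z z')"
      "(\<lambda>(z, z'). G z z') \<in> sq_int (\<rho> \<Otimes>\<^sub>M \<rho>)" "nonneg_definite_kernel ZZ G"
    and HK: "rkhs T K HK ipK"
    and HG: "rkhs ZZ G HG ipG"
  \<comment> \<open>model\<close>
    and P: "prob_space P"
    and X_meas: "(\<lambda>(\<omega>, t). X \<omega> t) \<in> borel_measurable (P \<Otimes>\<^sub>M \<tau>)" "X \<in> measurable P (l2_borel \<tau>)"
    and X_sq_int: "integrable P (\<lambda>\<omega>. (l2_norm \<tau> (X \<omega>))\<^sup>2)"
    and X_centered: "AE t in \<tau>. (\<integral>\<omega>. X \<omega> t \<partial>P) = 0"
    and Z_meas: "Z \<in> measurable P \<B>"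
    and X_given_Z: "cond_exp_zero P T \<B> X Z"
    and true_params: "\<beta>0 \<in> HK" "g0 \<in> HG"
    and eps_meas: "eps \<in> borel_measurable P"
    and Y: "\<forall>\<omega>\<in>space P. Y \<omega> = (\<integral>t. X \<omega> t * \<beta>0 t \<partial>\<tau>) + g0 (Z \<omega>) + eps \<omega>"
  \<comment> \<open>i.i.d. sample; the sample of size \<open>n\<close> consists of the observations \<open>i < n\<close>\<close>
    and Q: "prob_space Q"
    and sample_indep:
      "prob_space.indep_vars Q (\<lambda>_. XZY_space) (\<lambda>i \<omega>. (Xs i \<omega>, Zs i \<omega>, Ys i \<omega>)) UNIV"
    and sample_law:
      "\<forall>i. distr Q XZY_space (\<lambda>\<omega>. (Xs i \<omega>, Zs i \<omega>, Ys i \<omega>)) =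
           distr P XZY_space (\<lambda>\<omega>. (X \<omega>, Z \<omega>, Y \<omega>))"
    and Ys: "\<forall>i. \<forall>\<omega>\<in>space Q. Ys i \<omega> = (\<integral>t. Xs i \<omega> t * \<beta>0 t \<partial>\<tau>) + g0 (Zs i \<omega>) + es i \<omega>"
  \<comment> \<open>Gaussian errors, independent of the covariates\<close>
    and errors_indep: "prob_space.indep_vars Q (\<lambda>_. borel) es UNIV"
    and errors_normal: "\<forall>i. distributed Q lborel (es i) std_normal_density"
    and errors_design_indep:
      "prob_space.indep_set Q
         (sets (vimage_algebra (space Q) (\<lambda>\<omega> i. es i \<omega>) (PiM UNIV (\<lambda>_. borel))))
         (sets (vimage_algebra (space Q) (\<lambda>\<omega> i. (Xs i \<omega>, Zs i \<omega>))
            (PiM UNIV (\<lambda>_. l2_borel \<tau> \<Otimes>\<^sub>M \<B>))))"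
  \<comment> \<open>design\<close>
    and X_bounded: "AE \<omega> in P. l2_norm \<tau> (X \<omega>) \<le> D\<^sub>x"
    and D_K: "bdd_above ((\<lambda>t. \<bar>K t t\<bar>) ` T)"
    and D_G: "bdd_above ((\<lambda>z. \<bar>G z z\<bar>) ` ZZ)"
  \<comment> \<open>eigenvalue decay\<close>
    and LK_half: "l2_sqrt \<tau> (kernel_op \<tau> K) LK_half"
    and s: "l2_eigenvalues \<tau> (LK_half \<circ> kernel_op \<tau> (cov_kernel P X) \<circ> LK_half) s"
    and s': "l2_eigenvalues \<rho> (kernel_op \<rho> G) s'" "\<forall>k\<ge>1. 0 < s' k"
    and s_decay: "\<forall>k\<ge>1. s k \<le> c1 * real k powr (- 2 * r)"
    and s'_decay: "\<forall>k\<ge>1. s' k \<le> c2 * real k powr (- 2 * m)"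
    and smoothness: "0 < m" "0 < r" "m < r"
  shows "\<exists>\<delta>0>0. \<forall>\<delta> \<delta>\<^sub>I (lam :: nat \<Rightarrow> real) \<xi> R R\<^sub>I \<beta>h gh.
      0 < \<delta> \<and> \<delta> \<le> \<delta>0 \<and> 0 < \<delta>\<^sub>I \<and> \<delta>\<^sub>I \<le> \<delta>0 \<and>
      (\<forall>n\<ge>1. 0 < lam n \<and> 0 < \<xi> n) \<and>
      (\<forall>n\<ge>1. \<forall>\<omega>\<in>space Q.
         is_arg_min
           (plm_objective T ipK ipG (lam n) (\<xi> n) n (\<lambda>i. Xs i \<omega>) (\<lambda>i. Zs i \<omega>) (\<lambda>i. Ys i \<omega>))
           (\<lambda>(\<beta>, g). \<beta> \<in> HK \<and> g \<in> HG) (\<beta>h n \<omega>, gh n \<omega>)) \<and>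
      same_order (\<lambda>n. (lam n)\<^sup>2) (\<lambda>n. real n powr (- (2 * r / (2 * r + 1)))) \<and>
      same_order (\<lambda>n. (\<xi> n)\<^sup>2) (\<lambda>n. real n powr (- (2 * m / (2 * m + 1)))) \<and>
      same_order (\<lambda>n. (R n)\<^sup>2) (\<lambda>n. (\<xi> n)\<^sup>2) \<and>
      same_order (\<lambda>n. (R\<^sub>I n)\<^sup>2) (\<lambda>n. (lam n)\<^sup>2) \<and>
      (\<forall>\<^sub>F n in sequentially.
         (lam n)\<^sup>2 * (rkhs_norm ipK \<beta>0)\<^sup>2 + (\<xi> n)\<^sup>2 * (rkhs_norm ipG g0)\<^sup>2 \<le> \<delta>\<^sup>2 * (R n)\<^sup>2 \<and>
         lam n \<le> \<xi> n \<and> \<xi> n \<le> R n \<and>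
         (lam n)\<^sup>2 * (rkhs_norm ipK \<beta>0)\<^sup>2 \<le> \<delta>\<^sub>I\<^sup>2 * (R\<^sub>I n)\<^sup>2 \<and>
         lam n \<le> R\<^sub>I n \<and> R\<^sub>I n \<le> R n \<and> R n \<le> 1 \<and>
         R\<^sub>I n \<ge> R n * lam n / \<xi> n)
      \<longrightarrow>
      bigO_prob Q
        (\<lambda>n \<omega>. (rv_norm P (\<lambda>\<omega>'. (X \<omega>', Z \<omega>'))
           (\<lambda>u. plm_fun T (\<beta>h n \<omega>) (gh n \<omega>) u - plm_fun T \<beta>0 g0 u))\<^sup>2)
        (\<lambda>n. real n powr (- (2 * m / (2 * m + 1)))) \<and>
      bigO_prob Q
        (\<lambda>n \<omega>. (rv_norm P (\<lambda>\<omega>'. (X \<omega>', Z \<omega>')) (\<lambda>(x, z). gh n \<omega> z - g0 z))\<^sup>2)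
        (\<lambda>n. real n powr (- (2 * m / (2 * m + 1)))) \<and>
      bigO_prob Q
        (\<lambda>n \<omega>. (rv_norm P (\<lambda>\<omega>'. (X \<omega>', Z \<omega>'))
           (\<lambda>(x, z). \<integral>t. x t * (\<beta>h n \<omega> t - \<beta>0 t) \<partial>\<tau>))\<^sup>2)
        (\<lambda>n. real n powr (- (2 * r / (2 * r + 1))))"
proof -

  \<comment> \<open>The kernel spaces and the random curve of the model\<close>
  interpret P: prob_space P by (rule P)
  interpret Q: prob_space Q by (rule Q)
  have XZ: "X \<in> measurable P (l2_borel \<tau>)" "Z \<in> measurable P \<B>" by (rule X_meas(2), rule Z_meas)
  have space_\<B>: "space \<B> = ZZ" by (simp add: \<B>_def space_restrict_space)
  have space_\<tau>: "space \<tau> = T" by (simp add: \<tau>_def)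
  have T_leb: "T \<in> lmeasurable" using T by (rule lmeasurable_compact)
  obtain DK where DK: "\<And>t. t \<in> T \<Longrightarrow> \<bar>K t t\<bar> \<le> DK" "0 \<le> DK"
  proof -
    obtain d where "\<And>y. y \<in> (\<lambda>t. \<bar>K t t\<bar>) ` T \<Longrightarrow> y \<le> d" using D_K by (auto simp: bdd_above_def)
    \<comment> \<open>The maximum with 0 makes the bound nonnegative even when \<open>T\<close> is
      empty.\<close>
    then show thesis by (intro that[of "max d 0"]) (auto simp: le_max_iff_disj)
  qed
  obtain DG where DG: "\<And>z. z \<in> ZZ \<Longrightarrow> \<bar>G z z\<bar> \<le> DG" "0 \<le> DG"
  proof -
    obtain d where "\<And>y. y \<in> (\<lambda>z. \<bar>G z z\<bar>) ` ZZ \<Longrightarrow> y \<le> d" using D_G by (auto simp: bdd_above_def)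
    then show thesis by (intro that[of "max d 0"]) (auto simp: le_max_iff_disj)
  qed
  interpret RK: rkhs_in_l2 T K HK ipK DK \<tau>
  proof -
    interpret finite_measure \<tau> unfolding \<tau>_def by (rule finite_measure_lebesgue_on[OF T_leb])
    show "rkhs_in_l2 T K HK ipK DK \<tau>"
    proof
      show "f \<in> borel_measurable \<tau>" if "continuous_on T f" for f :: "real \<Rightarrow> real"
        unfolding \<tau>_def by (rule continuous_imp_measurable_on_sets_lebesgue[OF that fmeasurableD[OF T_leb]])
    qed (use HK K DK space_\<tau> in auto)
  qed
  interpret RG: rkhs_in_l2 ZZ G HG ipG DG \<rho>
  proof -
    interpret prob_space \<rho> unfolding \<rho>_def by (rule P.prob_space_distr[OF Z_meas])
    show "rkhs_in_l2 ZZ G HG ipG DG \<rho>"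
    proof
      show "f \<in> borel_measurable \<rho>" if "continuous_on ZZ f" for f :: "real ^ 'p \<Rightarrow> real"
        unfolding \<rho>_def measurable_distr_eq1 \<B>_def by (rule borel_measurable_continuous_on_restrict[OF that])
    qed (use HG G DG space_\<B> in \<open>auto simp: \<rho>_def\<close>)
  qed
  have \<rho>_meas: "f \<in> borel_measurable \<rho> \<Longrightarrow> f \<in> borel_measurable \<B>" for f :: "real ^ 'p \<Rightarrow> real"
    by (simp add: \<rho>_def)
  have HG_meas: "g \<in> borel_measurable \<B>" if "g \<in> HG" for g
    by (rule \<rho>_meas[OF sq_int_measurable[OF RG.mem_sq_int[OF that]]])
  have rc: "random_curve P \<tau> X"
    by (intro random_curve.intro random_curve_axioms.intro P RK.finite_measure_axioms X_meas X_sq_int)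
  interpret RC: random_curve P \<tau> X by (rule rc)

  \<comment> \<open>The joint law of the covariates and the i.i.d. sample\<close>
  define M where "M = l2_borel \<tau> \<Otimes>\<^sub>M \<B>"
  define V where "V \<omega> = (X \<omega>, Z \<omega>)" for \<omega>
  define \<mu> where "\<mu> = distr P M V"
  define W where "W i \<omega> = (Xs i \<omega>, Zs i \<omega>)" for i \<omega>
  have V: "V \<in> measurable P M" unfolding V_def[abs_def] M_def using XZ by simp
  have space_M: "space M = sq_int \<tau> \<times> ZZ" by (simp add: M_def space_pair_measure space_\<B>)
  have fst_M: "fst \<in> measurable M (l2_borel \<tau>)" and snd_M: "snd \<in> measurable M \<B>" by (simp_all add: M_def)
  have Y_meas: "Y \<in> borel_measurable P"
  proof -
    have "(\<lambda>\<omega>. l2_inner \<tau> (X \<omega>) \<beta>0 + g0 (Z \<omega>) + eps \<omega>) \<in> borel_measurable P"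
      using sq_int_measurable[OF RC.pairing_sq_int[OF RK.mem_sq_int[OF true_params(1)]]]
        measurable_compose[OF Z_meas HG_meas[OF true_params(2)]] eps_meas by simp
    then show ?thesis by (rule measurable_cong[THEN iffD2, rotated]) (simp add: Y l2_inner_def)
  qed
  have "iid_sample Q (l2_borel \<tau> \<Otimes>\<^sub>M \<B>) (distr P (l2_borel \<tau> \<Otimes>\<^sub>M \<B>) (\<lambda>\<omega>. (X \<omega>, Z \<omega>))) (\<lambda>i \<omega>. (Xs i \<omega>, Zs i \<omega>)) es"
    by (rule iid_sample_of_triples[OF Q sample_indep[unfolded XZY_space_def] _ XZ Y_meas errors_indep _ errors_design_indep])
      (use sample_law errors_normal in \<open>auto simp: XZY_space_def\<close>)
  then interpret S: iid_sample Q M \<mu> W es unfolding M_def \<mu>_def V_def[abs_def] W_def[abs_def] .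

  \<comment> \<open>Uncorrelated features of the two components\<close>
  obtain v where v: "RK.ortho_system v"
    and v_cov: "\<forall>j k. (\<integral>\<omega>. l2_inner \<tau> (X \<omega>) (v j) * l2_inner \<tau> (X \<omega>) (v k) \<partial>P)
       = (if j = k then (if 1 \<le> k \<and> 0 < s k then s k else 0) else 0)"
    and v_null: "\<forall>f\<in>HK. (\<forall>k. ipK f (v k) = 0) \<longrightarrow> (AE \<omega> in P. l2_inner \<tau> (X \<omega>) f = 0)"
    using functional_features[OF RK.rkhs_in_l2_axioms rc LK_half s] by (elim exE conjE) (rule that; assumption)
  obtain w where w: "RG.ortho_system w"
    and w_cov: "\<forall>j k. l2_inner \<rho> (w j) (w k) = (if j = k then (if 1 \<le> k \<and> 0 < s' k then s' k else 0) else 0)"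
    and w_null: "\<forall>f\<in>HG. (\<forall>k. ipG f (w k) = 0) \<longrightarrow> (AE z in \<rho>. f z = 0)"
    using nonparametric_features[OF RG.rkhs_in_l2_axioms s'(1)] by (elim exE conjE) (rule that; assumption)
  note v_cov = v_cov[rule_format] and v_null = v_null[rule_format]
    and w_cov = w_cov[rule_format] and w_null = w_null[rule_format]
  have vH: "v k \<in> HK" for k using v by (simp add: RK.ortho_system_def)
  have wH: "w k \<in> HG" for k using w by (simp add: RG.ortho_system_def)
  define \<sigma> where "\<sigma> k = (if 1 \<le> k \<and> 0 < s k then s k else 0)" for k
  define \<sigma>' where "\<sigma>' k = (if 1 \<le> k \<and> 0 < s' k then s' k else 0)" for k
  define x where "x k p = l2_inner \<tau> (fst p) (v k)" for k and p :: "(real \<Rightarrow> real) \<times> (real ^ 'p)"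
  define z where "z k p = w k (snd p)" for k and p :: "(real \<Rightarrow> real) \<times> (real ^ 'p)"
  \<comment> \<open>The first factor is the norm of the inclusion of \<open>HK\<close> into the
    square integrable functions, or a bound for it; the second bounds the curve, with the absolute
    value because \<open>D\<^sub>x\<close> carries no sign condition.\<close>
  define \<kappa> where "\<kappa> = sqrt (DK * measure \<tau> T) * \<bar>D\<^sub>x\<bar>"
  have \<kappa>0: "0 \<le> \<kappa>" using DK by (simp add: \<kappa>_def)
  have act_meas: "(\<lambda>p. l2_inner \<tau> (fst p) f) \<in> borel_measurable M" if "f \<in> HK" for f
    by (rule measurable_compose[OF fst_M measurable_l2_inner[OF RK.mem_sq_int[OF that]]])
  have act_meas': "(\<lambda>p. g (snd p)) \<in> borel_measurable M" if "g \<in> HG" for g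
    by (rule measurable_compose[OF snd_M HG_meas[OF that]])
  have bndK: "AE p in \<mu>. \<forall>f\<in>HK. \<bar>l2_inner \<tau> (fst p) f\<bar> \<le> \<kappa> * rkhs_norm ipK f"
  proof -
    have [measurable]: "(\<lambda>p. l2_norm \<tau> (fst p)) \<in> borel_measurable M"
      by (rule measurable_compose[OF fst_M measurable_l2_norm])
    have "AE p in \<mu>. l2_norm \<tau> (fst p) \<le> D\<^sub>x"
      unfolding \<mu>_def by (subst AE_distr_iff[OF V]) (use X_bounded in \<open>auto simp: V_def\<close>)
    then show ?thesis using AE_space
    proof eventually_elim
      case (elim p)
      have p: "fst p \<in> sq_int \<tau>" using elim(2) by (auto simp: \<mu>_def space_M)
      show ?case
      proof
        fix f assume f: "f \<in> HK"
        have "\<bar>l2_inner \<tau> (fst p) f\<bar> \<le> sqrt (DK * measure \<tau> T) * l2_norm \<tau> (fst p) * rkhs_norm ipK f"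
          by (rule RK.pairing_bound[OF p f])
        also have "\<dots> \<le> \<kappa> * rkhs_norm ipK f"
          unfolding \<kappa>_def using elim(1) DK RK.norm_ge0[OF f] by (intro mult_right_mono mult_left_mono) auto
        finally show "\<bar>l2_inner \<tau> (fst p) f\<bar> \<le> \<kappa> * rkhs_norm ipK f" .
      qed
    qed
  qed
  have bndG: "AE p in \<mu>. \<forall>g\<in>HG. \<bar>g (snd p)\<bar> \<le> sqrt DG * rkhs_norm ipG g"
    by (rule AE_I2) (auto simp: \<mu>_def space_M intro!: RG.eval_bound)
  obtain EK where EK: "countable EK" "EK \<subseteq> HK" "\<And>f. f \<in> HK \<Longrightarrow> (\<And>d. d \<in> EK \<Longrightarrow> ipK f d = 0) \<Longrightarrow> f = (\<lambda>x. 0)"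
    by (rule RK.countable_separating) blast
  obtain EG where EG: "countable EG" "EG \<subseteq> HG" "\<And>f. f \<in> HG \<Longrightarrow> (\<And>d. d \<in> EG \<Longrightarrow> ipG f d = 0) \<Longrightarrow> f = (\<lambda>x. 0)"
    by (rule RG.countable_separating) blast
  have linK: "l2_inner \<tau> (fst p) (\<lambda>t. a * f t + b * g t) = a * l2_inner \<tau> (fst p) f + b * l2_inner \<tau> (fst p) g"
    if "p \<in> space M" "f \<in> HK" "g \<in> HK" for p f g a b
    by (rule l2_inner_lin[OF RK.mem_sq_int RK.mem_sq_int]) (use that in \<open>auto simp: space_M\<close>)
  have v_cov': "(\<integral>\<omega>. l2_inner \<tau> (fst (V \<omega>)) (v j) * l2_inner \<tau> (fst (V \<omega>)) (v k) \<partial>P) = (if j = k then \<sigma> k else 0)" for j k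
    unfolding \<sigma>_def V_def fst_conv by (rule v_cov)
  have v_null': "AE \<omega> in P. l2_inner \<tau> (fst (V \<omega>)) f = 0" if "f \<in> HK" "\<And>k. ipK f (v k) = 0" for f
    unfolding V_def fst_conv by (rule v_null[OF that])
  note fbK = RK.feature_block_of_system[where act = "\<lambda>p. l2_inner \<tau> (fst p)",
      OF V linK act_meas bndK[unfolded \<mu>_def] \<kappa>0 v v_cov' v_null' EK]
  have blockK: "feature_block \<mu> x \<sigma> (\<kappa>\<^sup>2)"
    unfolding \<mu>_def x_def[abs_def] by (rule fbK(1))
  have sumsK: "AE p in \<mu>. \<forall>f\<in>HK. (\<lambda>k. ipK f (v k) * x k p) sums l2_inner \<tau> (fst p) f"
    unfolding \<mu>_def x_def[abs_def] by (rule fbK(2))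
  have w_cov': "(\<integral>\<omega>. w j (snd (V \<omega>)) * w k (snd (V \<omega>)) \<partial>P) = (if j = k then \<sigma>' k else 0)" for j k
    unfolding \<sigma>'_def w_cov[symmetric] l2_inner_def \<rho>_def V_def
    using integral_distr[OF Z_meas, of "\<lambda>z. w j z * w k z"] HG_meas[OF wH] by simp
  have w_null': "AE \<omega> in P. f (snd (V \<omega>)) = 0" if "f \<in> HG" "\<And>k. ipG f (w k) = 0" for f
    using AE_distrD[OF Z_meas w_null[OF that, unfolded \<rho>_def]] by (simp add: V_def)
  have DG': "0 \<le> sqrt DG" using DG by simp
  note fbG = RG.feature_block_of_system[where act = "\<lambda>p g. g (snd p)",
      OF V refl act_meas' bndG[unfolded \<mu>_def] DG' w w_cov' w_null' EG]
  have blockG: "feature_block \<mu> z \<sigma>' ((sqrt DG)\<^sup>2)"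
    unfolding \<mu>_def z_def[abs_def] by (rule fbG(1))
  have sumsG: "AE p in \<mu>. \<forall>g\<in>HG. (\<lambda>k. ipG g (w k) * z k p) sums g (snd p)"
    unfolding \<mu>_def z_def[abs_def] by (rule fbG(2))
  \<comment> \<open>Here \<open>E[X | Z] = 0\<close> enters; the bounded kernel makes each
    \<open>w k\<close> a bounded function of \<open>Z\<close>.\<close>
  have xz: "(\<integral>p. x j p * z k p \<partial>\<mu>) = 0" for j k
  proof -
    have "(\<integral>p. x j p * z k p \<partial>\<mu>) = (\<integral>\<omega>. l2_inner \<tau> (X \<omega>) (v j) * w k (Z \<omega>) \<partial>P)"
      unfolding \<mu>_def x_def z_def
      by (subst integral_distr[OF V]) (use act_meas[OF vH] act_meas'[OF wH] in \<open>auto simp: V_def\<close>)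
    also have "\<dots> = 0"
      by (rule RC.uncorrelated_of_cond_exp_zero[OF Z_meas X_given_Z[unfolded cond_exp_zero_def, folded \<tau>_def]
            HG_meas[OF wH] _ RK.mem_sq_int[OF vH]])
        (use RG.eval_bound[OF _ wH] in \<open>simp add: space_\<B>\<close>)
    finally show ?thesis .
  qed

  \<comment> \<open>Trace and decay bounds, expansions along the sample, and error norms in
    coefficients\<close>
  have trace: "(\<Sum>k<J. \<sigma> k) \<le> \<kappa>\<^sup>2" "(\<Sum>k<J. \<sigma>' k) \<le> (sqrt DG)\<^sup>2" for J
    using prob_space.feature_block_facts(8)[OF S.prob_space_mu blockK]
      prob_space.feature_block_facts(8)[OF S.prob_space_mu blockG] by auto
  have s0: "0 \<le> s k" if "k \<ge> 1" for k using s that by (simp add: l2_eigenvalues_def)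
  have decay: "\<sigma> k \<le> c1 * real k powr (- 2 * r)" "\<sigma>' k \<le> c2 * real k powr (- 2 * m)" if "k \<ge> 1" for k
    using s_decay s'_decay s0[OF that] s'(2) that by (auto simp: \<sigma>_def \<sigma>'_def not_less)
  have \<sigma>0: "0 \<le> \<sigma> k" "0 \<le> \<sigma>' k" for k by (auto simp: \<sigma>_def \<sigma>'_def)
  \<comment> \<open>One null set serves all observations and all elements of both kernel spaces, as
    the functions inserted later depend on the sample.\<close>
  have good: "AE \<omega> in Q. \<forall>i. (\<forall>f\<in>HK. (\<lambda>k. ipK f (v k) * x k (W i \<omega>)) sums l2_inner \<tau> (Xs i \<omega>) f) \<and>
      (\<forall>g\<in>HG. (\<lambda>k. ipG g (w k) * z k (W i \<omega>)) sums g (Zs i \<omega>))"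
    unfolding AE_all_countable
  proof
    fix i
    have "AE p in distr Q M (W i). (\<forall>f\<in>HK. (\<lambda>k. ipK f (v k) * x k p) sums l2_inner \<tau> (fst p) f) \<and>
        (\<forall>g\<in>HG. (\<lambda>k. ipG g (w k) * z k p) sums g (snd p))"
      unfolding S.law using sumsK sumsG by eventually_elim blast
    from AE_distrD[OF S.W_meas this]
    show "AE \<omega> in Q. (\<forall>f\<in>HK. (\<lambda>k. ipK f (v k) * x k (W i \<omega>)) sums l2_inner \<tau> (Xs i \<omega>) f) \<and>
      (\<forall>g\<in>HG. (\<lambda>k. ipG g (w k) * z k (W i \<omega>)) sums g (Zs i \<omega>))" by (simp add: W_def)
  qed
  \<comment> \<open>Used with \<open>f\<close> the functional error at a fixed sample outcome, so
    that the integral is over an independent copy of the covariates.\<close>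
  have errK: "(\<integral>\<omega>. (l2_inner \<tau> (X \<omega>) f)\<^sup>2 \<partial>P) = (\<Sum>k. \<sigma> k * (ipK f (v k))\<^sup>2)" if f: "f \<in> HK" for f
  proof -
    have m: "(\<lambda>p. l2_inner \<tau> (fst p) f) \<in> borel_measurable \<mu>" using act_meas[OF f] S.measurable_mu by simp
    have "(\<Sum>k. \<sigma> k * (ipK f (v k))\<^sup>2) = (\<integral>p. (l2_inner \<tau> (fst p) f)\<^sup>2 \<partial>\<mu>)"
      by (rule prob_space.feature_block_norm(2)[OF S.prob_space_mu blockK RK.bessel_partial[OF v f] _ m, symmetric])
        (use sumsK f in auto)
    also have "\<dots> = (\<integral>\<omega>. (l2_inner \<tau> (X \<omega>) f)\<^sup>2 \<partial>P)"
      unfolding \<mu>_def by (subst integral_distr[OF V]) (use act_meas[OF f] in \<open>auto simp: V_def\<close>)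
    finally show ?thesis by simp
  qed
  have errG: "(\<integral>\<omega>. (g (Z \<omega>))\<^sup>2 \<partial>P) = (\<Sum>k. \<sigma>' k * (ipG g (w k))\<^sup>2)"
    and intG: "integrable P (\<lambda>\<omega>. (g (Z \<omega>))\<^sup>2)" if g: "g \<in> HG" for g
  proof -
    have m: "(\<lambda>p. g (snd p)) \<in> borel_measurable \<mu>" using act_meas'[OF g] S.measurable_mu by simp
    have sm: "AE p in \<mu>. (\<lambda>k. ipG g (w k) * z k p) sums g (snd p)" using sumsG g by auto
    note n = prob_space.feature_block_norm[OF S.prob_space_mu blockG RG.bessel_partial[OF w g] sm m]
    show "integrable P (\<lambda>\<omega>. (g (Z \<omega>))\<^sup>2)"
      using n(1) integrable_distr_eq[OF V, of "\<lambda>p. (g (snd p))\<^sup>2"] act_meas'[OF g] by (simp add: \<mu>_def V_def)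
    show "(\<integral>\<omega>. (g (Z \<omega>))\<^sup>2 \<partial>P) = (\<Sum>k. \<sigma>' k * (ipG g (w k))\<^sup>2)"
      unfolding n(2)[symmetric] \<mu>_def
      by (subst integral_distr[OF V]) (use act_meas'[OF g] in \<open>auto simp: V_def\<close>)
  qed

  \<comment> \<open>The three rates for a given sequence of estimators\<close>
  have rates: "bigO_prob Q
        (\<lambda>n \<omega>. (rv_norm P (\<lambda>\<omega>'. (X \<omega>', Z \<omega>'))
           (\<lambda>u. plm_fun T (\<beta>h n \<omega>) (gh n \<omega>) u - plm_fun T \<beta>0 g0 u))\<^sup>2)
        (\<lambda>n. real n powr (- (2 * m / (2 * m + 1)))) \<and>
      bigO_prob Q
        (\<lambda>n \<omega>. (rv_norm P (\<lambda>\<omega>'. (X \<omega>', Z \<omega>')) (\<lambda>(x, z). gh n \<omega> z - g0 z))\<^sup>2)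
        (\<lambda>n. real n powr (- (2 * m / (2 * m + 1)))) \<and>
      bigO_prob Q
        (\<lambda>n \<omega>. (rv_norm P (\<lambda>\<omega>'. (X \<omega>', Z \<omega>'))
           (\<lambda>(x, z). \<integral>t. x t * (\<beta>h n \<omega> t - \<beta>0 t) \<partial>\<tau>))\<^sup>2)
        (\<lambda>n. real n powr (- (2 * r / (2 * r + 1))))"
    if pos: "\<forall>n\<ge>1. 0 < lam n \<and> 0 < \<xi> n"
      and amin: "\<forall>n\<ge>1. \<forall>\<omega>\<in>space Q. is_arg_min
           (plm_objective T ipK ipG (lam n) (\<xi> n) n (\<lambda>i. Xs i \<omega>) (\<lambda>i. Zs i \<omega>) (\<lambda>i. Ys i \<omega>))
           (\<lambda>(\<beta>, g). \<beta> \<in> HK \<and> g \<in> HG) (\<beta>h n \<omega>, gh n \<omega>)"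
      and ol: "same_order (\<lambda>n. (lam n)\<^sup>2) (\<lambda>n. real n powr (- (2 * r / (2 * r + 1))))"
      and ox: "same_order (\<lambda>n. (\<xi> n)\<^sup>2) (\<lambda>n. real n powr (- (2 * m / (2 * m + 1))))"
    for lam \<xi> :: "nat \<Rightarrow> real" and \<beta>h gh
  proof -
    obtain l1 l2 where l: "l1 > 0" "l2 > 0" and evl: "\<forall>\<^sub>F n in sequentially.
        l1 \<le> (lam n)\<^sup>2 / real n powr (- (2 * r / (2 * r + 1))) \<and> (lam n)\<^sup>2 / real n powr (- (2 * r / (2 * r + 1))) \<le> l2"
      by (rule same_order_bounds[OF ol])
    obtain x1 x2 where x12: "x1 > 0" "x2 > 0" and evx: "\<forall>\<^sub>F n in sequentially.
        x1 \<le> (\<xi> n)\<^sup>2 / real n powr (- (2 * m / (2 * m + 1))) \<and> (\<xi> n)\<^sup>2 / real n powr (- (2 * m / (2 * m + 1))) \<le> x2"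
      by (rule same_order_bounds[OF ox])
    have lbl: "\<forall>\<^sub>F n in sequentially. l1 \<le> (lam n)\<^sup>2 / real n powr (- (2 * r / (2 * r + 1)))"
      using evl by eventually_elim simp
    have lbx: "\<forall>\<^sub>F n in sequentially. x1 \<le> (\<xi> n)\<^sup>2 / real n powr (- (2 * m / (2 * m + 1)))"
      using evx by eventually_elim simp
    obtain NK where NK: "NK > 0" "\<forall>\<^sub>F n in sequentially. \<forall>J. (\<Sum>k<J. \<sigma> k / (\<sigma> k + (lam n)\<^sup>2)) \<le> NK * real n * (lam n)\<^sup>2"
      using effective_dimension[OF \<sigma>0(1) trace(1) decay(1) smoothness(2) l(1) lbl] by blast
    obtain NG where NG: "NG > 0" "\<forall>\<^sub>F n in sequentially. \<forall>J. (\<Sum>k<J. \<sigma>' k / (\<sigma>' k + (\<xi> n)\<^sup>2)) \<le> NG * real n * (\<xi> n)\<^sup>2"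
      using effective_dimension[OF \<sigma>0(2) trace(2) decay(2) smoothness(1) x12(1) lbx] by blast
    have NK': "\<forall>\<^sub>F n in sequentially. \<forall>J. (\<Sum>k<J. \<sigma> k / (\<sigma> k + (lam n)\<^sup>2)) \<le> (NK + NG) * real n * (lam n)\<^sup>2"
      using NK(2)
    proof eventually_elim
      case (elim n)
      have "NK * real n * (lam n)\<^sup>2 \<le> (NK + NG) * real n * (lam n)\<^sup>2" using NG(1) by (intro mult_right_mono) auto
      with elim show ?case by (meson order_trans)
    qed
    have NG': "\<forall>\<^sub>F n in sequentially. \<forall>J. (\<Sum>k<J. \<sigma>' k / (\<sigma>' k + (\<xi> n)\<^sup>2)) \<le> (NK + NG) * real n * (\<xi> n)\<^sup>2"
      using NG(2)
    proof eventually_elim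
      case (elim n)
      have "NG * real n * (\<xi> n)\<^sup>2 \<le> (NK + NG) * real n * (\<xi> n)\<^sup>2" using NK(1) by (intro mult_right_mono) auto
      with elim show ?case by (meson order_trans)
    qed
    have pos': "n \<ge> 1 \<Longrightarrow> 0 < lam n \<and> 0 < \<xi> n" for n using pos by blast
    \<comment> \<open>The exponent \<open>2 * r / (2 * r + 1)\<close> increases with
      \<open>r\<close>, so \<open>m < r\<close> leaves a gap between the two rates.\<close>
    have ratio: "(\<lambda>n. lam n / \<xi> n) \<longlonglongrightarrow> 0"
    proof (rule powr_ratio_tendsto_0[OF pos'])
      show "\<forall>\<^sub>F n in sequentially. (lam n)\<^sup>2 / real n powr - (2 * r / (2 * r + 1)) \<le> l2"
        using evl by eventually_elim simp
      show "\<forall>\<^sub>F n in sequentially. x1 \<le> (\<xi> n)\<^sup>2 / real n powr - (2 * m / (2 * m + 1))" by (rule lbx)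
      show "2 * m / (2 * m + 1) < 2 * r / (2 * r + 1)" using smoothness by (simp add: field_simps)
    qed (use x12 in auto)
    \<comment> \<open>This bounds both kernel norms of the truth; it enters through the bias, the
      inner product of the truth with the error.\<close>
    define B0 where "B0 = rkhs_norm ipK \<beta>0 + rkhs_norm ipG g0"
    have B0: "0 \<le> B0" "rkhs_norm ipK \<beta>0 \<le> B0" "rkhs_norm ipG g0 \<le> B0"
      using RK.norm_ge0[OF true_params(1)] RG.norm_ge0[OF true_params(2)] by (auto simp: B0_def)
    define db where "db n \<omega> t = \<beta>h n \<omega> t - \<beta>0 t" for n \<omega> t
    define dg where "dg n \<omega> z = gh n \<omega> z - g0 z" for n \<omega> z
    define errX where "errX n \<omega> = (\<integral>\<omega>'. (l2_inner \<tau> (X \<omega>') (db n \<omega>))\<^sup>2 \<partial>P)" for n \<omega>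
    define errZ where "errZ n \<omega> = (\<integral>\<omega>'. (dg n \<omega> (Z \<omega>'))\<^sup>2 \<partial>P)" for n \<omega>
    have est: "\<beta>h n \<omega> \<in> HK" "gh n \<omega> \<in> HG" if "n \<ge> 1" "\<omega> \<in> space Q" for n \<omega>
      using amin that by (auto simp: is_arg_min_def)
    have dH: "db n \<omega> \<in> HK" "dg n \<omega> \<in> HG" if "n \<ge> 1" "\<omega> \<in> space Q" for n \<omega>
      using RK.diff_mem[OF est(1)[OF that] true_params(1)] RG.diff_mem[OF est(2)[OF that] true_params(2)]
      by (simp_all add: db_def[abs_def] dg_def[abs_def])
    have key: "\<exists>C>0. \<forall>\<^sub>F n in sequentially. \<exists>A\<in>sets Q. measure Q A \<le> e \<and>
        (\<forall>\<omega>\<in>space Q - A. errX n \<omega> \<le> C * (lam n)\<^sup>2 \<and> errZ n \<omega> \<le> C * (\<xi> n)\<^sup>2)" if e: "e > 0" for e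
    proof -
      have NKG: "NK + NG > 0" using NK NG by simp
      obtain C where C: "C > 0" and ev: "\<forall>\<^sub>F n in sequentially. \<exists>A\<in>sets Q. measure Q A \<le> e \<and>
        (\<forall>\<omega>\<in>space Q - A. S.rate_bound x z \<sigma> \<sigma>' n (lam n) (\<xi> n) B0 C \<omega>)"
        using S.penalized_rates[OF blockK blockG xz pos NK' NG' NKG ratio e B0(1)]
        by (elim exE conjE) (rule that; assumption)
      obtain N0 where N0: "N0 \<in> null_sets Q" and goodN: "\<And>\<omega>. \<omega> \<in> space Q - N0 \<Longrightarrow>
          \<forall>i. (\<forall>f\<in>HK. (\<lambda>k. ipK f (v k) * x k (W i \<omega>)) sums l2_inner \<tau> (Xs i \<omega>) f) \<and>
            (\<forall>g\<in>HG. (\<lambda>k. ipG g (w k) * z k (W i \<omega>)) sums g (Zs i \<omega>))"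
        by (rule AE_E3[OF good]) (rule that; assumption)
      have "\<forall>\<^sub>F n in sequentially. \<exists>A\<in>sets Q. measure Q A \<le> e \<and>
        (\<forall>\<omega>\<in>space Q - A. errX n \<omega> \<le> C * (lam n)\<^sup>2 \<and> errZ n \<omega> \<le> C * (\<xi> n)\<^sup>2)"
        using ev eventually_ge_at_top[of 1]
      proof eventually_elim
        case (elim n)
        note n = elim(2)
        obtain A where A: "A \<in> sets Q" "measure Q A \<le> e" and A3: "\<forall>\<omega>\<in>space Q - A.
            S.rate_bound x z \<sigma> \<sigma>' n (lam n) (\<xi> n) B0 C \<omega>"
          using elim(1) by (elim bexE conjE) (rule that; assumption)
        show ?case
        proof (intro bexI[of _ "A \<union> N0"] conjI ballI)
          show "A \<union> N0 \<in> sets Q" using A N0 by auto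
          show "measure Q (A \<union> N0) \<le> e" using A N0 by (simp add: measure_Un_null_set)
          fix \<omega> assume "\<omega> \<in> space Q - (A \<union> N0)"
          then have \<omega>: "\<omega> \<in> space Q" "\<omega> \<in> space Q - A" "\<omega> \<in> space Q - N0" by auto
          let ?b = "db n \<omega>" and ?g = "dg n \<omega>" and ?bh = "\<beta>h n \<omega>" and ?gh = "gh n \<omega>"
          note bg = dH[OF n \<omega>(1)] and hh = est[OF n \<omega>(1)]
          have Xs: "Xs i \<omega> \<in> sq_int \<tau>" for i
            using measurable_space[OF S.W_meas[of i] \<omega>(1)] by (simp add: W_def space_M)
          define u where "u i = l2_inner \<tau> (Xs i \<omega>) ?b" for i
          define y where "y i = ?g (Zs i \<omega>)" for i
          have res: "Ys i \<omega> - (\<integral>t. Xs i \<omega> t * ?bh t \<partial>\<tau>) - ?gh (Zs i \<omega>) = es i \<omega> - (u i + y i)" for i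
          proof -
            have "u i = l2_inner \<tau> (Xs i \<omega>) ?bh - l2_inner \<tau> (Xs i \<omega>) \<beta>0"
              using l2_inner_lin[OF RK.mem_sq_int[OF hh(1)] RK.mem_sq_int[OF true_params(1)] Xs[of i], of 1 "-1"]
              by (simp add: u_def db_def[abs_def])
            then show ?thesis using Ys \<omega>(1) by (simp add: y_def dg_def l2_inner_def)
          qed
          have int: "\<forall>i<n. \<forall>f\<in>HK. integrable (lebesgue_on T) (\<lambda>t. Xs i \<omega> t * f t)"
            using sq_int_mult[OF Xs RK.mem_sq_int] by (simp add: \<tau>_def)
          have am: "is_arg_min (plm_objective T ipK ipG (lam n) (\<xi> n) n (\<lambda>i. Xs i \<omega>) (\<lambda>i. Zs i \<omega>) (\<lambda>i. Ys i \<omega>))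
             (\<lambda>(\<beta>, g). \<beta> \<in> HK \<and> g \<in> HG) (?bh, ?gh)" using amin n \<omega>(1) by blast
          \<comment> \<open>The direction \<open>(?b, ?g)\<close> yields the equation for the total
            error, the direction with second component 0 the one for the functional error.\<close>
          note ne = normal_equation[OF RK.hfs RG.hfs int am bg(1), folded \<tau>_def]
          have "(1 / real n) * (\<Sum>i<n. (es i \<omega> - (u i + y i)) * (u i + y i)) = (lam n)\<^sup>2 * ipK ?bh ?b + (\<xi> n)\<^sup>2 * ipG ?gh ?g"
            using ne[OF bg(2)] unfolding res by (simp add: u_def y_def l2_inner_def)
          then have eq1: "(1 / real n) * (\<Sum>i<n. (u i + y i)\<^sup>2) + (lam n)\<^sup>2 * ipK ?bh ?b + (\<xi> n)\<^sup>2 * ipG ?gh ?g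
              = (1 / real n) * (\<Sum>i<n. es i \<omega> * (u i + y i))"
            by (simp add: left_diff_distrib sum_subtractf right_diff_distrib diff_divide_distrib power2_eq_square)
          have "(1 / real n) * (\<Sum>i<n. (es i \<omega> - (u i + y i)) * u i) = (lam n)\<^sup>2 * ipK ?bh ?b"
            using ne[OF RG.zero_mem] RG.ip_zero(2)[OF hh(2)] unfolding res by (simp add: u_def l2_inner_def)
          then have eq2: "(1 / real n) * (\<Sum>i<n. u i * (u i + y i)) + (lam n)\<^sup>2 * ipK ?bh ?b
              = (1 / real n) * (\<Sum>i<n. es i \<omega> * u i)"
            by (simp add: left_diff_distrib sum_subtractf right_diff_distrib diff_divide_distrib mult.commute)
          \<comment> \<open>Writing the estimator as truth plus error turns the penalty term into
            the squared error norm plus a linear term, which Cauchy-Schwarz bounds.\<close>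
          have pK: "(rkhs_norm ipK ?b)\<^sup>2 - B0 * rkhs_norm ipK ?b \<le> ipK ?bh ?b"
          proof -
            have "ipK ?bh ?b = ipK ?b ?b + ipK \<beta>0 ?b"
              using RK.ip_lin[OF bg(1) true_params(1) bg(1), of 1 1] by (simp add: db_def[abs_def])
            moreover have "\<bar>ipK \<beta>0 ?b\<bar> \<le> B0 * rkhs_norm ipK ?b"
              using RK.Cauchy_Schwarz[OF true_params(1) bg(1)] mult_right_mono[OF B0(2) RK.norm_ge0[OF bg(1)]] by linarith
            ultimately show ?thesis using RK.norm_sq[OF bg(1)] by linarith
          qed
          have pG: "(rkhs_norm ipG ?g)\<^sup>2 - B0 * rkhs_norm ipG ?g \<le> ipG ?gh ?g"
          proof -
            have "ipG ?gh ?g = ipG ?g ?g + ipG g0 ?g"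
              using RG.ip_lin[OF bg(2) true_params(2) bg(2), of 1 1] by (simp add: dg_def[abs_def])
            moreover have "\<bar>ipG g0 ?g\<bar> \<le> B0 * rkhs_norm ipG ?g"
              using RG.Cauchy_Schwarz[OF true_params(2) bg(2)] mult_right_mono[OF B0(3) RG.norm_ge0[OF bg(2)]] by linarith
            ultimately show ?thesis using RG.norm_sq[OF bg(2)] by linarith
          qed
          have bK: "(\<Sum>k<J. (ipK ?b (v k))\<^sup>2) \<le> (rkhs_norm ipK ?b)\<^sup>2"
            and bG: "(\<Sum>k<J. (ipG ?g (w k))\<^sup>2) \<le> (rkhs_norm ipG ?g)\<^sup>2" for J
            using RK.bessel_partial[OF v bg(1)] RG.bessel_partial[OF w bg(2)]
            by (simp_all add: RK.norm_sq[OF bg(1)] RG.norm_sq[OF bg(2)])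
          have sK: "(\<lambda>k. ipK ?b (v k) * x k (W i \<omega>)) sums u i" and sG: "(\<lambda>k. ipG ?g (w k) * z k (W i \<omega>)) sums y i" for i
            using goodN[OF \<omega>(3)] bg by (auto simp: u_def y_def)
          have "(\<Sum>k. \<sigma> k * (ipK ?b (v k))\<^sup>2) \<le> C * (lam n)\<^sup>2 \<and> (\<Sum>k. \<sigma>' k * (ipG ?g (w k))\<^sup>2) \<le> C * (\<xi> n)\<^sup>2"
            using A3[THEN bspec, OF \<omega>(2), unfolded S.rate_bound_def, THEN spec, of "\<lambda>k. ipK ?b (v k)", THEN spec, of "rkhs_norm ipK ?b",
                THEN spec, of "\<lambda>k. ipG ?g (w k)", THEN spec, of "rkhs_norm ipG ?g", THEN spec, of u, THEN spec, of y,
                THEN spec, of "ipK ?bh ?b", THEN spec, of "ipG ?gh ?g"]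
              RK.norm_ge0[OF bg(1)] RG.norm_ge0[OF bg(2)] bK bG sK sG pK pG eq1 eq2 by simp
          then show "errX n \<omega> \<le> C * (lam n)\<^sup>2" "errZ n \<omega> \<le> C * (\<xi> n)\<^sup>2"
            by (simp_all add: errX_def errZ_def errK[OF bg(1)] errG[OF bg(2)])
        qed
      qed
      with C show ?thesis by blast
    qed
    have rv_sq: "(rv_norm P (\<lambda>\<omega>'. (X \<omega>', Z \<omega>')) f)\<^sup>2 = (\<integral>\<omega>'. (f (X \<omega>', Z \<omega>'))\<^sup>2 \<partial>P)" for f
    proof -
      have "0 \<le> (\<integral>\<omega>'. (f (X \<omega>', Z \<omega>'))\<^sup>2 \<partial>P)" by (rule integral_nonneg_AE) simp
      then show ?thesis by (simp add: rv_norm_def)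
    qed
    have third: "(rv_norm P (\<lambda>\<omega>'. (X \<omega>', Z \<omega>')) (\<lambda>(x, z). \<integral>t. x t * (\<beta>h n \<omega> t - \<beta>0 t) \<partial>\<tau>))\<^sup>2
        = errX n \<omega>" for n \<omega>
      by (simp add: errX_def rv_sq l2_inner_def db_def)
    have second: "(rv_norm P (\<lambda>\<omega>'. (X \<omega>', Z \<omega>')) (\<lambda>(x, z). gh n \<omega> z - g0 z))\<^sup>2
        = errZ n \<omega>" for n \<omega>
      by (simp add: errZ_def rv_sq dg_def)
    have first: "(rv_norm P (\<lambda>\<omega>'. (X \<omega>', Z \<omega>')) (\<lambda>u. plm_fun T (\<beta>h n \<omega>) (gh n \<omega>) u - plm_fun T \<beta>0 g0 u))\<^sup>2
        \<le> 2 * errX n \<omega> + 2 * errZ n \<omega>"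
      if n: "n \<ge> 1" and \<omega>: "\<omega> \<in> space Q" for n \<omega>
    proof -
      note bg = dH[OF n \<omega>] and hh = est[OF n \<omega>]
      let ?u = "\<lambda>\<omega>'. l2_inner \<tau> (X \<omega>') (db n \<omega>)" and ?w = "\<lambda>\<omega>'. dg n \<omega> (Z \<omega>')"
      have ui: "integrable P (\<lambda>\<omega>'. (?u \<omega>')\<^sup>2)"
        using RC.pairing_sq_int[OF RK.mem_sq_int[OF bg(1)]] by (simp add: sq_int_def)
      have wi: "integrable P (\<lambda>\<omega>'. (?w \<omega>')\<^sup>2)" by (rule intG[OF bg(2)])
      have "(\<integral>\<omega>'. (plm_fun T (\<beta>h n \<omega>) (gh n \<omega>) (X \<omega>', Z \<omega>') - plm_fun T \<beta>0 g0 (X \<omega>', Z \<omega>'))\<^sup>2 \<partial>P)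
          = (\<integral>\<omega>'. (?u \<omega>' + ?w \<omega>')\<^sup>2 \<partial>P)"
      proof (rule Bochner_Integration.integral_cong[OF refl])
        fix \<omega>' assume "\<omega>' \<in> space P"
        from l2_inner_lin[OF RK.mem_sq_int[OF hh(1)] RK.mem_sq_int[OF true_params(1)] RC.X_sq_int[OF this], of 1 "-1"]
        have "?u \<omega>' = l2_inner \<tau> (X \<omega>') (\<beta>h n \<omega>) - l2_inner \<tau> (X \<omega>') \<beta>0" by (simp add: db_def[abs_def])
        then have "plm_fun T (\<beta>h n \<omega>) (gh n \<omega>) (X \<omega>', Z \<omega>') - plm_fun T \<beta>0 g0 (X \<omega>', Z \<omega>') = ?u \<omega>' + ?w \<omega>'"
          unfolding plm_fun_def dg_def l2_inner_def \<tau>_def prod.case by linarith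
        then show "(plm_fun T (\<beta>h n \<omega>) (gh n \<omega>) (X \<omega>', Z \<omega>') - plm_fun T \<beta>0 g0 (X \<omega>', Z \<omega>'))\<^sup>2 = (?u \<omega>' + ?w \<omega>')\<^sup>2"
          by simp
      qed
      also have "\<dots> \<le> (\<integral>\<omega>'. 2 * (?u \<omega>')\<^sup>2 + 2 * (?w \<omega>')\<^sup>2 \<partial>P)"
      proof (rule integral_mono_AE')
        have "(a + b)\<^sup>2 \<le> 2 * a\<^sup>2 + 2 * b\<^sup>2" for a b :: real
          using sum_squares_bound[of a b] by (simp add: power2_sum)
        then show "AE \<omega>' in P. (?u \<omega>' + ?w \<omega>')\<^sup>2 \<le> 2 * (?u \<omega>')\<^sup>2 + 2 * (?w \<omega>')\<^sup>2" by simp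
      qed (use ui wi in auto)
      also have "\<dots> = 2 * (\<integral>\<omega>'. (?u \<omega>')\<^sup>2 \<partial>P) + 2 * (\<integral>\<omega>'. (?w \<omega>')\<^sup>2 \<partial>P)" using ui wi by simp
      finally show ?thesis by (simp add: errX_def errZ_def rv_sq)
    qed
    have lim_le: "\<forall>\<^sub>F n in sequentially. (lam n)\<^sup>2 \<le> (\<xi> n)\<^sup>2"
    proof -
      have "\<forall>\<^sub>F n in sequentially. lam n / \<xi> n < 1" using ratio by (rule order_tendstoD(2)) simp
      then show ?thesis using eventually_ge_at_top[of 1]
      proof eventually_elim
        case (elim n)
        then have "lam n < \<xi> n" "0 < lam n" using pos'[of n] by (auto simp: field_simps)
        then show ?case by (intro power_mono) auto
      qed
    qed
    have bpos: "\<forall>\<^sub>F n in sequentially. real n powr a > 0" for a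
      using eventually_ge_at_top[of 1] by eventually_elim simp
    have ubl: "\<forall>\<^sub>F n in sequentially. (lam n)\<^sup>2 / real n powr (- (2 * r / (2 * r + 1))) \<le> l2"
      using evl by eventually_elim simp
    have ubx: "\<forall>\<^sub>F n in sequentially. (\<xi> n)\<^sup>2 / real n powr (- (2 * m / (2 * m + 1))) \<le> x2"
      using evx by eventually_elim simp
    \<comment> \<open>The factor 4 is set by the prediction error: the square of a sum is at most
      twice the sum of squares, and both squares are bounded at the rate of \<open>\<xi>\<close>.
      The other two claims have room to spare.\<close>
    have rate: "bigO_prob Q U b"
      if dom: "\<And>C n \<omega>. C > 0 \<Longrightarrow> n \<ge> 1 \<Longrightarrow> \<omega> \<in> space Q \<Longrightarrow> (lam n)\<^sup>2 \<le> (\<xi> n)\<^sup>2 \<Longrightarrow>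
          errX n \<omega> \<le> C * (lam n)\<^sup>2 \<Longrightarrow> errZ n \<omega> \<le> C * (\<xi> n)\<^sup>2 \<Longrightarrow> \<bar>U n \<omega>\<bar> \<le> 4 * C * a n"
        and ub: "\<forall>\<^sub>F n in sequentially. a n / b n \<le> C'" "\<forall>\<^sub>F n in sequentially. b n > 0" "C' > 0"
      for U a b C'
    proof (rule bigO_prob_of_rate[OF _ ub])
      fix e :: real assume "e > 0"
      from key[OF this] obtain C where C: "C > 0" and ev: "\<forall>\<^sub>F n in sequentially. \<exists>A\<in>sets Q. measure Q A \<le> e \<and>
        (\<forall>\<omega>\<in>space Q - A. errX n \<omega> \<le> C * (lam n)\<^sup>2 \<and> errZ n \<omega> \<le> C * (\<xi> n)\<^sup>2)" by blast
      have "\<forall>\<^sub>F n in sequentially. \<exists>A\<in>sets Q. measure Q A \<le> e \<and> (\<forall>\<omega>\<in>space Q - A. \<bar>U n \<omega>\<bar> \<le> 4 * C * a n)"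
        using ev lim_le eventually_ge_at_top[of 1]
      proof eventually_elim
        case (elim n)
        obtain A where A: "A \<in> sets Q" "measure Q A \<le> e" and A3: "\<forall>\<omega>\<in>space Q - A.
          errX n \<omega> \<le> C * (lam n)\<^sup>2 \<and> errZ n \<omega> \<le> C * (\<xi> n)\<^sup>2" using elim(1) by blast
        show ?case
          by (intro bexI[OF _ A(1)] conjI ballI A(2) dom[OF C elim(3) _ elim(2)]) (use A3 in auto)
      qed
      moreover have "4 * C > 0" using C by simp
      ultimately show "\<exists>C>0. \<forall>\<^sub>F n in sequentially. \<exists>A\<in>sets Q. measure Q A \<le> e \<and>
          (\<forall>\<omega>\<in>space Q - A. \<bar>U n \<omega>\<bar> \<le> C * a n)" by blast
    qed
    have weaken: "y \<le> 4 * C * c\<^sup>2" if "y \<le> C * c\<^sup>2" "0 < C" for y C c :: real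
    proof -
      have "0 \<le> C * c\<^sup>2" using that(2) by simp
      with that(1) show ?thesis by linarith
    qed
    have "bigO_prob Q (\<lambda>n \<omega>. (rv_norm P (\<lambda>\<omega>'. (X \<omega>', Z \<omega>'))
           (\<lambda>(x, z). \<integral>t. x t * (\<beta>h n \<omega> t - \<beta>0 t) \<partial>\<tau>))\<^sup>2) (\<lambda>n. real n powr (- (2 * r / (2 * r + 1))))"
      by (rule rate[OF _ ubl bpos l(2)], unfold abs_power2, unfold third, rule weaken)
    moreover have "bigO_prob Q (\<lambda>n \<omega>. (rv_norm P (\<lambda>\<omega>'. (X \<omega>', Z \<omega>')) (\<lambda>(x, z). gh n \<omega> z - g0 z))\<^sup>2)
        (\<lambda>n. real n powr (- (2 * m / (2 * m + 1))))"
      by (rule rate[OF _ ubx bpos x12(2)], unfold abs_power2, unfold second, rule weaken)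
    moreover have "bigO_prob Q (\<lambda>n \<omega>. (rv_norm P (\<lambda>\<omega>'. (X \<omega>', Z \<omega>'))
           (\<lambda>u. plm_fun T (\<beta>h n \<omega>) (gh n \<omega>) u - plm_fun T \<beta>0 g0 u))\<^sup>2) (\<lambda>n. real n powr (- (2 * m / (2 * m + 1))))"
    proof (rule rate[OF _ ubx bpos x12(2)], unfold abs_power2)
      fix C n \<omega>
      assume *: "0 < C" "n \<ge> 1" "\<omega> \<in> space Q" "(lam n)\<^sup>2 \<le> (\<xi> n)\<^sup>2" "errX n \<omega> \<le> C * (lam n)\<^sup>2" "errZ n \<omega> \<le> C * (\<xi> n)\<^sup>2"
      from mult_left_mono[OF *(4), of C] have "C * (lam n)\<^sup>2 \<le> C * (\<xi> n)\<^sup>2" using *(1) by simp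
      then show "(rv_norm P (\<lambda>\<omega>'. (X \<omega>', Z \<omega>'))
           (\<lambda>u. plm_fun T (\<beta>h n \<omega>) (gh n \<omega>) u - plm_fun T \<beta>0 g0 u))\<^sup>2 \<le> 4 * C * (\<xi> n)\<^sup>2"
        using first[OF *(2,3)] *(5,6) by linarith
    qed
    ultimately show ?thesis by blast
  qed
  show ?thesis
    by (rule exI[of _ 1], intro conjI allI impI; (elim conjE)?; (rule zero_less_one | rule rates[THEN conjunct1] |
      rule rates[THEN conjunct2, THEN conjunct1] | rule rates[THEN conjunct2, THEN conjunct2]); assumption)
qed

end
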